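(* Let $\mathfrak{m}(t)$, $0\le t\le 1$, be the Brownian meander of length $1$ and let $\mu(\mathfrak{m})=\sup_{0\le u\le1}\mathfrak{m}(u)$. Then, as $\varepsilon\to0+$, $$ \mathsf{P}\{\mu(\mathfrak{m}) \leq \varepsilon \} \sim \frac{2\sqrt{2\pi}}{\varepsilon} \exp \left(- \frac{\pi^2}{2\varepsilon^2}\right). $$
   Context: The Brownian meander $\mathfrak{m}$ is, informally, a Brownian motion started at $0$ and conditioned to stay positive up to time $1$; rigorously, if $W$ is a standard Brownian motion and $g=\sup\{t\le1:W(t)=0\}$, then $\mathfrak{m}(t)=|W(g+t(1-g))|/\sqrt{1-g}$, $0\le t\le1$. The notation $f(\varepsilon)\sim g(\varepsilon)$ means $f(\varepsilon)/g(\varepsilon)\to1$. *)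

theory Defs
  imports "HOL-Probability.Probability" "HOL-Library.Landau_Symbols"
begin

(* Only times t >= 0 matter; start at 0 and path continuity are required almost surely. *)
definition standard_brownian_motion :: "'a measure \<Rightarrow> (real \<Rightarrow> 'a \<Rightarrow> real) \<Rightarrow> bool" where
  "standard_brownian_motion M W \<longleftrightarrow>
     prob_space M \<and>
     (\<forall>t\<ge>0. W t \<in> borel_measurable M) \<and>
     (AE \<omega> in M. W 0 \<omega> = 0) \<and>
     (\<forall>(n::nat) t. 0 \<le> t 0 \<and> (\<forall>i<n. t i \<le> t (Suc i)) \<longrightarrow>
        prob_space.indep_vars M (\<lambda>_. borel) (\<lambda>i \<omega>. W (t (Suc i)) \<omega> - W (t i) \<omega>) {..<n}) \<and>
     (\<forall>s t. 0 \<le> s \<and> s < t \<longrightarrow>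
        distributed M lborel (\<lambda>\<omega>. W t \<omega> - W s \<omega>) (normal_density 0 (sqrt (t - s)))) \<and>
     (AE \<omega> in M. continuous_on {0..} (\<lambda>t. W t \<omega>))"

definition last_zero :: "(real \<Rightarrow> 'a \<Rightarrow> real) \<Rightarrow> 'a \<Rightarrow> real" where
  "last_zero W \<omega> = Sup {t. 0 \<le> t \<and> t \<le> 1 \<and> W t \<omega> = 0}"

(* For a Brownian motion W, the last zero is almost surely < 1, so the value 0 produced by
   division by zero is only taken on a null set. *)
definition brownian_meander :: "(real \<Rightarrow> 'a \<Rightarrow> real) \<Rightarrow> real \<Rightarrow> 'a \<Rightarrow> real" where
  "brownian_meander W t \<omega> =
     \<bar>W (last_zero W \<omega> + t * (1 - last_zero W \<omega>)) \<omega>\<bar> / sqrt (1 - last_zero W \<omega>)"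

definition path_sup :: "(real \<Rightarrow> real) \<Rightarrow> real" where
  "path_sup f = (SUP u\<in>{0..1}. f u)"

(* As paths are only almost surely continuous, events about whole paths are measurable only up
   to null sets; their probability is therefore taken in the completion of M, which agrees with
   M on all sets measurable in M. *)
definition path_prob :: "'a measure \<Rightarrow> ('a \<Rightarrow> bool) \<Rightarrow> real" where
  "path_prob M P = measure (completion M) {\<omega> \<in> space M. P \<omega>}"

end

theory Submission
  imports Defs "HOL-Real_Asymp.Real_Asymp"
begin

text \<open>Let \<open>t\<close> be a grid point just to the right of the last zero and \<open>y = \<bar>W t\<bar> / sqrt (1 - t)\<close>, which is
  small. Given the past up to \<open>t\<close>, the path has no zero in \<open>[t, 1]\<close> with probability
  \<open>P(\<bar>N\<bar> \<le> y) \<sim> sqrt (2 / pi) * y\<close> (\<open>N\<close> standard normal), and it moreover stays below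
  \<open>\<epsilon> * sqrt (1 - t)\<close> with probability close to
  \<open>(4 / pi) * sin (pi * y / \<epsilon>) * exp (- pi\<^sup>2 / (2 * \<epsilon>\<^sup>2))\<close>, up to a relative error of order
  \<open>exp (- 4 * pi\<^sup>2 / \<epsilon>\<^sup>2)\<close>. By Brownian scaling the ratio of the two for \<open>y \<rightarrow> 0\<close> depends neither on
  \<open>t\<close> nor on the past. Summed over the grid cells that may contain the last zero, the
  probabilities of having no later zero add up to 1, so the probability in question equals
  that ratio up to errors vanishing with the mesh.

  The survival probabilities come from optional stopping: if \<open>\<phi>\<close> is antisymmetric about each
  boundary point of an interval, so is its heat flow, which therefore vanishes on the
  boundary; hence \<open>\<phi>\<close> has the same expectation at the final time with and without killing.
  The half-line uses truncations of the sign function, the strip a smoothed square wave with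
  an explicit Fourier series.\<close>

section \<open>Continuous Brownian motion and its past\<close>

text \<open>The constant arises as follows: for small \<open>y\<close> the strip probability is
  about \<open>4 * y / \<epsilon>\<close> times the exponential, the zero-free one about
  \<open>sqrt (2 / pi) * y\<close>, and \<open>4 / sqrt (2 / pi) = 2 * sqrt (2 * pi)\<close>. The
  last zero is not a stopping time, so the Markov property cannot be applied there. It is applied at
  the right end of the cell, where having just been near zero is an event of the past. Strip and
  zero-free probabilities are then integrals of two functions of \<open>y\<close> over the same past
  event, so it is enough to compare these functions for small \<open>y\<close>. For that, the
  Fourier error must be proportional to \<open>y\<close>, not merely small. The sign function and
  the square wave jump at the boundary, and a path watched on a grid overshoots it. For Lipschitz
  approximations the overshoot is harmless; the jump is restored by a limit afterwards. Limits are
  taken in the order: mesh, then the bound \<open>\<delta>\<close> on \<open>y\<close>, then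
  \<open>\<epsilon>\<close>. After the first two, the quotient of the probability and the claimed
  asymptotics is within \<open>wave_rest (1 / \<epsilon>\<^sup>2)\<close> of 1 for every positive
  \<open>\<epsilon>\<close>.\<close>

locale continuous_brownian_motion = prob_space M for M :: "'a measure" +
  fixes V :: "real \<Rightarrow> 'a \<Rightarrow> real"
  assumes measurable_V: "0 \<le> t \<Longrightarrow> V t \<in> borel_measurable M"
    and V_0: "\<omega> \<in> space M \<Longrightarrow> V 0 \<omega> = 0"
    and continuous_V: "\<omega> \<in> space M \<Longrightarrow> continuous_on {0..} (\<lambda>t. V t \<omega>)"
    and indep_increments: "\<And>(n::nat) t. 0 \<le> t 0 \<Longrightarrow> (\<And>i. i < n \<Longrightarrow> t i \<le> t (Suc i)) \<Longrightarrow>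
          indep_vars (\<lambda>_. borel) (\<lambda>i \<omega>. V (t (Suc i)) \<omega> - V (t i) \<omega>) {..<n}"
    and normal_increments: "0 \<le> s \<Longrightarrow> s < t \<Longrightarrow>
          distributed M lborel (\<lambda>\<omega>. V t \<omega> - V s \<omega>) (normal_density 0 (sqrt (t - s)))"
begin

definition past :: "real \<Rightarrow> 'a measure" where
  "past s = sigma (space M) {V r -` A \<inter> space M | r A. 0 \<le> r \<and> r \<le> s \<and> A \<in> sets borel}"

lemma space_past [simp]: "space (past s) = space M"
  unfolding past_def by (intro space_measure_of) auto

lemma sets_past: "sets (past s) =
    sigma_sets (space M) {V r -` A \<inter> space M | r A. 0 \<le> r \<and> r \<le> s \<and> A \<in> sets borel}"
  unfolding past_def by (intro sets_measure_of) auto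

lemma measurable_V_past: "0 \<le> r \<Longrightarrow> r \<le> s \<Longrightarrow> V r \<in> borel_measurable (past s)"
  by (rule measurableI) (auto simp: sets_past)

lemma sets_past_subset: "sets (past s) \<subseteq> sets M"
  unfolding sets_past by (rule sets.sigma_sets_subset) (auto intro: measurable_V measurable_sets)

lemma past_mono: "s \<le> t \<Longrightarrow> sets (past s) \<subseteq> sets (past t)"
  unfolding sets_past by (rule sigma_sets_mono') fastforce

lemma distr_increment:
  assumes "0 \<le> s" "s < t"
  shows "distr M borel (\<lambda>\<omega>. V t \<omega> - V s \<omega>) = distr std_normal_distribution borel (\<lambda>z. sqrt (t - s) * z)"
proof -
  have d: "distributed M lborel (\<lambda>\<omega>. V t \<omega> - V s \<omega>) (normal_density 0 (sqrt (t - s)))"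
    by (rule normal_increments[OF assms])
  have "distributed M lborel (\<lambda>\<omega>. ((V t \<omega> - V s \<omega>) - 0) / sqrt (t - s)) std_normal_density"
    using d assms by (subst normal_standard_normal_convert[symmetric]) auto
  then have e: "distr M lborel (\<lambda>\<omega>. (V t \<omega> - V s \<omega>) / sqrt (t - s)) = std_normal_distribution"
    by (simp add: distributed_def)
  have m: "(\<lambda>\<omega>. V t \<omega> - V s \<omega>) \<in> borel_measurable M"
    using assms by (intro borel_measurable_diff measurable_V) auto
  have "distr std_normal_distribution borel (\<lambda>z. sqrt (t - s) * z)
     = distr (distr M borel (\<lambda>\<omega>. (V t \<omega> - V s \<omega>) / sqrt (t - s))) borel (\<lambda>z. sqrt (t - s) * z)"
    unfolding e[symmetric] by (intro distr_cong) (auto intro!: distr_cong)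
  also have "\<dots> = distr M borel (\<lambda>\<omega>. V t \<omega> - V s \<omega>)"
    using m assms by (subst distr_distr) (auto simp: comp_def)
  finally show ?thesis by simp
qed

text \<open>The increments along dyadic subdivisions generate the past up to \<open>s\<close>, and the sets
  depending on finitely many of them form an intersection-stable generator.\<close>

lemma indep_past_increment:
  assumes s: "0 \<le> s" "s < t" and Z: "Z \<in> sets (past s)" and B: "B \<in> sets borel"
  shows "prob (Z \<inter> ((\<lambda>\<omega>. V t \<omega> - V s \<omega>) -` B \<inter> space M))
     = prob Z * prob ((\<lambda>\<omega>. V t \<omega> - V s \<omega>) -` B \<inter> space M)"
proof -
  \<comment> \<open>The indices up to \<open>2 ^ N\<close> subdivide \<open>[0, s]\<close>, and the
    next one jumps to \<open>t\<close>. Thus the increment with index \<open>2 ^ N\<close> is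
    \<open>V t - V s\<close>, and one application of \<open>indep_increments\<close> covers past and
    future together.\<close>
  define tt where "tt N j = (if j \<le> 2 ^ N then s * real j / 2 ^ N else t)" for N j :: nat
  define \<xi> where "\<xi> N i \<omega> = V (tt N (Suc i)) \<omega> - V (tt N i) \<omega>" for N i \<omega>
  define E where "E N i = {\<xi> N i -` A \<inter> space M | A. A \<in> sets borel}" for N i
  define G where "G N = sigma (space M) (\<Union>i\<in>{..<2 ^ N}. E N i)" for N :: nat
  define Y where "Y \<omega> = V t \<omega> - V s \<omega>" for \<omega>
  define EY where "EY = {Y -` A \<inter> space M | A. A \<in> sets borel}"
  have tt0: "0 \<le> tt N j" for N j using s by (auto simp: tt_def)
  have mxi: "\<xi> N i \<in> borel_measurable M" for N i
    unfolding \<xi>_def by (intro borel_measurable_diff measurable_V tt0)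
  have mY: "Y \<in> borel_measurable M"
    unfolding Y_def using s by (intro borel_measurable_diff measurable_V) auto
  have EE: "E N i \<subseteq> events" for N i using mxi by (auto simp: E_def)
  have EYE: "EY \<subseteq> events" using mY by (auto simp: EY_def)
  have space_G: "space (G N) = space M" for N
    unfolding G_def by (intro space_measure_of) (auto simp: E_def)
  have sets_G: "sets (G N) = sigma_sets (space M) (\<Union>i\<in>{..<2 ^ N}. E N i)" for N
    unfolding G_def by (intro sets_measure_of) (auto simp: E_def)
  have mxiG: "\<xi> N i \<in> borel_measurable (G N)" if "i < 2 ^ N" for N i
    by (rule measurableI) (use that in \<open>auto simp: space_G sets_G E_def\<close>)
  have GM: "sets (G N) \<subseteq> events" for N
    unfolding sets_G using EE by (intro sets.sigma_sets_subset) auto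
  have indepN: "indep_set (sets (G N)) (sigma_sets (space M) EY)" for N
  proof -
    have "indep_vars (\<lambda>_. borel) (\<xi> N) {..<Suc (2 ^ N)}"
      unfolding \<xi>_def
    proof (rule indep_increments)
      show "0 \<le> tt N 0" by (rule tt0)
      fix i assume "i < Suc (2 ^ N)"
      then have "real i \<le> 2 ^ N"
        by (metis less_Suc_eq_le of_nat_le_iff of_nat_numeral of_nat_power)
      then have "s * real i / 2 ^ N \<le> s"
        using s by (simp add: divide_le_eq mult_left_mono)
      then show "tt N i \<le> tt N (Suc i)"
        using s by (auto simp: tt_def divide_right_mono mult_left_mono)
    qed
    then have "indep_sets (E N) {..<Suc (2 ^ N)}"
      unfolding indep_vars_def2 E_def by auto
    moreover define I where "I = case_bool {..<(2::nat) ^ N} {2 ^ N}"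
    moreover have "(\<Union>j\<in>UNIV. I j) = {..<Suc (2 ^ N)}" by (auto simp: I_def UNIV_bool)
    ultimately have "indep_sets (E N) (\<Union>j\<in>UNIV. I j)" by simp
    then have "indep_sets (\<lambda>j. sigma_sets (space M) (\<Union>i\<in>I j. E N i)) UNIV"
    proof (rule indep_sets_collect_sigma)
      show "Int_stable (E N i)" for i
        unfolding E_def Int_stable_def
      proof safe
        fix A A' :: "real set" assume "A \<in> sets borel" "A' \<in> sets borel"
        then show "\<exists>B. \<xi> N i -` A \<inter> space M \<inter> (\<xi> N i -` A' \<inter> space M) = \<xi> N i -` B \<inter> space M
            \<and> B \<in> sets borel" by (intro exI[of _ "A \<inter> A'"]) auto
      qed
      show "disjoint_family_on I UNIV"
        unfolding disjoint_family_on_def I_def by (auto split: bool.splits)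
    qed
    moreover have "E N (2 ^ N) = EY"
      unfolding E_def EY_def \<xi>_def Y_def by (simp add: tt_def)
    ultimately show ?thesis
      unfolding indep_set_def
      by (elim indep_sets_mono_sets) (auto simp: I_def sets_G split: bool.splits)
  qed
  \<comment> \<open>Halving the mesh splits each increment into two of the next level, so the
    \<open>G N\<close> increase; this makes their union intersection-stable.\<close>
  have xi_split: "\<xi> N i \<omega> = \<xi> (Suc N) (2 * i) \<omega> + \<xi> (Suc N) (Suc (2 * i)) \<omega>" if "i < 2 ^ N" for N i \<omega>
  proof -
    have "tt N (Suc i) = tt (Suc N) (Suc (Suc (2 * i)))" "tt N i = tt (Suc N) (2 * i)"
      using that by (auto simp: tt_def field_simps)
    then show ?thesis by (simp add: \<xi>_def)
  qed
  have G_Suc: "sets (G N) \<subseteq> sets (G (Suc N))" for N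
  proof -
    have "E N i \<subseteq> sets (G (Suc N))" if "i < 2 ^ N" for i
    proof -
      have "(\<lambda>\<omega>. \<xi> (Suc N) (2 * i) \<omega> + \<xi> (Suc N) (Suc (2 * i)) \<omega>) \<in> borel_measurable (G (Suc N))"
        using that by (intro borel_measurable_add mxiG) auto
      then have "\<xi> N i \<in> borel_measurable (G (Suc N))"
        by (subst measurable_cong) (auto simp: xi_split[OF that])
      then show ?thesis using measurable_sets[of "\<xi> N i" "G (Suc N)" borel]
        by (auto simp: E_def space_G)
    qed
    then show ?thesis unfolding sets_G[of N]
      using sets.sigma_sets_subset[of "(\<Union>i\<in>{..<2 ^ N}. E N i)" "G (Suc N)"] by (auto simp: space_G)
  qed
  have G_mono: "sets (G m) \<subseteq> sets (G n)" if "m \<le> n" for m n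
    using that by (rule lift_Suc_mono_le[of "\<lambda>N. sets (G N)", OF G_Suc])
  have "indep_set (\<Union>N. sets (G N)) (sigma_sets (space M) EY)"
    unfolding indep_sets2_eq
  proof (intro conjI ballI)
    show "(\<Union>N. sets (G N)) \<subseteq> events" using GM by auto
    show "sigma_sets (space M) EY \<subseteq> events" using EYE by (intro sets.sigma_sets_subset)
    fix a b assume "a \<in> (\<Union>N. sets (G N))" "b \<in> sigma_sets (space M) EY"
    then show "prob (a \<inter> b) = prob a * prob b"
      using indepN unfolding indep_sets2_eq by blast
  qed
  moreover have "Int_stable (\<Union>N. sets (G N))"
    unfolding Int_stable_def
  proof safe
    fix a b m n assume "a \<in> sets (G m)" "b \<in> sets (G n)"
    then have "a \<in> sets (G (max m n))" "b \<in> sets (G (max m n))"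
      using G_mono[of m "max m n"] G_mono[of n "max m n"] by auto
    then show "a \<inter> b \<in> (\<Union>N. sets (G N))" by auto
  qed
  moreover have "Int_stable (sigma_sets (space M) EY)"
  proof -
    interpret sigma_algebra "space M" "sigma_sets (space M) EY"
      by (rule sigma_algebra_sigma_sets) (auto simp: EY_def)
    show ?thesis by (auto simp: Int_stable_def)
  qed
  ultimately have ind: "indep_set (sigma_sets (space M) (\<Union>N. sets (G N)))
      (sigma_sets (space M) (sigma_sets (space M) EY))"
    by (rule indep_set_sigma_sets)
  define H where "H = sigma (space M) (\<Union>N. sets (G N))"
  have H: "space H = space M" "sets H = sigma_sets (space M) (\<Union>N. sets (G N))"
    unfolding H_def using GM sets.sets_into_space
    by (auto intro!: space_measure_of sets_measure_of; blast)+
  have mVH: "V r \<in> borel_measurable H" if r: "0 \<le> r" "r \<le> s" for r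
  proof (cases "s = 0")
    case True
    then have "r = 0" using r by simp
    then have "V r \<in> borel_measurable H \<longleftrightarrow> (\<lambda>_. 0::real) \<in> borel_measurable H"
      by (intro measurable_cong) (simp add: H V_0)
    then show ?thesis by simp
  next
    case False
    then have s0: "0 < s" using s by simp
    \<comment> \<open>\<open>s * k N / 2 ^ N\<close> is \<open>r\<close> rounded down to level
      \<open>N\<close>. The value of \<open>V\<close> there is a telescoping sum of increments
      because \<open>V 0 = 0\<close>, and path continuity recovers \<open>V r\<close> in the
      limit.\<close>
    define k where "k N = nat \<lfloor>r / s * 2 ^ N\<rfloor>" for N :: nat
    have k_real: "real (k N) = of_int \<lfloor>r / s * 2 ^ N\<rfloor>" for N
      unfolding k_def using r s0 by simp
    have k_le: "k N \<le> 2 ^ N" for N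
    proof -
      have "r / s * 2 ^ N \<le> 1 * 2 ^ N" using r s0 by (intro mult_right_mono) auto
      then have "real (k N) \<le> 2 ^ N" unfolding k_real by linarith
      then show ?thesis by (metis of_nat_le_iff of_nat_numeral of_nat_power)
    qed
    have V_sum: "V (s * real (k N) / 2 ^ N) \<omega> = (\<Sum>i<k N. \<xi> N i \<omega>)" if "\<omega> \<in> space M" for N \<omega>
    proof -
      have "(\<Sum>i<k N. \<xi> N i \<omega>) = V (tt N (k N)) \<omega> - V (tt N 0) \<omega>"
        unfolding \<xi>_def by (rule sum_lessThan_telescope)
      then show ?thesis using k_le[of N] V_0[OF that] by (simp add: tt_def)
    qed
    have "(\<lambda>\<omega>. \<Sum>i<k N. \<xi> N i \<omega>) \<in> borel_measurable H" for N
    proof (intro borel_measurable_sum)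
      fix i assume "i \<in> {..<k N}"
      then have i: "i < 2 ^ N" using k_le[of N] by auto
      show "\<xi> N i \<in> borel_measurable H"
      proof (rule measurableI)
        fix A :: "real set" assume "A \<in> sets borel"
        then have "\<xi> N i -` A \<inter> space M \<in> sets (G N)"
          using measurable_sets[OF mxiG[OF i]] by (simp add: space_G)
        then show "\<xi> N i -` A \<inter> space H \<in> sets H" unfolding H by auto
      qed simp
    qed
    then have mk: "V (s * real (k N) / 2 ^ N) \<in> borel_measurable H" for N
      by (subst measurable_cong[of _ _ "\<lambda>\<omega>. \<Sum>i<k N. \<xi> N i \<omega>"]) (auto simp: H V_sum)
    have lim: "(\<lambda>N. s * real (k N) / 2 ^ N) \<longlonglongrightarrow> r"
    proof (rule tendsto_sandwich)
      have "r / s * 2 ^ N - 1 \<le> real (k N)" "real (k N) \<le> r / s * 2 ^ N" for N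
        unfolding k_real by linarith+
      then have "s * (r / s * 2 ^ N - 1) / 2 ^ N \<le> s * real (k N) / 2 ^ N"
        "s * real (k N) / 2 ^ N \<le> s * (r / s * 2 ^ N) / 2 ^ N" for N
        using s0 by (intro divide_right_mono mult_left_mono; simp)+
      moreover have "s * (r / s * 2 ^ N - 1) / 2 ^ N = r - s / 2 ^ N" "s * (r / s * 2 ^ N) / 2 ^ N = r" for N
        using s0 by (simp_all add: field_simps)
      ultimately have e1: "r - s / 2 ^ N \<le> s * real (k N) / 2 ^ N"
        and e2: "s * real (k N) / 2 ^ N \<le> r" for N by simp_all
      show "\<forall>\<^sub>F N in sequentially. r - s / 2 ^ N \<le> s * real (k N) / 2 ^ N"
        "\<forall>\<^sub>F N in sequentially. s * real (k N) / 2 ^ N \<le> r"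
        using s0 e1 e2 by (auto intro!: always_eventually)
      have "(\<lambda>N. r - s * (1 / 2) ^ N) \<longlonglongrightarrow> r - s * 0"
        by (rule tendsto_diff[OF tendsto_const tendsto_mult[OF tendsto_const LIMSEQ_power_zero]]) auto
      then show "(\<lambda>N. r - s / 2 ^ N) \<longlonglongrightarrow> r" by (simp add: power_one_over)
    qed auto
    show ?thesis
    proof (rule borel_measurable_LIMSEQ_real[OF _ mk])
      fix \<omega> assume "\<omega> \<in> space H"
      then have "continuous_on {0..} (\<lambda>t. V t \<omega>)" using continuous_V by (simp add: H)
      from continuous_on_tendsto_compose[OF this lim]
      show "(\<lambda>N. V (s * real (k N) / 2 ^ N) \<omega>) \<longlonglongrightarrow> V r \<omega>"
        using r s by auto
    qed
  qed
  have "sets (past s) \<subseteq> sets H"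
    unfolding sets_past
  proof (subst H(1)[symmetric], rule sets.sigma_sets_subset, safe)
    fix r and A :: "real set" assume "0 \<le> r" "r \<le> s" "A \<in> sets borel"
    then show "V r -` A \<inter> space M \<in> sets H" using measurable_sets[OF mVH] by (auto simp: H(1))
  qed
  then have "Z \<in> sigma_sets (space M) (\<Union>N. sets (G N))" using Z H by auto
  moreover have "Y -` B \<inter> space M \<in> sigma_sets (space M) (sigma_sets (space M) EY)"
    using B by (auto simp: EY_def)
  ultimately have "prob (Z \<inter> (Y -` B \<inter> space M)) = prob Z * prob (Y -` B \<inter> space M)"
    using ind unfolding indep_sets2_eq by blast
  then show ?thesis unfolding Y_def .
qed

end

section \<open>The heat semigroup and the Markov property\<close>

definition heat :: "real \<Rightarrow> (real \<Rightarrow> real) \<Rightarrow> real \<Rightarrow> real" where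
  "heat h \<phi> y = (\<integral>z. \<phi> (y + sqrt h * z) \<partial>std_normal_distribution)"

lemma prob_space_std_normal: "prob_space std_normal_distribution"
  using prob_space_normal_density[of 1 0] by simp

lemma heat_integrable:
  fixes \<phi> :: "real \<Rightarrow> real" and K :: real
  assumes "\<phi> \<in> borel_measurable borel" "\<And>x. \<bar>\<phi> x\<bar> \<le> K"
  shows "integrable std_normal_distribution (\<lambda>z. \<phi> (y + sqrt h * z))"
proof -
  interpret prob_space std_normal_distribution by (rule prob_space_std_normal)
  show ?thesis using assms by (intro integrable_const_bound[where B=K]) auto
qed

lemma heat_0 [simp]: "heat 0 \<phi> y = \<phi> y"
proof -
  interpret prob_space std_normal_distribution by (rule prob_space_std_normal)
  show ?thesis by (use prob_space in \<open>simp add: heat_def\<close>)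
qed

lemma heat_bounded:
  assumes "\<phi> \<in> borel_measurable borel" "\<And>x. \<bar>\<phi> x\<bar> \<le> K"
  shows "\<bar>heat h \<phi> y\<bar> \<le> K"
proof -
  interpret prob_space std_normal_distribution by (rule prob_space_std_normal)
  have "\<bar>heat h \<phi> y\<bar> \<le> (\<integral>z. \<bar>\<phi> (y + sqrt h * z)\<bar> \<partial>std_normal_distribution)"
    unfolding heat_def by (rule integral_abs_bound)
  also have "\<dots> \<le> (\<integral>z. K \<partial>std_normal_distribution)"
    using assms by (intro integral_mono integrable_abs heat_integrable) auto
  finally show ?thesis using prob_space by simp
qed

lemma heat_lipschitz:
  assumes "\<phi> \<in> borel_measurable borel" "\<And>x. \<bar>\<phi> x\<bar> \<le> K" and L: "\<And>x y. \<bar>\<phi> x - \<phi> y\<bar> \<le> L * \<bar>x - y\<bar>"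
  shows "\<bar>heat h \<phi> x - heat h \<phi> y\<bar> \<le> L * \<bar>x - y\<bar>"
proof -
  interpret prob_space std_normal_distribution by (rule prob_space_std_normal)
  note int = heat_integrable[OF assms(1,2)]
  have "\<bar>heat h \<phi> x - heat h \<phi> y\<bar> = \<bar>(\<integral>z. \<phi> (x + sqrt h * z) - \<phi> (y + sqrt h * z) \<partial>std_normal_distribution)\<bar>"
    unfolding heat_def using Bochner_Integration.integral_diff[OF int int] by simp
  also have "\<dots> \<le> (\<integral>z. \<bar>\<phi> (x + sqrt h * z) - \<phi> (y + sqrt h * z)\<bar> \<partial>std_normal_distribution)"
    by (rule integral_abs_bound)
  also have "\<dots> \<le> (\<integral>z. L * \<bar>x - y\<bar> \<partial>std_normal_distribution)"
  proof (rule integral_mono)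
    show "integrable std_normal_distribution (\<lambda>z. \<bar>\<phi> (x + sqrt h * z) - \<phi> (y + sqrt h * z)\<bar>)"
      by (rule integrable_abs[OF Bochner_Integration.integrable_diff[OF int int]])
    show "\<bar>\<phi> (x + sqrt h * z) - \<phi> (y + sqrt h * z)\<bar> \<le> L * \<bar>x - y\<bar>" for z
      using L[of "x + sqrt h * z" "y + sqrt h * z"] by simp
  qed simp
  finally show ?thesis using prob_space by simp
qed

lemma distr_std_normal_uminus: "distr std_normal_distribution borel uminus = std_normal_distribution"
proof -
  interpret prob_space std_normal_distribution by (rule prob_space_std_normal)
  have "distributed std_normal_distribution lborel (\<lambda>x. x) (normal_density 0 1)"
    unfolding distributed_def by (auto intro!: distr_id2)
  then have "distributed std_normal_distribution lborel (\<lambda>x. 0 + (-1) * x) (normal_density (0 + (-1) * 0) (\<bar>-1\<bar> * 1))"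
    by (rule normal_density_affine) auto
  then have "distr std_normal_distribution lborel (\<lambda>x. 0 + (-1) * x) = std_normal_distribution"
    unfolding distributed_def by simp
  moreover have "distr std_normal_distribution borel uminus = distr std_normal_distribution lborel (\<lambda>x. 0 + (-1) * x)"
    by (rule distr_cong) auto
  ultimately show ?thesis by simp
qed

text \<open>The substitution of \<open>- z\<close> for \<open>z\<close> preserves the normal law and
  negates the integrand, so the integral equals its own negative.\<close>

lemma heat_reflect:
  assumes "\<phi> \<in> borel_measurable borel" and odd: "\<And>x. \<phi> (2 * a - x) = - \<phi> x"
  shows "heat h \<phi> a = 0"
proof -
  have "heat h \<phi> a = (\<integral>z. \<phi> (a + sqrt h * z) \<partial>distr std_normal_distribution borel uminus)"
    unfolding heat_def distr_std_normal_uminus ..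
  also have "\<dots> = (\<integral>z. \<phi> (a + sqrt h * (- z)) \<partial>std_normal_distribution)"
    using assms(1) by (intro integral_distr) auto
  also have "\<dots> = (\<integral>z. - \<phi> (a + sqrt h * z) \<partial>std_normal_distribution)"
    using odd[of "a + sqrt h * z" for z] by (intro Bochner_Integration.integral_cong) (auto simp: algebra_simps)
  also have "\<dots> = - heat h \<phi> a" unfolding heat_def by simp
  finally show ?thesis by simp
qed

lemma borel_measurable_heat:
  assumes [measurable]: "\<phi> \<in> borel_measurable borel"
  shows "heat h \<phi> \<in> borel_measurable borel"
proof -
  interpret prob_space std_normal_distribution by (rule prob_space_std_normal)
  show ?thesis unfolding heat_def by measurable
qed

context continuous_brownian_motion
begin

text \<open>\<open>indep_var\<close> relates variables with the same value type; \<open>g\<close>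
  embeds the real increment into the type of \<open>X\<close>. The Markov property takes
  \<open>y\<close> to \<open>(0, y)\<close>.\<close>

lemma indep_var_past_increment:
  fixes X :: "'a \<Rightarrow> 'c" and g :: "real \<Rightarrow> 'c"
  assumes s: "0 \<le> s" "s < t" and X: "X \<in> measurable (past s) N" and g: "g \<in> measurable borel N'"
  shows "indep_var N X N' (\<lambda>\<omega>. g (V t \<omega> - V s \<omega>))"
proof -
  define Y where "Y \<omega> = g (V t \<omega> - V s \<omega>)" for \<omega>
  have mD: "(\<lambda>\<omega>. V t \<omega> - V s \<omega>) \<in> borel_measurable M"
    using s by (intro borel_measurable_diff measurable_V) auto
  have mY: "Y \<in> measurable M N'"
    unfolding Y_def by (rule measurable_compose[OF mD g])
  have XM: "X \<in> measurable M N"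
    using X sets_past_subset[of s] by (auto simp: measurable_def)
  have "indep_set {X -` A \<inter> space M |A. A \<in> sets N} {Y -` A \<inter> space M |A. A \<in> sets N'}"
    unfolding indep_sets2_eq
  proof (intro conjI ballI)
    fix a b assume "a \<in> {X -` A \<inter> space M |A. A \<in> sets N}" "b \<in> {Y -` A \<inter> space M |A. A \<in> sets N'}"
    then obtain B where "a \<in> sets (past s)" "b = (\<lambda>\<omega>. V t \<omega> - V s \<omega>) -` (g -` B) \<inter> space M" "B \<in> sets N'"
      using measurable_sets[OF X] by (auto simp: Y_def vimage_def)
    then show "prob (a \<inter> b) = prob a * prob b"
      using indep_past_increment[OF s, of a "g -` B"] measurable_sets[OF g, of B] by simp
  qed (use XM mY in auto)
  moreover have "Int_stable {X -` A \<inter> space M |A. A \<in> sets N}" for X :: "'a \<Rightarrow> 'c" and N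
    unfolding Int_stable_def
  proof safe
    fix A B assume "A \<in> sets N" "B \<in> sets N"
    then show "\<exists>C. X -` A \<inter> space M \<inter> (X -` B \<inter> space M) = X -` C \<inter> space M \<and> C \<in> sets N"
      by (intro exI[of _ "A \<inter> B"]) auto
  qed
  ultimately have "indep_set (sigma_sets (space M) {X -` A \<inter> space M |A. A \<in> sets N})
      (sigma_sets (space M) {Y -` A \<inter> space M |A. A \<in> sets N'})"
    by (intro indep_set_sigma_sets)
  then show ?thesis
    unfolding indep_var_eq using XM mY unfolding Y_def by auto
qed

text \<open>Write \<open>V t\<close> as \<open>V s\<close> plus an increment. The pair of
  \<open>indicator Z\<close> and \<open>V s\<close> is a function of the past, hence independent of
  the increment, and Fubini integrates the increment out first.\<close>

lemma markov_property:
  assumes s: "0 \<le> s" "s \<le> t" and Z: "Z \<in> sets (past s)"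
    and phi [measurable]: "\<phi> \<in> borel_measurable borel" and K: "\<And>x. \<bar>\<phi> x\<bar> \<le> K"
  shows "(\<integral>\<omega>. indicator Z \<omega> * \<phi> (V t \<omega>) \<partial>M) = (\<integral>\<omega>. indicator Z \<omega> * heat (t - s) \<phi> (V s \<omega>) \<partial>M)"
proof (cases "s = t")
  case False
  with s have st: "s < t" by simp
  define Y where "Y \<omega> = V t \<omega> - V s \<omega>" for \<omega>
  define X where "X \<omega> = (indicator Z \<omega> :: real, V s \<omega>)" for \<omega>
  \<comment> \<open>The first pair carries \<open>indicator Z\<close> and \<open>V s\<close>; the
    second carries a dummy 0 and the increment. Testing the first entry for 1 recovers the event
    \<open>Z\<close>.\<close>
  define f :: "(real \<times> real) \<times> real \<times> real \<Rightarrow> real"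
    where "f = (\<lambda>(x, y). indicator {1} (fst x) * \<phi> (snd x + snd y))"
  have [measurable]: "Y \<in> borel_measurable M"
    unfolding Y_def using s by (intro borel_measurable_diff measurable_V) auto
  have mX: "X \<in> measurable (past s) (borel \<Otimes>\<^sub>M borel)"
    unfolding X_def using Z s by (intro measurable_Pair borel_measurable_indicator measurable_V_past) auto
  have [measurable]: "X \<in> measurable M (borel \<Otimes>\<^sub>M borel)"
    using mX sets_past_subset[of s] by (auto simp: measurable_def)
  have [measurable]: "f \<in> borel_measurable ((borel \<Otimes>\<^sub>M borel) \<Otimes>\<^sub>M (borel \<Otimes>\<^sub>M borel))"
    unfolding f_def by measurable
  have fK: "\<bar>f p\<bar> \<le> K" for p
    using K[of "snd (fst p) + snd (snd p)"] order_trans[OF abs_ge_zero K[of 0]]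
    by (auto simp: f_def case_prod_beta indicator_def)
  have iv: "indep_var (borel \<Otimes>\<^sub>M borel) X (borel \<Otimes>\<^sub>M borel) (\<lambda>\<omega>. (0::real, Y \<omega>))"
    unfolding Y_def by (rule indep_var_past_increment[OF s(1) st mX]) auto
  define DX where "DX = distr M (borel \<Otimes>\<^sub>M borel) X"
  define DY where "DY = distr M (borel \<Otimes>\<^sub>M borel) (\<lambda>\<omega>. (0::real, Y \<omega>))"
  interpret DX: prob_space DX unfolding DX_def by (rule prob_space_distr) measurable
  interpret DY: prob_space DY unfolding DY_def by (rule prob_space_distr) measurable
  interpret P: pair_prob_space DX DY ..
  have "(\<integral>\<omega>. indicator Z \<omega> * \<phi> (V t \<omega>) \<partial>M) = (\<integral>\<omega>. f (X \<omega>, 0, Y \<omega>) \<partial>M)"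
    by (intro Bochner_Integration.integral_cong) (auto simp: f_def X_def Y_def indicator_def)
  also have "\<dots> = (\<integral>p. f p \<partial>distr M ((borel \<Otimes>\<^sub>M borel) \<Otimes>\<^sub>M (borel \<Otimes>\<^sub>M borel)) (\<lambda>\<omega>. (X \<omega>, 0, Y \<omega>)))"
    by (subst integral_distr) auto
  also have "\<dots> = (\<integral>p. f p \<partial>(DX \<Otimes>\<^sub>M DY))"
    using indep_var_distribution_eq[THEN iffD1, OF iv] unfolding DX_def DY_def by simp
  also have "\<dots> = (\<integral>x. (\<integral>y. f (x, y) \<partial>DY) \<partial>DX)"
  proof (rule P.integral_fst'[symmetric])
    show "integrable (DX \<Otimes>\<^sub>M DY) f"
      by (rule P.integrable_const_bound[where B=K]) (use fK in \<open>auto simp: DX_def DY_def\<close>)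
  qed
  also have "\<dots> = (\<integral>x. indicator {1} (fst x) * heat (t - s) \<phi> (snd x) \<partial>DX)"
  proof (intro Bochner_Integration.integral_cong refl)
    fix x
    have "(\<integral>y. f (x, y) \<partial>DY) = (\<integral>\<omega>. indicator {1} (fst x) * \<phi> (snd x + Y \<omega>) \<partial>M)"
      unfolding DY_def by (subst integral_distr) (auto simp: f_def)
    also have "\<dots> = (\<integral>y. indicator {1} (fst x) * \<phi> (snd x + y) \<partial>distr M borel Y)"
      by (subst integral_distr) auto
    also have "\<dots> = (\<integral>y. indicator {1} (fst x) * \<phi> (snd x + y) \<partial>distr std_normal_distribution borel (\<lambda>z. sqrt (t - s) * z))"
      unfolding Y_def distr_increment[OF s(1) st] ..
    also have "\<dots> = (\<integral>z. indicator {1} (fst x) * \<phi> (snd x + sqrt (t - s) * z) \<partial>std_normal_distribution)"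
      by (subst integral_distr) auto
    also have "\<dots> = indicator {1} (fst x) * heat (t - s) \<phi> (snd x)"
      unfolding heat_def by simp
    finally show "(\<integral>y. f (x, y) \<partial>DY) = indicator {1} (fst x) * heat (t - s) \<phi> (snd x)" .
  qed
  also have "\<dots> = (\<integral>\<omega>. indicator {1} (fst (X \<omega>)) * heat (t - s) \<phi> (snd (X \<omega>)) \<partial>M)"
    unfolding DX_def using borel_measurable_heat[OF phi] by (subst integral_distr) auto
  also have "\<dots> = (\<integral>\<omega>. indicator Z \<omega> * heat (t - s) \<phi> (V s \<omega>) \<partial>M)"
    by (intro Bochner_Integration.integral_cong) (auto simp: X_def indicator_def)
  finally show ?thesis .
qed simp

end

section \<open>Survival in a closed set\<close>

definition grid :: "real \<Rightarrow> real \<Rightarrow> nat \<Rightarrow> nat \<Rightarrow> real" where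
  "grid s t m j = s + (t - s) * real j / real (Suc m)"

lemma grid_0 [simp]: "grid s t m 0 = s"
  by (simp add: grid_def)

lemma grid_step: "grid s t m (Suc j) - grid s t m j = (t - s) / real (Suc m)"
proof -
  have "grid s t m (Suc j) - grid s t m j = ((t - s) * real (Suc j) - (t - s) * real j) / real (Suc m)"
    by (simp add: grid_def diff_divide_distrib)
  then show ?thesis by (simp add: algebra_simps)
qed

lemma grid_bounds:
  assumes "s \<le> t"
  shows "s \<le> grid s t m j" and "j \<le> Suc m \<Longrightarrow> grid s t m j \<le> t"
proof -
  show "s \<le> grid s t m j" using assms by (simp add: grid_def)
  assume "j \<le> Suc m"
  then have "real j \<le> real (Suc m)" by linarith
  then have "(t - s) * real j \<le> (t - s) * real (Suc m)" using assms by (intro mult_left_mono) auto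
  then have "(t - s) * real j / real (Suc m) \<le> t - s" by (simp add: divide_le_eq)
  then show "grid s t m j \<le> t" by (simp add: grid_def)
qed

lemma grid_dense:
  assumes "s \<le> r" "r \<le> t"
  obtains j where "j \<le> Suc m" "\<bar>grid s t m j - r\<bar> \<le> (t - s) / real (Suc m)"
proof (cases "s = t")
  case True
  with assms that[of 0] show ?thesis by simp
next
  case False
  with assms have st: "s < t" by simp
  define x where "x = (r - s) / (t - s) * real (Suc m)"
  have x0: "0 \<le> x" using assms st by (simp add: x_def)
  have "x \<le> 1 * real (Suc m)" unfolding x_def using assms st by (intro mult_right_mono) auto
  then have "\<lfloor>x\<rfloor> \<le> int (Suc m)" by (simp add: floor_le_iff)
  then have "nat \<lfloor>x\<rfloor> \<le> Suc m" by linarith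
  moreover have "\<bar>grid s t m (nat \<lfloor>x\<rfloor>) - r\<bar> \<le> (t - s) / real (Suc m)"
  proof -
    have "r = s + (t - s) * x / real (Suc m)" using st by (simp add: x_def)
    then have "grid s t m (nat \<lfloor>x\<rfloor>) - r = (t - s) / real (Suc m) * (real (nat \<lfloor>x\<rfloor>) - x)"
      unfolding grid_def by (simp add: algebra_simps diff_divide_distrib)
    moreover have "\<bar>real (nat \<lfloor>x\<rfloor>) - x\<bar> \<le> 1" using x0 by linarith
    ultimately show ?thesis using st
      by (simp add: abs_mult mult_left_le divide_right_mono)
  qed
  ultimately show ?thesis by (rule that)
qed

lemma eventually_mesh_less:
  assumes "0 < \<delta>"
  shows "\<forall>\<^sub>F m in sequentially. c / real (Suc m) < \<delta>"
proof -
  have "(\<lambda>m. c / real (Suc m)) \<longlonglongrightarrow> 0"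
    by (rule LIMSEQ_Suc[OF lim_const_over_n])
  then show ?thesis using assms by (rule order_tendstoD)
qed

text \<open>At most one summand is nonzero, so the bound does not grow with the number of grid
  points over which the first exit is summed.\<close>

lemma abs_sum_indicator_disjoint_le:
  fixes f :: "nat \<Rightarrow> real"
  assumes "disjoint_family_on T J" "finite J" "0 \<le> b" "\<And>j. j \<in> J \<Longrightarrow> \<omega> \<in> T j \<Longrightarrow> \<bar>f j\<bar> \<le> b"
  shows "\<bar>\<Sum>j\<in>J. indicator (T j) \<omega> * f j\<bar> \<le> b"
proof (cases "\<exists>j\<in>J. \<omega> \<in> T j")
  case True
  then obtain i where i: "i \<in> J" "\<omega> \<in> T i" by blast
  have "(\<Sum>j\<in>J. indicator (T j) \<omega> * f j) = (\<Sum>j\<in>J. if j = i then f i else 0)"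
    using assms(1) i by (intro sum.cong) (auto simp: indicator_def disjoint_family_on_def)
  also have "\<dots> = f i" using assms(2) i by simp
  finally show ?thesis using assms(4)[OF i] by simp
next
  case False
  then have "(\<Sum>j\<in>J. indicator (T j) \<omega> * f j) = 0" by (intro sum.neutral) auto
  with assms(3) show ?thesis by simp
qed

context continuous_brownian_motion
begin

definition stay :: "real \<Rightarrow> real \<Rightarrow> real set \<Rightarrow> 'a set" where
  "stay s t D = {\<omega> \<in> space M. \<forall>r\<in>{s..t}. V r \<omega> \<in> D}"

text \<open>The complement of \<open>D\<close> is open, so a continuous path that is outside
  \<open>D\<close> once is outside during a whole time neighbourhood, which every sufficiently fine
  grid meets.\<close>

lemma grid_exit:
  assumes "\<omega> \<in> space M" "closed D" "0 \<le> s" "\<omega> \<notin> stay s t D"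
  shows "\<forall>\<^sub>F m in sequentially. \<exists>j\<le>Suc m. V (grid s t m j) \<omega> \<notin> D"
proof -
  obtain r where r: "s \<le> r" "r \<le> t" "V r \<omega> \<notin> D" using assms by (auto simp: stay_def)
  have "\<forall>\<^sub>F r' in at r within {0..}. V r' \<omega> \<in> - D"
    using continuous_V[OF assms(1)] r assms(2,3)
    by (intro topological_tendstoD[where l="V r \<omega>"]) (auto simp: continuous_on_def)
  then obtain \<delta> where \<delta>: "0 < \<delta>" and
    "\<forall>r'\<in>{0..}. r' \<noteq> r \<and> dist r' r < \<delta> \<longrightarrow> V r' \<omega> \<in> - D"
    unfolding eventually_at by blast
  then have \<delta>': "V r' \<omega> \<notin> D" if "0 \<le> r'" "\<bar>r' - r\<bar> < \<delta>" for r'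
    using that r(3) by (cases "r' = r") (auto simp: dist_real_def)
  show ?thesis
    using eventually_mesh_less[OF \<delta>, of "t - s"]
  proof eventually_elim
    case (elim m)
    obtain j where j: "j \<le> Suc m" "\<bar>grid s t m j - r\<bar> \<le> (t - s) / real (Suc m)"
      using grid_dense[OF r(1,2)] by blast
    moreover have "0 \<le> grid s t m j" using grid_bounds(1)[of s t m j] r assms by simp
    ultimately have "V (grid s t m j) \<omega> \<notin> D" using elim by (intro \<delta>') linarith+
    with j(1) show ?case by blast
  qed
qed

text \<open>By \<open>grid_exit\<close>, staying in \<open>D\<close> at uncountably many times
  amounts to staying there at the countably many grid times.\<close>

lemma stay_sets_past:
  assumes "0 \<le> s" "s \<le> t" "closed D"
  shows "stay s t D \<in> sets (past t)"
proof -
  have "stay s t D = (\<Inter>m. {\<omega> \<in> space (past t). \<forall>j\<in>{..Suc m}. V (grid s t m j) \<omega> \<in> D})"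
  proof (intro equalityI subsetI)
    fix \<omega> assume "\<omega> \<in> stay s t D"
    then show "\<omega> \<in> (\<Inter>m. {\<omega> \<in> space (past t). \<forall>j\<in>{..Suc m}. V (grid s t m j) \<omega> \<in> D})"
      using grid_bounds[OF assms(2)] by (auto simp: stay_def)
  next
    fix \<omega> assume *: "\<omega> \<in> (\<Inter>m. {\<omega> \<in> space (past t). \<forall>j\<in>{..Suc m}. V (grid s t m j) \<omega> \<in> D})"
    then have "\<omega> \<in> space M" by simp
    moreover have "\<not> (\<forall>\<^sub>F m in sequentially. \<exists>j\<le>Suc m. V (grid s t m j) \<omega> \<notin> D)"
      using * by (auto simp: eventually_sequentially)
    ultimately show "\<omega> \<in> stay s t D" using grid_exit assms by blast
  qed
  also have "\<dots> \<in> sets (past t)"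
  proof (intro sets.countable_INT subsetI, elim rangeE, simp only:, intro sets.sets_Collect_finite_All)
    fix m j assume "j \<in> {..Suc m}"
    then have "V (grid s t m j) \<in> borel_measurable (past t)"
      using grid_bounds[OF assms(2)] assms(1) by (intro measurable_V_past) (auto intro: order_trans)
    from measurable_sets[OF this, of D]
    show "{\<omega> \<in> space (past t). V (grid s t m j) \<omega> \<in> D} \<in> sets (past t)"
      using assms(3) by (simp add: vimage_def Int_def conj_commute)
  qed auto
  finally show ?thesis .
qed

lemma stay_sets: "0 \<le> s \<Longrightarrow> s \<le> t \<Longrightarrow> closed D \<Longrightarrow> stay s t D \<in> sets M"
  using stay_sets_past sets_past_subset by blast

text \<open>Optional stopping at the first exit of the path from \<open>D\<close> on a fine grid. At that time the
  path has overshot \<open>D\<close> by at most its oscillation over one mesh width, so the hypothesis on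
  the heat flow makes the stopped part negligible.\<close>

lemma survival_expectation:
  assumes s: "0 \<le> s" "s \<le> t" and Z: "Z \<in> sets (past s)" and ZD: "\<And>\<omega>. \<omega> \<in> Z \<Longrightarrow> V s \<omega> \<in> D"
    and D: "closed D"
    and phi [measurable]: "\<phi> \<in> borel_measurable borel" and K: "\<And>x. \<bar>\<phi> x\<bar> \<le> K"
    and L: "0 \<le> L" "\<And>h y y'. 0 \<le> h \<Longrightarrow> y \<in> D \<Longrightarrow> y' \<notin> D \<Longrightarrow> \<bar>heat h \<phi> y'\<bar> \<le> L * \<bar>y' - y\<bar>"
  shows "(\<integral>\<omega>. indicator (Z \<inter> stay s t D) \<omega> * \<phi> (V t \<omega>) \<partial>M)
     = (\<integral>\<omega>. indicator Z \<omega> * heat (t - s) \<phi> (V s \<omega>) \<partial>M)"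
proof -
  have K0: "0 \<le> K" using order_trans[OF abs_ge_zero K[of 0]] .
  have ZM: "Z \<in> sets M" using Z sets_past_subset by blast
  then have ZS: "\<omega> \<in> Z \<Longrightarrow> \<omega> \<in> space M" for \<omega> using sets.sets_into_space by blast
  define r where "r m j = grid s t m j" for m j
  have r: "s \<le> r m j" "0 \<le> r m j" "j \<le> Suc m \<Longrightarrow> r m j \<le> t" for m j
    unfolding r_def using grid_bounds[OF s(2)] s(1) order_trans by blast+
  have r_mono: "i \<le> j \<Longrightarrow> r m i \<le> r m j" for m i j
    unfolding r_def grid_def using s by (intro add_left_mono divide_right_mono mult_left_mono) auto
  define G where "G m = {\<omega> \<in> space M. \<forall>j\<in>{..Suc m}. V (r m j) \<omega> \<in> D}" for m
  \<comment> \<open>On \<open>T m j\<close> the grid index \<open>j\<close> is the first one at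
    which the path is outside \<open>D\<close>.\<close>
  define T where "T m j = Z \<inter> {\<omega> \<in> space M. (\<forall>i\<in>{..<j}. V (r m i) \<omega> \<in> D) \<and> V (r m j) \<omega> \<notin> D}" for m j
  define e where "e m \<omega> = (\<Sum>j\<le>Suc m. indicator (T m j) \<omega> * heat (t - r m j) \<phi> (V (r m j) \<omega>))" for m \<omega>
  have mV: "V (r m j) \<in> borel_measurable M" for m j using r by (intro measurable_V)
  have mVt: "V t \<in> borel_measurable M" using s by (intro measurable_V) auto
  have inD: "{\<omega> \<in> space (past u). V (r m i) \<omega> \<in> D} \<in> sets (past u)" if "r m i \<le> u" for m i u
    using measurable_sets[OF measurable_V_past[OF r(2) that], of D] D
    by (simp add: vimage_def Int_def conj_commute)
  have T_past: "T m j \<in> sets (past (r m j))" for m j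
  proof -
    have "{\<omega> \<in> space (past (r m j)). (\<forall>i\<in>{..<j}. V (r m i) \<omega> \<in> D) \<and> \<not> V (r m j) \<omega> \<in> D} \<in> sets (past (r m j))"
      by (intro sets.sets_Collect_conj sets.sets_Collect_neg sets.sets_Collect_finite_All inD r_mono) auto
    moreover have "Z \<in> sets (past (r m j))" using Z past_mono[OF r(1)] by blast
    ultimately show ?thesis unfolding T_def by simp
  qed
  have T_M: "T m j \<in> sets M" for m j using T_past sets_past_subset by blast
  have G_M: "G m \<in> sets M" for m
  proof -
    have "{\<omega> \<in> space (past t). \<forall>j\<in>{..Suc m}. V (r m j) \<omega> \<in> D} \<in> sets (past t)"
      by (intro sets.sets_Collect_finite_All inD r) auto
    then show ?thesis unfolding G_def using sets_past_subset by auto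
  qed
  have T_disj: "disjoint_family (T m)" for m
    unfolding disjoint_family_on_def
  proof (intro ballI impI)
    fix i j :: nat assume "i \<noteq> j"
    then have "i < j \<or> j < i" by auto
    then show "T m i \<inter> T m j = {}" unfolding T_def by auto
  qed
  have decomp: "indicator Z \<omega> = indicator (Z \<inter> G m) \<omega> + (\<Sum>j\<le>Suc m. indicator (T m j) \<omega> :: real)" for m \<omega>
  proof (cases "\<omega> \<in> Z")
    case True
    show ?thesis
    proof (cases "\<omega> \<in> G m")
      case True
      then have "(\<Sum>j\<le>Suc m. indicator (T m j) \<omega> :: real) = 0"
        by (intro sum.neutral) (auto simp: T_def G_def)
      with True \<open>\<omega> \<in> Z\<close> show ?thesis by simp
    next
      case False
      define P where "P j \<longleftrightarrow> V (r m j) \<omega> \<notin> D" for j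
      have "\<exists>j\<in>{..Suc m}. P j"
        using False ZS[OF \<open>\<omega> \<in> Z\<close>] unfolding G_def P_def mem_Collect_eq by metis
      then obtain j where j: "j \<le> Suc m" "P j" by (metis atMost_iff)
      define i where "i = (LEAST j. P j)"
      have "P i" unfolding i_def by (rule LeastI[of P, OF j(2)])
      moreover have "i \<le> Suc m" unfolding i_def using Least_le[of P, OF j(2)] j(1) by (rule order_trans)
      moreover have "\<And>k. k < i \<Longrightarrow> \<not> P k" unfolding i_def by (rule not_less_Least)
      ultimately have i: "P i" "i \<le> Suc m" "\<And>k. k < i \<Longrightarrow> \<not> P k" .
      then have "\<omega> \<in> T m i" using \<open>\<omega> \<in> Z\<close> ZS by (auto simp: T_def P_def)
      then have "(\<Sum>j\<le>Suc m. indicator (T m j) \<omega> :: real) = (\<Sum>j\<le>Suc m. if j = i then 1 else 0)"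
        using T_disj[of m] by (intro sum.cong) (auto simp: indicator_def disjoint_family_on_def)
      with i False \<open>\<omega> \<in> Z\<close> show ?thesis by simp
    qed
  qed (auto simp: T_def intro!: sum.neutral)
  have int_ind: "integrable M (\<lambda>\<omega>. indicator A \<omega> * f \<omega>)"
    if "A \<in> sets M" "f \<in> borel_measurable M" "\<And>\<omega>. \<bar>f \<omega>\<bar> \<le> K" for A f
    using that K0 by (intro integrable_const_bound[where B=K]) (auto simp: indicator_def)
  have hK: "\<bar>heat h \<phi> y\<bar> \<le> K" for h y by (rule heat_bounded[OF phi K])
  have m1: "(\<lambda>\<omega>. \<phi> (V t \<omega>)) \<in> borel_measurable M" by (rule measurable_compose[OF mVt phi])
  have m2: "(\<lambda>\<omega>. heat h \<phi> (V (r m j) \<omega>)) \<in> borel_measurable M" for h m j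
    by (rule measurable_compose[OF mV borel_measurable_heat[OF phi]])
  \<comment> \<open>\<open>Z\<close> splits into the paths inside \<open>D\<close> at all grid times
    and the first-exit events \<open>T m j\<close>. On \<open>T m j\<close>, which belongs to the
    past of \<open>r m j\<close>, the Markov property turns \<open>\<phi> (V t)\<close> into the
    heat flow over the remaining time.\<close>
  have split: "(\<integral>\<omega>. indicator Z \<omega> * \<phi> (V t \<omega>) \<partial>M) - (\<integral>\<omega>. indicator (Z \<inter> G m) \<omega> * \<phi> (V t \<omega>) \<partial>M)
      = (\<integral>\<omega>. e m \<omega> \<partial>M)" for m
  proof -
    have "(\<integral>\<omega>. indicator Z \<omega> * \<phi> (V t \<omega>) \<partial>M)
      = (\<integral>\<omega>. indicator (Z \<inter> G m) \<omega> * \<phi> (V t \<omega>) + (\<Sum>j\<le>Suc m. indicator (T m j) \<omega> * \<phi> (V t \<omega>)) \<partial>M)"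
      using decomp[of _ m] by (intro Bochner_Integration.integral_cong) (auto simp: distrib_right sum_distrib_right)
    also have "\<dots> = (\<integral>\<omega>. indicator (Z \<inter> G m) \<omega> * \<phi> (V t \<omega>) \<partial>M)
        + (\<Sum>j\<le>Suc m. \<integral>\<omega>. indicator (T m j) \<omega> * \<phi> (V t \<omega>) \<partial>M)"
    proof (subst Bochner_Integration.integral_add)
      have I: "integrable M (\<lambda>\<omega>. indicator (T m j) \<omega> * \<phi> (V t \<omega>))" for j
        by (rule int_ind[OF T_M m1 K])
      show "integrable M (\<lambda>\<omega>. indicator (Z \<inter> G m) \<omega> * \<phi> (V t \<omega>))"
        by (rule int_ind[OF sets.Int[OF ZM G_M] m1 K])
      show "integrable M (\<lambda>\<omega>. \<Sum>j\<le>Suc m. indicator (T m j) \<omega> * \<phi> (V t \<omega>))"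
        by (rule Bochner_Integration.integrable_sum[OF I])
      show "(\<integral>\<omega>. indicator (Z \<inter> G m) \<omega> * \<phi> (V t \<omega>) \<partial>M)
          + (\<integral>\<omega>. (\<Sum>j\<le>Suc m. indicator (T m j) \<omega> * \<phi> (V t \<omega>)) \<partial>M)
        = (\<integral>\<omega>. indicator (Z \<inter> G m) \<omega> * \<phi> (V t \<omega>) \<partial>M)
          + (\<Sum>j\<le>Suc m. \<integral>\<omega>. indicator (T m j) \<omega> * \<phi> (V t \<omega>) \<partial>M)"
        by (simp only: Bochner_Integration.integral_sum[OF I])
    qed
    also have "(\<Sum>j\<le>Suc m. \<integral>\<omega>. indicator (T m j) \<omega> * \<phi> (V t \<omega>) \<partial>M) = (\<integral>\<omega>. e m \<omega> \<partial>M)"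
      unfolding e_def
    proof (subst Bochner_Integration.integral_sum)
      show "integrable M (\<lambda>\<omega>. indicator (T m j) \<omega> * heat (t - r m j) \<phi> (V (r m j) \<omega>))" for j
        by (rule int_ind[OF T_M m2 hK])
      show "(\<Sum>j\<le>Suc m. \<integral>\<omega>. indicator (T m j) \<omega> * \<phi> (V t \<omega>) \<partial>M)
          = (\<Sum>j\<le>Suc m. \<integral>\<omega>. indicator (T m j) \<omega> * heat (t - r m j) \<phi> (V (r m j) \<omega>) \<partial>M)"
        using r by (intro sum.cong refl markov_property[OF _ _ T_past phi K]) auto
    qed
    finally show ?thesis by simp
  qed
  have me: "e m \<in> borel_measurable M" for m
    unfolding e_def using T_M m2 by (intro borel_measurable_sum borel_measurable_times borel_measurable_indicator) auto
  have e_K: "\<bar>e m \<omega>\<bar> \<le> K" for m \<omega>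
    unfolding e_def using T_disj[of m] K0 hK
    by (intro abs_sum_indicator_disjoint_le) (auto simp: disjoint_family_on_def)
  have e_lim: "(\<lambda>m. e m \<omega>) \<longlonglongrightarrow> 0" if \<omega>: "\<omega> \<in> space M" for \<omega>
  proof (rule LIMSEQ_I)
    fix \<eta> :: real assume "0 < \<eta>"
    \<comment> \<open>Dividing by \<open>L + 1\<close> instead of \<open>L\<close> also covers
      \<open>L = 0\<close>.\<close>
    define \<eta>' where "\<eta>' = \<eta> / (L + 1)"
    have \<eta>': "0 < \<eta>'" "L * \<eta>' < \<eta>" unfolding \<eta>'_def using \<open>0 < \<eta>\<close> L(1) by (auto simp: field_simps)
    have "uniformly_continuous_on {s..t} (\<lambda>u. V u \<omega>)"
      using s by (intro compact_uniformly_continuous continuous_on_subset[OF continuous_V[OF \<omega>]]) auto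
    then obtain \<delta> where \<delta>: "0 < \<delta>"
      "\<And>u u'. u \<in> {s..t} \<Longrightarrow> u' \<in> {s..t} \<Longrightarrow> dist u' u < \<delta> \<Longrightarrow> dist (V u' \<omega>) (V u \<omega>) < \<eta>'"
      using \<eta>'(1) unfolding uniformly_continuous_on_def by metis
    have "\<forall>\<^sub>F m in sequentially. \<bar>e m \<omega>\<bar> < \<eta>"
      using eventually_mesh_less[OF \<delta>(1), of "t - s"]
    proof eventually_elim
      case (elim m)
      have "\<bar>e m \<omega>\<bar> \<le> L * \<eta>'"
        unfolding e_def
      proof (rule abs_sum_indicator_disjoint_le)
        show "disjoint_family_on (T m) {..Suc m}" using T_disj[of m] by (auto simp: disjoint_family_on_def)
        show "0 \<le> L * \<eta>'" using L(1) \<eta>'(1) by simp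
        fix j assume j: "j \<in> {..Suc m}" "\<omega> \<in> T m j"
        then have wZ: "\<omega> \<in> Z" and out: "V (r m j) \<omega> \<notin> D" by (auto simp: T_def)
        \<comment> \<open>The grid starts at \<open>s\<close>, where the path is in
          \<open>D\<close>. So the exit has a predecessor in \<open>D\<close>, one mesh width
          earlier, and uniform continuity bounds the overshoot.\<close>
        have "j \<noteq> 0" using out ZD[OF wZ] by (auto simp: r_def intro: gr0I)
        then obtain i where i: "j = Suc i" by (cases j) auto
        then have inn: "V (r m i) \<omega> \<in> D" using j by (auto simp: T_def)
        have "dist (r m j) (r m i) < \<delta>"
          using elim grid_step[of s t m i] s(2) unfolding i r_def dist_real_def by simp
        then have "dist (V (r m j) \<omega>) (V (r m i) \<omega>) < \<eta>'"
          using j i r by (intro \<delta>(2)) auto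
        then have "L * \<bar>V (r m j) \<omega> - V (r m i) \<omega>\<bar> \<le> L * \<eta>'"
          using L(1) by (intro mult_left_mono) (auto simp: dist_real_def)
        moreover have "\<bar>heat (t - r m j) \<phi> (V (r m j) \<omega>)\<bar> \<le> L * \<bar>V (r m j) \<omega> - V (r m i) \<omega>\<bar>"
          using r(3)[of j m] j(1) inn out by (intro L(2)) auto
        ultimately show "\<bar>heat (t - r m j) \<phi> (V (r m j) \<omega>)\<bar> \<le> L * \<eta>'" by linarith
      qed simp
      with \<eta>'(2) show ?case by simp
    qed
    then show "\<exists>no. \<forall>n\<ge>no. norm (e n \<omega> - 0) < \<eta>" by (simp add: eventually_sequentially)
  qed
  have lim_e: "(\<lambda>m. \<integral>\<omega>. e m \<omega> \<partial>M) \<longlonglongrightarrow> (\<integral>\<omega>. 0 \<partial>M)"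
    by (rule integral_dominated_convergence[where w="\<lambda>_. K"]) (use me e_K e_lim in auto)
  have lim_G: "(\<lambda>m. \<integral>\<omega>. indicator (Z \<inter> G m) \<omega> * \<phi> (V t \<omega>) \<partial>M)
      \<longlonglongrightarrow> (\<integral>\<omega>. indicator (Z \<inter> stay s t D) \<omega> * \<phi> (V t \<omega>) \<partial>M)"
  proof (rule integral_dominated_convergence[where w="\<lambda>_. K"])
    show "(\<lambda>\<omega>. indicator (Z \<inter> stay s t D) \<omega> * \<phi> (V t \<omega>)) \<in> borel_measurable M"
      using ZM stay_sets[OF s D] m1 by (intro borel_measurable_times borel_measurable_indicator) auto
    show "(\<lambda>\<omega>. indicator (Z \<inter> G m) \<omega> * \<phi> (V t \<omega>)) \<in> borel_measurable M" for m
      using ZM G_M m1 by (intro borel_measurable_times borel_measurable_indicator) auto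
    show "AE \<omega> in M. norm (indicator (Z \<inter> G m) \<omega> * \<phi> (V t \<omega>)) \<le> K" for m
      using K K0 by (auto simp: indicator_def)
    show "AE \<omega> in M. (\<lambda>m. indicator (Z \<inter> G m) \<omega> * \<phi> (V t \<omega>)) \<longlonglongrightarrow> indicator (Z \<inter> stay s t D) \<omega> * \<phi> (V t \<omega>)"
    proof (rule AE_I2)
      fix \<omega> assume \<omega>: "\<omega> \<in> space M"
      have "\<forall>\<^sub>F m in sequentially. indicator (Z \<inter> stay s t D) \<omega> * \<phi> (V t \<omega>) = indicator (Z \<inter> G m) \<omega> * \<phi> (V t \<omega>)"
      proof (cases "\<omega> \<in> stay s t D")
        case True
        then have "\<omega> \<in> G m" for m using r by (auto simp: stay_def G_def)
        with True show ?thesis by (simp add: indicator_def)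
      next
        case False
        from grid_exit[OF \<omega> D s(1) False]
        have "\<forall>\<^sub>F m in sequentially. \<omega> \<notin> G m"
          by eventually_elim (auto simp: G_def r_def)
        then show ?thesis by eventually_elim (use False in \<open>auto simp: indicator_def\<close>)
      qed
      then show "(\<lambda>m. indicator (Z \<inter> G m) \<omega> * \<phi> (V t \<omega>)) \<longlonglongrightarrow> indicator (Z \<inter> stay s t D) \<omega> * \<phi> (V t \<omega>)"
        by (rule tendsto_eventually[OF eventually_mono]) (erule sym)
    qed
  qed simp
  have "(\<lambda>m. \<integral>\<omega>. e m \<omega> \<partial>M) \<longlonglongrightarrow> (\<integral>\<omega>. indicator Z \<omega> * \<phi> (V t \<omega>) \<partial>M)
      - (\<integral>\<omega>. indicator (Z \<inter> stay s t D) \<omega> * \<phi> (V t \<omega>) \<partial>M)"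
    unfolding split[symmetric] by (intro tendsto_diff tendsto_const lim_G)
  from LIMSEQ_unique[OF this lim_e]
  have "(\<integral>\<omega>. indicator Z \<omega> * \<phi> (V t \<omega>) \<partial>M) = (\<integral>\<omega>. indicator (Z \<inter> stay s t D) \<omega> * \<phi> (V t \<omega>) \<partial>M)"
    by simp
  with markov_property[OF s Z phi K] show ?thesis by simp
qed

end

section \<open>Half-line and strip: heat flow of odd functions\<close>

text \<open>The heat flow vanishes at the reflection point \<open>a\<close> and keeps the Lipschitz
  constant of \<open>\<phi>\<close>. Since \<open>a\<close> separates \<open>y\<close> from
  \<open>y'\<close>, its distance to \<open>y'\<close> is at most the distance of \<open>y\<close>
  and \<open>y'\<close>. This supplies the overshoot hypothesis of
  \<open>survival_expectation\<close>.\<close>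

lemma heat_crossing:
  fixes \<phi> :: "real \<Rightarrow> real"
  assumes "\<phi> \<in> borel_measurable borel" "\<And>x. \<bar>\<phi> x\<bar> \<le> K" "\<And>x y. \<bar>\<phi> x - \<phi> y\<bar> \<le> L * \<bar>x - y\<bar>" "0 \<le> L"
    and "\<And>x. \<phi> (2 * a - x) = - \<phi> x"
    and "y' \<le> a \<and> a \<le> y \<or> y \<le> a \<and> a \<le> y'"
  shows "\<bar>heat h \<phi> y'\<bar> \<le> L * \<bar>y' - y\<bar>"
proof -
  have "\<bar>heat h \<phi> y' - heat h \<phi> a\<bar> \<le> L * \<bar>y' - a\<bar>" by (rule heat_lipschitz[OF assms(1-3)])
  also have "\<dots> \<le> L * \<bar>y' - y\<bar>" using assms(4,6) by (intro mult_left_mono) auto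
  finally show ?thesis using heat_reflect[OF assms(1,5)] by simp
qed

section \<open>Gaussian estimates for the heat flow of the sign function\<close>

lemma measure_std_normal_interval:
  fixes u v m K :: real
  assumes "u \<le> v" "\<And>z. u \<le> z \<Longrightarrow> z \<le> v \<Longrightarrow> m \<le> std_normal_density z \<and> std_normal_density z \<le> K"
  shows "m * (v - u) \<le> measure std_normal_distribution {u..v}"
    and "measure std_normal_distribution {u..v} \<le> K * (v - u)"
proof -
  have int: "integrable lborel (\<lambda>z. std_normal_density z * indicator {u..v} z)"
    by (rule integrable_real_mult_indicator) (auto intro!: integrable_normal_density)
  have eq: "measure std_normal_distribution {u..v} = (\<integral>z. std_normal_density z * indicator {u..v} z \<partial>lborel)"
  proof -
    interpret prob_space std_normal_distribution by (rule prob_space_std_normal)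
    have "measure std_normal_distribution {u..v} = (\<integral>z. indicator {u..v} z \<partial>std_normal_distribution)" by simp
    also have "\<dots> = (\<integral>z. std_normal_density z * indicator {u..v} z \<partial>lborel)"
      by (subst integral_density) auto
    finally show ?thesis .
  qed
  have c: "integrable lborel (\<lambda>z. c * indicator {u..v} z :: real)" "(\<integral>z. c * indicator {u..v} z \<partial>lborel) = c * (v - u)" for c
    using assms(1) by (auto simp: integrable_indicator_iff)
  have "(\<integral>z. m * indicator {u..v} z \<partial>lborel) \<le> (\<integral>z. std_normal_density z * indicator {u..v} z \<partial>lborel)"
    using assms(2) by (intro integral_mono c int) (auto simp: indicator_def)
  then show "m * (v - u) \<le> measure std_normal_distribution {u..v}" unfolding eq c .
  have "(\<integral>z. std_normal_density z * indicator {u..v} z \<partial>lborel) \<le> (\<integral>z. K * indicator {u..v} z \<partial>lborel)"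
    using assms(2) by (intro integral_mono c int) (auto simp: indicator_def)
  then show "measure std_normal_distribution {u..v} \<le> K * (v - u)" unfolding eq c .
qed

lemma AE_std_normal_neq: "AE z in std_normal_distribution. z \<noteq> c"
proof (subst AE_density)
  have "AE z in lborel. z \<noteq> c" by (rule AE_lborel_singleton)
  then show "AE z in lborel. 0 < ennreal (std_normal_density z) \<longrightarrow> z \<noteq> c" by eventually_elim simp
qed simp

text \<open>The two signs differ, by 2, exactly when \<open>z\<close> lies between \<open>-x\<close>
  and \<open>-y\<close>, apart from the end points, which are null. With \<open>y = 0\<close> this
  identifies \<open>heat 1 sgn x\<close> as the probability that a standard normal variable is at
  most \<open>x\<close> in absolute value.\<close>

lemma heat_sgn_diff:
  fixes x y :: real
  assumes "y \<le> x"
  shows "heat 1 sgn x - heat 1 sgn y = 2 * measure std_normal_distribution {-x..-y}"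
proof -
  interpret prob_space std_normal_distribution by (rule prob_space_std_normal)
  have int: "integrable std_normal_distribution (\<lambda>z. sgn (w + sqrt 1 * z))" for w :: real
    by (rule heat_integrable[where K=1]) (auto simp: sgn_if)
  have "heat 1 sgn x - heat 1 sgn y = (\<integral>z. sgn (x + sqrt 1 * z) - sgn (y + sqrt 1 * z) \<partial>std_normal_distribution)"
    unfolding heat_def using Bochner_Integration.integral_diff[OF int int] by simp
  also have "\<dots> = (\<integral>z. 2 * indicator {-x..-y} z \<partial>std_normal_distribution)"
  proof (rule integral_cong_AE)
    have "AE z in std_normal_distribution. z \<noteq> - x" "AE z in std_normal_distribution. z \<noteq> - y"
      by (rule AE_std_normal_neq)+
    then show "AE z in std_normal_distribution. sgn (x + sqrt 1 * z) - sgn (y + sqrt 1 * z) = 2 * indicator {-x..-y} z"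
      by eventually_elim (use assms in \<open>auto simp: sgn_if indicator_def\<close>)
  qed auto
  finally show ?thesis by simp
qed

lemma heat_sgn_0: "heat h sgn (0::real) = 0"
  by (rule heat_reflect) (auto simp: sgn_minus)

lemma std_normal_density_antimono:
  assumes "\<bar>x\<bar> \<le> \<bar>y\<bar>" shows "std_normal_density y \<le> std_normal_density x"
  using assms by (simp add: std_normal_density_def divide_right_mono abs_le_square_iff)

text \<open>On \<open>{-x..0}\<close> the normal density lies between its values at \<open>x\<close>
  and at 0. The two bounds have ratio tending to 1 as \<open>x\<close> tends to 0, which makes
  \<open>heat 1 sgn\<close> linear to first order.\<close>

lemma heat_sgn_bounds:
  assumes "0 \<le> x"
  shows "2 * x * std_normal_density x \<le> heat 1 sgn x" and "heat 1 sgn x \<le> 2 * x * std_normal_density 0"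
proof -
  have "heat 1 sgn x = 2 * measure std_normal_distribution {-x..0}"
    using heat_sgn_diff[OF assms] by (simp add: heat_sgn_0)
  moreover have "std_normal_density x \<le> std_normal_density z \<and> std_normal_density z \<le> std_normal_density 0"
    if "- x \<le> z" "z \<le> 0" for z
    using that by (auto intro!: std_normal_density_antimono)
  then have "std_normal_density x * (0 - - x) \<le> measure std_normal_distribution {-x..0}"
    "measure std_normal_distribution {-x..0} \<le> std_normal_density 0 * (0 - - x)"
    using assms measure_std_normal_interval[of "-x" 0 "std_normal_density x" "std_normal_density 0"] by auto
  ultimately show "2 * x * std_normal_density x \<le> heat 1 sgn x" "heat 1 sgn x \<le> 2 * x * std_normal_density 0"
    by (auto simp: algebra_simps)
qed

lemma heat_sgn_lipschitz:
  "\<bar>heat 1 sgn x - heat 1 sgn y\<bar> \<le> 2 * std_normal_density 0 * \<bar>x - y :: real\<bar>"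
proof -
  have *: "\<bar>heat 1 sgn u - heat 1 sgn v\<bar> \<le> 2 * std_normal_density 0 * \<bar>u - v\<bar>" if "v \<le> u" for u v :: real
  proof -
    have "measure std_normal_distribution {-u..-v} \<le> std_normal_density 0 * (-v - -u)"
      using that by (intro measure_std_normal_interval(2)[where m=0]) (auto intro!: std_normal_density_antimono)
    then show ?thesis unfolding heat_sgn_diff[OF that] using that by (simp add: mult.assoc)
  qed
  show ?thesis
    using *[of x y] *[of y x] by (cases "y \<le> x") (auto simp: abs_minus_commute)
qed

lemma heat_sgn_scale:
  assumes "0 < h"
  shows "heat h (\<lambda>x. sgn (x - a)) y = heat 1 sgn ((y - a) / sqrt h)"
proof -
  have "sgn (y + sqrt h * z - a) = sgn ((y - a) / sqrt h + sqrt 1 * z)" for z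
  proof -
    have "y + sqrt h * z - a = sqrt h * ((y - a) / sqrt h + sqrt 1 * z)" using assms by (simp add: field_simps)
    also have "sgn \<dots> = sgn ((y - a) / sqrt h + sqrt 1 * z)" using assms by (simp add: sgn_mult)
    finally show ?thesis .
  qed
  then show ?thesis unfolding heat_def by simp
qed

text \<open>The Poisson kernel smoothing of the square wave with period \<open>2 c\<close>.\<close>

definition wave :: "real \<Rightarrow> real \<Rightarrow> real \<Rightarrow> real" where
  "wave c r y = 2 / pi * arctan (2 * r * sin (pi * y / c) / (1 - r\<^sup>2))"

lemma borel_measurable_wave [measurable]: "wave c r \<in> borel_measurable borel"
  unfolding wave_def by measurable

lemma abs_wave_le: "\<bar>wave c r y\<bar> \<le> 1"
proof -
  have "\<bar>arctan x\<bar> \<le> pi / 2" for x using arctan_bounded[of x] by auto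
  then have "2 / pi * \<bar>arctan x\<bar> \<le> 2 / pi * (pi / 2)" for x by (intro mult_left_mono) auto
  then show ?thesis unfolding wave_def by (simp add: abs_mult)
qed

lemma wave_reflect_0: "wave c r (2 * 0 - y) = - wave c r y"
  by (simp add: wave_def arctan_minus)

lemma wave_reflect_c:
  assumes "c \<noteq> 0" shows "wave c r (2 * c - y) = - wave c r y"
proof -
  have "sin (pi * (2 * c - y) / c) = sin (2 * pi - pi * y / c)" using assms by (simp add: field_simps)
  also have "\<dots> = - sin (pi * y / c)" by (simp add: sin_diff)
  finally show ?thesis by (simp add: wave_def arctan_minus)
qed

lemma abs_arctan_diff_le: "\<bar>arctan x - arctan y\<bar> \<le> \<bar>x - y\<bar>"
proof -
  have "\<bar>inverse (1 + z\<^sup>2)\<bar> \<le> 1" for z :: real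
  proof -
    have "0 < 1 + z\<^sup>2" by (simp add: add_pos_nonneg)
    then show ?thesis by (simp add: inverse_le_1_iff)
  qed
  then have "norm (arctan x - arctan y) \<le> 1 * norm (x - y)"
    by (intro field_differentiable_bound[where S=UNIV and f'="\<lambda>x. inverse (1 + x\<^sup>2)"])
      (auto intro!: DERIV_arctan[THEN DERIV_subset])
  then show ?thesis by simp
qed

lemma abs_sin_diff_le: "\<bar>sin x - sin y\<bar> \<le> \<bar>x - y :: real\<bar>"
proof -
  have "norm (sin x - sin y) \<le> 1 * norm (x - y)"
    by (rule field_differentiable_bound[where S=UNIV and f'=cos]) (auto intro!: DERIV_sin[THEN DERIV_subset])
  then show ?thesis by simp
qed

text \<open>Both \<open>arctan\<close> and \<open>sin\<close> have Lipschitz constant 1; the inner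
  factors \<open>2 * r / (1 - r\<^sup>2)\<close> and \<open>pi / c\<close> and the outer
  \<open>2 / pi\<close> give the constant. It blows up as \<open>r\<close> tends to 1, so that limit
  can only be taken after optional stopping.\<close>

lemma wave_lipschitz:
  assumes "0 < c" "0 \<le> r" "r < 1"
  shows "\<bar>wave c r x - wave c r y\<bar> \<le> 4 * r / ((1 - r\<^sup>2) * c) * \<bar>x - y\<bar>"
proof -
  have r2: "0 < 1 - r\<^sup>2" using assms by (simp add: power_less_one_iff abs_square_less_1)
  have "\<bar>wave c r x - wave c r y\<bar>
      = 2 / pi * \<bar>arctan (2 * r * sin (pi * x / c) / (1 - r\<^sup>2)) - arctan (2 * r * sin (pi * y / c) / (1 - r\<^sup>2))\<bar>"
    unfolding wave_def right_diff_distrib[symmetric] abs_mult by simp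
  also have "\<dots> \<le> 2 / pi * \<bar>2 * r * sin (pi * x / c) / (1 - r\<^sup>2) - 2 * r * sin (pi * y / c) / (1 - r\<^sup>2)\<bar>"
    by (intro mult_left_mono abs_arctan_diff_le) auto
  also have "\<dots> = 2 / pi * (2 * r / (1 - r\<^sup>2)) * \<bar>sin (pi * x / c) - sin (pi * y / c)\<bar>"
    using assms r2 by (simp add: abs_mult diff_divide_distrib[symmetric] right_diff_distrib[symmetric])
  also have "\<dots> \<le> 2 / pi * (2 * r / (1 - r\<^sup>2)) * \<bar>pi * x / c - pi * y / c\<bar>"
    using assms r2 by (intro mult_left_mono abs_sin_diff_le) auto
  also have "\<dots> = 4 * r / ((1 - r\<^sup>2) * c) * \<bar>x - y\<bar>"
    using assms r2 by (simp add: abs_mult diff_divide_distrib[symmetric] right_diff_distrib[symmetric])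
  finally show ?thesis .
qed

text \<open>Inside the strip the sine is positive, so the argument of \<open>arctan\<close> tends to
  infinity.\<close>

lemma wave_tendsto:
  assumes "0 < y" "y < c" "r \<longlonglongrightarrow> 1" "\<And>n::nat. 0 \<le> r n" "\<And>n. r n < 1"
  shows "(\<lambda>n. wave c (r n) y) \<longlonglongrightarrow> 1"
proof -
  have s: "0 < sin (pi * y / c)" using assms by (intro sin_gt_zero) (auto simp: field_simps)
  have "(\<lambda>n. 1 - (r n)\<^sup>2) \<longlonglongrightarrow> 1 - 1\<^sup>2" by (intro tendsto_intros assms)
  moreover have "0 < 1 - (r n)\<^sup>2" for n using assms(4,5)[of n] by (simp add: power_less_one_iff abs_square_less_1)
  ultimately have "filterlim (\<lambda>n. 1 - (r n)\<^sup>2) (at_right 0) sequentially"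
    unfolding filterlim_at by (auto intro!: always_eventually simp: less_imp_neq[symmetric])
  moreover have "(\<lambda>n. 2 * r n * sin (pi * y / c)) \<longlonglongrightarrow> 2 * 1 * sin (pi * y / c)"
    by (intro tendsto_intros assms)
  ultimately have "filterlim (\<lambda>n. 2 * r n * sin (pi * y / c) / (1 - (r n)\<^sup>2)) at_top sequentially"
    using s unfolding divide_inverse[of "_ * _" "1 - _"]
    by (intro filterlim_tendsto_pos_mult_at_top[where c="2 * 1 * sin (pi * y / c)"] filterlim_compose[OF filterlim_inverse_at_top_right]) auto
  then have "(\<lambda>n. arctan (2 * r n * sin (pi * y / c) / (1 - (r n)\<^sup>2))) \<longlonglongrightarrow> pi / 2"
    by (rule filterlim_compose[OF tendsto_arctan_at_top])
  then have "(\<lambda>n. wave c (r n) y) \<longlonglongrightarrow> 2 / pi * (pi / 2)"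
    unfolding wave_def by (intro tendsto_mult tendsto_const)
  then show ?thesis by simp
qed

text \<open>For \<open>z\<close> of modulus \<open>r\<close> and angle \<open>\<theta>\<close>, the
  imaginary part of \<open>Ln ((1 + z) / (1 - z))\<close> is the arctangent in \<open>wave\<close>.
  This logarithm is \<open>Arctan (\<i> * z)\<close> up to the factor \<open>\<i> / 2\<close>, so
  the odd power series of \<open>Arctan\<close> becomes the sine series of the wave.\<close>

lemma wave_sums:
  assumes "0 \<le> r" "r < 1"
  shows "(\<lambda>k. 4 / pi * (r ^ (2 * k + 1) / real (2 * k + 1)) * sin (real (2 * k + 1) * (pi * y / c))) sums wave c r y"
proof -
  define \<theta> where "\<theta> = pi * y / c"
  define z where "z = rcis r \<theta>"
  have nz: "norm z = r" using assms by (simp add: z_def)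
  then have nz1: "norm (\<i> * z) < 1" using assms by (simp add: norm_mult)
  have z1: "z \<noteq> 1" using nz assms by auto
  define w where "w = (1 + z) / (1 - z)"
  have d: "0 < (cmod (1 - z))\<^sup>2" using z1 by simp
  have "w = (1 + z) * cnj (1 - z) / (cmod (1 - z))\<^sup>2"
    unfolding w_def complex_div_cnj[of "1 + z" "1 - z"] by simp
  moreover have "(1 + z) * cnj (1 - z) = of_real (1 - r\<^sup>2) + \<i> * of_real (2 * r * sin \<theta>)"
  proof -
    have "(1 + z) * cnj (1 - z) = 1 - z * cnj z + (z - cnj z)" by (simp add: algebra_simps)
    also have "z * cnj z = of_real (r\<^sup>2)" unfolding complex_norm_square[symmetric] nz by simp
    also have "z - cnj z = \<i> * of_real (2 * r * sin \<theta>)" unfolding complex_diff_cnj by (simp add: z_def mult_ac)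
    finally show ?thesis by simp
  qed
  ultimately have w: "Re w = (1 - r\<^sup>2) / (cmod (1 - z))\<^sup>2" "Im w = 2 * r * sin \<theta> / (cmod (1 - z))\<^sup>2"
    by (simp_all only: Re_divide_of_real Im_divide_of_real) simp_all
  have r2: "0 < 1 - r\<^sup>2" using assms by (simp add: power_less_one_iff abs_square_less_1)
  \<comment> \<open>In the right half-plane the principal argument is the arctangent of imaginary
    over real part, without a correction by \<open>pi\<close>.\<close>
  have Rew: "0 < Re w" unfolding w using r2 d by simp
  then have w0: "w \<noteq> 0" by auto
  have "Im (Ln w) = arctan (Im w / Re w)"
    using arg_conv_arctan[OF Rew] Arg_eq_Im_Ln[OF w0] by simp
  also have "\<dots> = arctan (2 * r * sin \<theta> / (1 - r\<^sup>2))" unfolding w using d by simp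
  finally have im: "- Re (Arctan (\<i> * z)) * (4 / pi) = wave c r y"
    unfolding Arctan_def wave_def \<theta>_def[symmetric] w_def by (simp add: algebra_simps Re_divide_numeral)
  have "(\<lambda>k. - Re ((-1) ^ k / of_nat (2 * k + 1) * (\<i> * z) ^ (2 * k + 1)) * (4 / pi)) sums (- Re (Arctan (\<i> * z)) * (4 / pi))"
    by (intro sums_mult2 sums_minus sums_Re Arctan_series(2)[OF nz1])
  moreover have "- Re ((-1) ^ k / of_nat (2 * k + 1) * (\<i> * z) ^ (2 * k + 1)) * (4 / pi)
      = 4 / pi * (r ^ (2 * k + 1) / real (2 * k + 1)) * sin (real (2 * k + 1) * \<theta>)" for k
  proof -
    have "(-1) ^ k * (\<i> * z) ^ (2 * k + 1) = \<i> * ((-1) ^ k * (-1) ^ k) * z ^ (2 * k + 1)"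
    proof -
      have "(\<i> * z) ^ (2 * k + 1) = \<i> ^ (2 * k + 1) * z ^ (2 * k + 1)" by (rule power_mult_distrib)
      also have "\<i> ^ (2 * k + 1) = \<i> * (-1) ^ k" by (simp add: power_mult)
      finally show ?thesis by (simp only: mult_ac)
    qed
    also have "\<dots> = \<i> * rcis (r ^ (2 * k + 1)) (real (2 * k + 1) * \<theta>)"
      unfolding z_def DeMoivre2 by (simp add: power_mult_distrib[symmetric])
    finally have e: "(-1) ^ k / of_nat (2 * k + 1) * (\<i> * z) ^ (2 * k + 1)
        = \<i> * rcis (r ^ (2 * k + 1)) (real (2 * k + 1) * \<theta>) / of_real (real (2 * k + 1))"
      by (simp add: field_simps)
    show ?thesis unfolding e Re_divide_of_real by (simp add: mult_ac)
  qed
  ultimately show ?thesis unfolding im \<theta>_def by simp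
qed

text \<open>Sines are eigenfunctions of the heat flow. The eigenvalue is the characteristic function
  of the normal law at \<open>l * sqrt h\<close>: its real part gives the mean of the cosine, its
  vanishing imaginary part that of the sine in the addition formula.\<close>

lemma heat_sin:
  assumes "0 \<le> h"
  shows "heat h (\<lambda>x. sin (l * x)) y = sin (l * y) * exp (- (l\<^sup>2 * h / 2))"
proof -
  interpret prob_space std_normal_distribution by (rule prob_space_std_normal)
  define t where "t = l * sqrt h"
  have i: "integrable std_normal_distribution (\<lambda>z. iexp (t * z))"
    by (rule integrable_const_bound[where B=1]) auto
  have ch: "(CLINT z|std_normal_distribution. iexp (t * z)) = complex_of_real (exp (- (t\<^sup>2) / 2))"
    using char_std_normal_distribution unfolding char_def by (rule fun_cong)
  have e: "Re (iexp (t * z)) = cos (t * z)" "Im (iexp (t * z)) = sin (t * z)" for z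
    by (simp_all add: Re_exp Im_exp)
  have c: "(\<integral>z. cos (t * z) \<partial>std_normal_distribution) = exp (- (t\<^sup>2) / 2)"
    using integral_Re[OF i] unfolding ch e by simp
  have s: "(\<integral>z. sin (t * z) \<partial>std_normal_distribution) = 0"
    using integral_Im[OF i] unfolding ch e by simp
  have ic: "integrable std_normal_distribution (\<lambda>z. cos (t * z))" "integrable std_normal_distribution (\<lambda>z. sin (t * z))"
    by (rule integrable_const_bound[where B=1]; auto)+
  have "heat h (\<lambda>x. sin (l * x)) y = (\<integral>z. sin (l * y) * cos (t * z) + cos (l * y) * sin (t * z) \<partial>std_normal_distribution)"
    unfolding heat_def t_def by (intro Bochner_Integration.integral_cong) (auto simp: distrib_left sin_add mult.assoc)
  also have "\<dots> = sin (l * y) * exp (- (t\<^sup>2) / 2)"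
    using ic by (simp add: c s)
  also have "t\<^sup>2 = l\<^sup>2 * h" using assms by (simp add: t_def power_mult_distrib)
  finally show ?thesis by simp
qed

text \<open>For \<open>r < 1\<close> the Fourier coefficients are dominated by a geometric series,
  so the heat flow may be applied termwise. The coefficients of the square wave itself, of order
  \<open>1 / k\<close>, are not summable.\<close>

lemma heat_wave_sums:
  assumes "0 \<le> r" "r < 1" "0 \<le> h"
  shows "(\<lambda>k. 4 / pi * (r ^ (2 * k + 1) / real (2 * k + 1)) *
      (sin (real (2 * k + 1) * (pi * y / c)) * exp (- ((real (2 * k + 1) * pi / c)\<^sup>2 * h / 2)))) sums heat h (wave c r) y"
proof -
  interpret prob_space std_normal_distribution by (rule prob_space_std_normal)
  define a where "a k = 4 / pi * (r ^ (2 * k + 1) / real (2 * k + 1))" for k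
  define l where "l k = real (2 * k + 1) * pi / c" for k
  have a0: "0 \<le> a k" for k using assms by (simp add: a_def)
  have wv: "(\<lambda>k. a k * sin (l k * x)) sums wave c r x" for x
    using wave_sums[OF assms(1,2), of x c] unfolding a_def l_def by (simp add: mult_ac)
  have int: "integrable std_normal_distribution (\<lambda>z. sin (l k * (y + sqrt h * z)))" for k
    by (rule integrable_const_bound[where B=1]) auto
  have sa: "summable a"
  proof (rule summable_comparison_test')
    show "summable (\<lambda>k. 4 / pi * (r\<^sup>2) ^ k)"
      using assms by (intro summable_mult summable_geometric) (simp add: power_less_one_iff abs_square_less_1)
    show "norm (a k) \<le> 4 / pi * (r\<^sup>2) ^ k" for k
    proof -
      have "r ^ (2 * k + 1) \<le> r ^ (2 * k)" using assms by (intro power_decreasing) auto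
      moreover have "r ^ (2 * k + 1) / real (2 * k + 1) \<le> r ^ (2 * k + 1) / 1"
        using assms by (intro divide_left_mono) auto
      ultimately have "r ^ (2 * k + 1) / real (2 * k + 1) \<le> (r\<^sup>2) ^ k" by (simp add: power_mult)
      then have "a k \<le> 4 / pi * (r\<^sup>2) ^ k" unfolding a_def by (intro mult_left_mono) auto
      then show ?thesis using a0[of k] by simp
    qed
  qed
  have bound: "\<bar>a k * sin (l k * x)\<bar> \<le> a k" for k x
    using mult_left_mono[OF abs_sin_le_one a0] a0 by (simp add: abs_mult)
  have bound_int: "(\<integral>z. norm (a k * sin (l k * (y + sqrt h * z))) \<partial>std_normal_distribution) \<le> a k" for k
  proof -
    have "(\<integral>z. norm (a k * sin (l k * (y + sqrt h * z))) \<partial>std_normal_distribution) \<le> (\<integral>z. a k \<partial>std_normal_distribution)"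
      using bound by (intro integral_mono integrable_norm integrable_mult_right int) auto
    then show ?thesis using prob_space by simp
  qed
  have "(\<lambda>k. \<integral>z. a k * sin (l k * (y + sqrt h * z)) \<partial>std_normal_distribution)
      sums (\<integral>z. (\<Sum>k. a k * sin (l k * (y + sqrt h * z))) \<partial>std_normal_distribution)"
  proof (rule sums_integral)
    show "integrable std_normal_distribution (\<lambda>z. a k * sin (l k * (y + sqrt h * z)))" for k
      by (intro integrable_mult_right int)
    show "AE z in std_normal_distribution. summable (\<lambda>k. norm (a k * sin (l k * (y + sqrt h * z))))"
      using bound by (intro always_eventually allI summable_comparison_test'[OF sa]) auto
    show "summable (\<lambda>k. \<integral>z. norm (a k * sin (l k * (y + sqrt h * z))) \<partial>std_normal_distribution)"
      using bound_int by (intro summable_comparison_test'[OF sa]) auto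
  qed
  moreover have "(\<integral>z. a k * sin (l k * (y + sqrt h * z)) \<partial>std_normal_distribution)
      = a k * (sin (l k * y) * exp (- ((l k)\<^sup>2 * h / 2)))" for k
    using heat_sin[OF assms(3), of "l k" y] unfolding heat_def by simp
  moreover have "(\<Sum>k. a k * sin (l k * (y + sqrt h * z))) = wave c r (y + sqrt h * z)" for z
    using sums_unique[OF wv] by simp
  ultimately have "(\<lambda>k. a k * (sin (l k * y) * exp (- ((l k)\<^sup>2 * h / 2)))) sums heat h (wave c r) y"
    unfolding heat_def by (simp only:)
  moreover have "l k * y = real (2 * k + 1) * (pi * y / c)" for k by (simp add: l_def)
  ultimately show ?thesis by (simp only: a_def l_def)
qed

text \<open>The geometric series \<open>q + q\<^sup>2 + ...\<close> with
  \<open>q = exp (- (4 * pi\<^sup>2 * x))\<close>. For \<open>x = h / c\<^sup>2\<close> it bounds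
  all higher Fourier modes relative to the first: the exponents of modes 3 and 1 differ by
  \<open>(9 - 1) / 2 = 4\<close> times \<open>pi\<^sup>2 * x\<close>.\<close>

definition wave_rest :: "real \<Rightarrow> real" where
  "wave_rest x = exp (- (4 * pi\<^sup>2 * x)) / (1 - exp (- (4 * pi\<^sup>2 * x)))"

text \<open>Only the first Fourier mode is kept. In mode \<open>n\<close> the bound of
  \<open>sin (n * x)\<close> by \<open>n * x\<close> cancels the \<open>1 / n\<close> of the
  coefficient, so the error is proportional to \<open>y\<close> and stays relatively small near the
  boundary, uniformly in \<open>r\<close>.\<close>

lemma heat_wave_approx:
  assumes "0 \<le> r" "r < 1" "0 < h" "0 < c" "0 \<le> y"
  shows "\<bar>heat h (wave c r) y - 4 / pi * r * sin (pi * y / c) * exp (- (pi\<^sup>2 * h / (2 * c\<^sup>2)))\<bar>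
     \<le> 4 * y / c * exp (- (pi\<^sup>2 * h / (2 * c\<^sup>2))) * wave_rest (h / c\<^sup>2)"
proof -
  define q where "q = exp (- (4 * pi\<^sup>2 * (h / c\<^sup>2)))"
  have q: "0 < q" "q < 1" unfolding q_def using assms by auto
  define e where "e = exp (- (pi\<^sup>2 * h / (2 * c\<^sup>2)))"
  define f where "f k = 4 / pi * (r ^ (2 * k + 1) / real (2 * k + 1)) *
      (sin (real (2 * k + 1) * (pi * y / c)) * exp (- ((real (2 * k + 1) * pi / c)\<^sup>2 * h / 2)))" for k
  have fs: "f sums heat h (wave c r) y" unfolding f_def by (rule heat_wave_sums[OF assms(1,2)]) (use assms in auto)
  have f0: "f 0 = 4 / pi * r * sin (pi * y / c) * e"
    by (simp add: f_def e_def power_divide power_mult_distrib field_simps)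
  have fS: "(\<lambda>k. f (Suc k)) sums (heat h (wave c r) y - f 0)" using fs by (simp add: sums_Suc_iff)
  have fb: "\<bar>f (Suc k)\<bar> \<le> 4 * y / c * e * q * q ^ k" for k
  proof -
    define n where "n = real (2 * Suc k + 1)"
    have n: "3 \<le> n" "n = 2 * real k + 3" by (auto simp: n_def)
    have "exp (- ((n * pi / c)\<^sup>2 * h / 2)) \<le> e * q * q ^ k"
    proof -
      have "e * q * q ^ k = exp (- (pi\<^sup>2 * h / (2 * c\<^sup>2)) + - (4 * pi\<^sup>2 * (h / c\<^sup>2)) + real k * - (4 * pi\<^sup>2 * (h / c\<^sup>2)))"
        unfolding e_def q_def exp_add exp_of_nat_mult ..
      also have "- (pi\<^sup>2 * h / (2 * c\<^sup>2)) + - (4 * pi\<^sup>2 * (h / c\<^sup>2)) + real k * - (4 * pi\<^sup>2 * (h / c\<^sup>2))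
          = - (pi\<^sup>2 * (h / c\<^sup>2) / 2) * (9 + 8 * real k)"
      proof -
        define X where "X = pi\<^sup>2 * (h / c\<^sup>2)"
        have "pi\<^sup>2 * h / (2 * c\<^sup>2) = X / 2" "4 * pi\<^sup>2 * (h / c\<^sup>2) = 4 * X" by (simp_all add: X_def)
        then show ?thesis unfolding X_def[symmetric] by (simp add: algebra_simps)
      qed
      finally have *: "e * q * q ^ k = exp (- (pi\<^sup>2 * (h / c\<^sup>2) / 2) * (9 + 8 * real k))" .
      have **: "(n * pi / c)\<^sup>2 * h / 2 = (pi\<^sup>2 * (h / c\<^sup>2) / 2) * n\<^sup>2" by (simp add: power_divide power_mult_distrib)
      \<comment> \<open>The square is \<open>4 * k\<^sup>2 + 12 * k + 9\<close>. Replacing it by a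
        linear function of \<open>k\<close> turns the Gaussian decay of the modes into the geometric
        series with ratio \<open>q\<close>.\<close>
      have "9 + 8 * real k \<le> n\<^sup>2" unfolding n(2) by (simp add: power2_eq_square algebra_simps)
      then have "(pi\<^sup>2 * (h / c\<^sup>2) / 2) * (9 + 8 * real k) \<le> (pi\<^sup>2 * (h / c\<^sup>2) / 2) * n\<^sup>2"
        using assms by (intro mult_left_mono) auto
      then show ?thesis unfolding * ** by simp
    qed
    note E = this
    have "r ^ (2 * Suc k + 1) \<le> 1" using assms by (intro power_le_one) auto
    then have A: "4 / pi * (r ^ (2 * Suc k + 1) / n) \<le> 4 / pi * (1 / n)" "0 \<le> 4 / pi * (r ^ (2 * Suc k + 1) / n)"
      using n assms by (auto intro!: mult_left_mono divide_right_mono simp del: power_Suc power_add mult_Suc_right)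
    have S: "\<bar>sin (n * (pi * y / c))\<bar> \<le> n * (pi * y / c)"
      using abs_sin_x_le_abs_x[of "n * (pi * y / c)"] n(1) assms by simp
    have "4 / pi * (r ^ (2 * Suc k + 1) / n) * (\<bar>sin (n * (pi * y / c))\<bar> * exp (- ((n * pi / c)\<^sup>2 * h / 2)))
        \<le> 4 / pi * (1 / n) * (n * (pi * y / c) * (e * q * q ^ k))"
      by (rule mult_mono[OF A(1) mult_mono[OF S E]]) (use n(1) assms in auto)
    also have "\<dots> = 4 * y / c * e * q * q ^ k" using n(1) by simp
    finally show ?thesis
      by (simp only: f_def n_def[symmetric] abs_mult[of "4 / pi * (r ^ (2 * Suc k + 1) / n)"]
          abs_of_nonneg[OF A(2)] abs_mult[of "sin _"] abs_exp_cancel)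
  qed
  have gs: "(\<lambda>k. 4 * y / c * e * q * q ^ k) sums (4 * y / c * e * q * (1 / (1 - q)))"
    using q by (intro sums_mult geometric_sums) auto
  have "\<bar>heat h (wave c r) y - f 0\<bar> \<le> 4 * y / c * e * q * (1 / (1 - q))"
    using norm_suminf_le[of "\<lambda>k. f (Suc k)", OF _ sums_summable[OF gs]] fb
    unfolding sums_unique[OF fS, symmetric] sums_unique[OF gs, symmetric] by simp
  then show ?thesis unfolding f0 e_def wave_rest_def q_def by simp
qed

lemma wave_rest_nonneg: "0 < x \<Longrightarrow> 0 \<le> wave_rest x"
  unfolding wave_rest_def by simp

section \<open>Survival probabilities of half-lines and strips\<close>

context continuous_brownian_motion
begin

text \<open>As \<open>V 0 = 0\<close>, \<open>V t\<close> is itself a normal increment and has no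
  atoms. This excludes end points on the boundary, where the approximating functions vanish instead
  of tending to 1.\<close>

lemma AE_V_neq:
  assumes "0 < t" shows "AE \<omega> in M. V t \<omega> \<noteq> c"
proof -
  have m: "(\<lambda>\<omega>. V t \<omega> - V 0 \<omega>) \<in> borel_measurable M"
    using assms by (intro borel_measurable_diff measurable_V) auto
  have "AE z in std_normal_distribution. sqrt (t - 0) * z \<noteq> c"
    using AE_std_normal_neq[of "c / sqrt t"] by eventually_elim (use assms in \<open>auto simp: field_simps\<close>)
  then have "AE x in distr std_normal_distribution borel (\<lambda>z. sqrt (t - 0) * z). x \<noteq> c"
    by (subst AE_distr_iff) auto
  then have "AE x in distr M borel (\<lambda>\<omega>. V t \<omega> - V 0 \<omega>). x \<noteq> c"
    unfolding distr_increment[OF order_refl assms] .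
  then have "AE \<omega> in M. V t \<omega> - V 0 \<omega> \<noteq> c"
    using m by (subst (asm) AE_distr_iff) auto
  with AE_space show ?thesis by eventually_elim (simp add: V_0)
qed

lemma integrable_indicator_mult:
  fixes f :: "'a \<Rightarrow> real"
  assumes "A \<in> sets M" "f \<in> borel_measurable M" "\<And>\<omega>. \<omega> \<in> A \<Longrightarrow> \<bar>f \<omega>\<bar> \<le> K"
  shows "integrable M (\<lambda>\<omega>. indicator A \<omega> * f \<omega>)"
  using assms by (intro integrable_const_bound[where B="\<bar>K\<bar>"]) (fastforce simp: indicator_def)+

text \<open>This is the reflection principle in integrated form. The functions
  \<open>\<phi> n\<close> are Lipschitz and odd about \<open>a\<close>, so
  \<open>survival_expectation\<close> applies to each. As \<open>n\<close> grows they tend to 1 at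
  the end point of a surviving path, while their heat flows tend to that of the sign.\<close>

lemma prob_stay_halfline:
  assumes s: "0 \<le> s" "s < t" and Z: "Z \<in> sets (past s)" and ZV: "\<And>\<omega>. \<omega> \<in> Z \<Longrightarrow> a \<le> V s \<omega>"
  shows "prob (Z \<inter> stay s t {a..}) = (\<integral>\<omega>. indicator Z \<omega> * heat 1 sgn ((V s \<omega> - a) / sqrt (t - s)) \<partial>M)"
proof -
  interpret N: prob_space std_normal_distribution by (rule prob_space_std_normal)
  define \<phi> where "\<phi> n y = max (-1) (min 1 (real (Suc n) * (y - a)))" for n y
  have phi_meas [measurable]: "\<phi> n \<in> borel_measurable borel" for n unfolding \<phi>_def by measurable
  have K: "\<bar>\<phi> n x\<bar> \<le> 1" for n x unfolding \<phi>_def by auto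
  have L: "\<bar>\<phi> n x - \<phi> n y\<bar> \<le> real (Suc n) * \<bar>x - y\<bar>" for n x y
  proof -
    have "\<bar>\<phi> n x - \<phi> n y\<bar> \<le> \<bar>real (Suc n) * (x - a) - real (Suc n) * (y - a)\<bar>"
      unfolding \<phi>_def by linarith
    also have "\<dots> = real (Suc n) * \<bar>x - y\<bar>" unfolding right_diff_distrib[symmetric] abs_mult by simp
    finally show ?thesis .
  qed
  have odd: "\<phi> n (2 * a - x) = - \<phi> n x" for n x
  proof -
    have "real (Suc n) * (2 * a - x - a) = - (real (Suc n) * (x - a))" by (simp add: algebra_simps)
    then show ?thesis unfolding \<phi>_def by linarith
  qed
  have lim: "(\<lambda>n. \<phi> n y) \<longlonglongrightarrow> sgn (y - a)" for y
  proof (cases "y = a")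
    case False
    have "\<forall>\<^sub>F n in sequentially. 1 / \<bar>y - a\<bar> < real (Suc n)"
      using filterlim_compose[OF filterlim_real_sequentially filterlim_Suc]
      unfolding filterlim_at_top_dense by blast
    then have "\<forall>\<^sub>F n in sequentially. \<phi> n y = sgn (y - a)"
    proof eventually_elim
      case (elim n)
      then have "1 < real (Suc n) * \<bar>y - a\<bar>" using False by (simp add: divide_less_eq)
      then show ?case unfolding \<phi>_def sgn_if by (cases "y < a") (auto simp: abs_if algebra_simps)
    qed
    then show ?thesis by (rule tendsto_eventually)
  qed (simp add: \<phi>_def)
  have ZM: "Z \<in> sets M" using Z sets_past_subset by blast
  have SM: "stay s t {a..} \<in> sets M" using s by (intro stay_sets) auto
  have mV: "V s \<in> borel_measurable M" "V t \<in> borel_measurable M" using s by (auto intro: measurable_V)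
  have eq: "(\<integral>\<omega>. indicator (Z \<inter> stay s t {a..}) \<omega> * \<phi> n (V t \<omega>) \<partial>M)
      = (\<integral>\<omega>. indicator Z \<omega> * heat (t - s) (\<phi> n) (V s \<omega>) \<partial>M)" for n
  proof (rule survival_expectation[OF s(1) less_imp_le[OF s(2)] Z _ _ phi_meas K])
    show "\<bar>heat h (\<phi> n) y'\<bar> \<le> real (Suc n) * \<bar>y' - y\<bar>" if "y \<in> {a..}" "y' \<notin> {a..}" for h y y'
      by (rule heat_crossing[OF phi_meas K L _ odd]) (use that in auto)
  qed (use ZV in auto)
  have hlim: "(\<lambda>n. heat h (\<phi> n) y) \<longlonglongrightarrow> heat h (\<lambda>x. sgn (x - a)) y" for h y
    unfolding heat_def
    by (rule integral_dominated_convergence[where w="\<lambda>_. 1"]) (use K lim in auto)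
  have "(\<lambda>n. \<integral>\<omega>. indicator Z \<omega> * heat (t - s) (\<phi> n) (V s \<omega>) \<partial>M)
      \<longlonglongrightarrow> (\<integral>\<omega>. indicator Z \<omega> * heat (t - s) (\<lambda>x. sgn (x - a)) (V s \<omega>) \<partial>M)"
  proof (rule integral_dominated_convergence[where w="\<lambda>_. 1"])
    have m: "(\<lambda>\<omega>. indicator Z \<omega> * heat (t - s) f (V s \<omega>)) \<in> borel_measurable M"
      if "f \<in> borel_measurable borel" for f :: "real \<Rightarrow> real"
      using ZM measurable_compose[OF mV(1) borel_measurable_heat[OF that]]
      by (intro borel_measurable_times borel_measurable_indicator) auto
    show "(\<lambda>\<omega>. indicator Z \<omega> * heat (t - s) (\<lambda>x. sgn (x - a)) (V s \<omega>)) \<in> borel_measurable M"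
      by (rule m) measurable
    show "(\<lambda>\<omega>. indicator Z \<omega> * heat (t - s) (\<phi> n) (V s \<omega>)) \<in> borel_measurable M" for n
      by (rule m) measurable
    show "AE \<omega> in M. norm (indicator Z \<omega> * heat (t - s) (\<phi> n) (V s \<omega>)) \<le> 1" for n
      using heat_bounded[OF _ K] by (auto simp: indicator_def)
    show "AE \<omega> in M. (\<lambda>n. indicator Z \<omega> * heat (t - s) (\<phi> n) (V s \<omega>))
        \<longlonglongrightarrow> indicator Z \<omega> * heat (t - s) (\<lambda>x. sgn (x - a)) (V s \<omega>)"
      by (intro AE_I2 tendsto_mult tendsto_const hlim)
  qed simp
  moreover have "(\<lambda>n. \<integral>\<omega>. indicator (Z \<inter> stay s t {a..}) \<omega> * \<phi> n (V t \<omega>) \<partial>M)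
      \<longlonglongrightarrow> (\<integral>\<omega>. indicator (Z \<inter> stay s t {a..}) \<omega> \<partial>M)"
  proof (rule integral_dominated_convergence[where w="\<lambda>_. 1"])
    show "(\<lambda>\<omega>. indicator (Z \<inter> stay s t {a..}) \<omega> :: real) \<in> borel_measurable M" using ZM SM by auto
    show "(\<lambda>\<omega>. indicator (Z \<inter> stay s t {a..}) \<omega> * \<phi> n (V t \<omega>)) \<in> borel_measurable M" for n
      using sets.Int[OF ZM SM] measurable_compose[OF mV(2) phi_meas]
      by (intro borel_measurable_times borel_measurable_indicator)
    show "AE \<omega> in M. norm (indicator (Z \<inter> stay s t {a..}) \<omega> * \<phi> n (V t \<omega>)) \<le> 1" for n
      using K by (auto simp: indicator_def)
    have "AE \<omega> in M. V t \<omega> \<noteq> a" using s by (intro AE_V_neq) auto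
    then show "AE \<omega> in M. (\<lambda>n. indicator (Z \<inter> stay s t {a..}) \<omega> * \<phi> n (V t \<omega>))
        \<longlonglongrightarrow> indicator (Z \<inter> stay s t {a..}) \<omega>"
    proof eventually_elim
      case (elim \<omega>)
      show ?case
      proof (cases "\<omega> \<in> Z \<inter> stay s t {a..}")
        case True
        then have "a < V t \<omega>" using elim s by (auto simp: stay_def less_le)
        with lim[of "V t \<omega>"] True show ?thesis by (simp add: sgn_if)
      qed simp
    qed
  qed simp
  ultimately have "(\<integral>\<omega>. indicator (Z \<inter> stay s t {a..}) \<omega> \<partial>M)
      = (\<integral>\<omega>. indicator Z \<omega> * heat (t - s) (\<lambda>x. sgn (x - a)) (V s \<omega>) \<partial>M)"
    unfolding eq by (rule LIMSEQ_unique[symmetric])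
  moreover have "(\<integral>\<omega>. indicator (Z \<inter> stay s t {a..}) \<omega> \<partial>M) = prob (Z \<inter> stay s t {a..})"
    using ZM SM by simp
  ultimately show ?thesis using s by (simp add: heat_sgn_scale)
qed

text \<open>Survival is computed for closed half-lines, but freedom from zeros is an open condition;
  this bridges the gap. The survival formula is continuous in the level, so the probabilities of
  staying above \<open>d n\<close> tend to that of staying above 0. These events are contained in
  the latter event, hence their union exhausts it up to a null set.\<close>

lemma AE_stay_nonneg_pos:
  assumes s: "0 \<le> s" "s < t"
  shows "AE \<omega> in M. \<omega> \<in> stay s t {0..} \<longrightarrow> 0 < V s \<omega> \<longrightarrow> (\<forall>r\<in>{s..t}. 0 < V r \<omega>)"
proof -
  define d where "d n = inverse (real (Suc n))" for n
  have d: "0 < d n" "d \<longlonglongrightarrow> 0" for n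
    unfolding d_def by (simp, rule LIMSEQ_inverse_real_of_nat)
  define Zn where "Zn n = {\<omega> \<in> space (past s). d n \<le> V s \<omega>}" for n
  define Z where "Z = {\<omega> \<in> space (past s). 0 < V s \<omega>}"
  define P where "P = Z \<inter> stay s t {0..}"
  define Pn where "Pn n = Zn n \<inter> stay s t {d n..}" for n
  have mVs: "V s \<in> borel_measurable (past s)" using s by (intro measurable_V_past) auto
  have Zp: "Z \<in> sets (past s)" "Zn n \<in> sets (past s)" for n
    unfolding Z_def Zn_def using mVs by measurable
  have PM: "P \<in> events" "Pn n \<in> events" for n
    unfolding P_def Pn_def using Zp sets_past_subset[of s] s by (auto intro!: sets.Int stay_sets)
  have mV: "V s \<in> borel_measurable M" using s by (intro measurable_V)
  have mh: "(\<lambda>\<omega>. indicator A \<omega> * heat 1 sgn ((V s \<omega> - c) / sqrt (t - s))) \<in> borel_measurable M"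
    if "A \<in> sets (past s)" for A c
  proof -
    have "A \<in> sets M" using that sets_past_subset by blast
    moreover have "(\<lambda>\<omega>. (V s \<omega> - c) / sqrt (t - s)) \<in> borel_measurable M" using mV by measurable
    moreover have "heat 1 sgn \<in> borel_measurable borel" by (rule borel_measurable_heat) measurable
    ultimately show ?thesis
      by (intro borel_measurable_times borel_measurable_indicator) (auto intro: measurable_compose)
  qed
  have h1: "\<bar>heat 1 sgn x\<bar> \<le> 1" for x :: real by (rule heat_bounded) (auto simp: sgn_if)
  have "(\<lambda>n. \<integral>\<omega>. indicator (Zn n) \<omega> * heat 1 sgn ((V s \<omega> - d n) / sqrt (t - s)) \<partial>M)
     \<longlonglongrightarrow> (\<integral>\<omega>. indicator Z \<omega> * heat 1 sgn ((V s \<omega> - 0) / sqrt (t - s)) \<partial>M)"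
  proof (rule integral_dominated_convergence[where w="\<lambda>_. 1"])
    show "AE \<omega> in M. norm (indicator (Zn n) \<omega> * heat 1 sgn ((V s \<omega> - d n) / sqrt (t - s))) \<le> 1" for n
      using h1 by (auto simp: indicator_def)
    show "AE \<omega> in M. (\<lambda>n. indicator (Zn n) \<omega> * heat 1 sgn ((V s \<omega> - d n) / sqrt (t - s)))
        \<longlonglongrightarrow> indicator Z \<omega> * heat 1 sgn ((V s \<omega> - 0) / sqrt (t - s))"
    proof (rule AE_I2)
      fix \<omega> assume \<omega>: "\<omega> \<in> space M"
      have h_cont: "isCont (heat 1 sgn) x" for x :: real
      proof -
        have "(2 * std_normal_density 0)-lipschitz_on UNIV (heat 1 sgn)"
          by (intro lipschitz_onI) (use heat_sgn_lipschitz in \<open>auto simp: dist_real_def\<close>)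
        then show ?thesis using lipschitz_on_continuous_on continuous_on_eq_continuous_at by blast
      qed
      have "(\<lambda>n. (V s \<omega> - d n) / sqrt (t - s)) \<longlonglongrightarrow> (V s \<omega> - 0) / sqrt (t - s)"
        using s by (intro tendsto_intros d) auto
      then have h: "(\<lambda>n. heat 1 sgn ((V s \<omega> - d n) / sqrt (t - s))) \<longlonglongrightarrow> heat 1 sgn ((V s \<omega> - 0) / sqrt (t - s))"
        by (rule isCont_tendsto_compose[OF h_cont])
      have "\<forall>\<^sub>F n in sequentially. indicator (Zn n) \<omega> = (indicator Z \<omega> :: real)"
      proof (cases "0 < V s \<omega>")
        case True
        from order_tendstoD(2)[OF d(2) this] show ?thesis
          by eventually_elim (use True \<omega> in \<open>auto simp: Z_def Zn_def\<close>)
      next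
        case False
        then have "\<not> d n \<le> V s \<omega>" for n using d(1)[of n] by linarith
        with False show ?thesis by (simp add: Z_def Zn_def)
      qed
      then have "(\<lambda>n. indicator (Zn n) \<omega>) \<longlonglongrightarrow> (indicator Z \<omega> :: real)" by (rule tendsto_eventually)
      from tendsto_mult[OF this h]
      show "(\<lambda>n. indicator (Zn n) \<omega> * heat 1 sgn ((V s \<omega> - d n) / sqrt (t - s)))
        \<longlonglongrightarrow> indicator Z \<omega> * heat 1 sgn ((V s \<omega> - 0) / sqrt (t - s))" .
    qed
  qed (rule mh[OF Zp(1)], rule mh[OF Zp(2)], simp)
  moreover have "(\<integral>\<omega>. indicator (Zn n) \<omega> * heat 1 sgn ((V s \<omega> - d n) / sqrt (t - s)) \<partial>M) = prob (Pn n)" for n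
    unfolding Pn_def by (rule prob_stay_halfline[symmetric, OF s Zp(2)]) (simp add: Zn_def)
  moreover have "(\<integral>\<omega>. indicator Z \<omega> * heat 1 sgn ((V s \<omega> - 0) / sqrt (t - s)) \<partial>M) = prob P"
    unfolding P_def by (rule prob_stay_halfline[symmetric, OF s Zp(1)]) (simp add: Z_def)
  ultimately have lim: "(\<lambda>n. prob (Pn n)) \<longlonglongrightarrow> prob P" by simp
  have sub: "Pn n \<subseteq> P" for n
    using d(1)[of n] by (force simp: Pn_def P_def Zn_def Z_def stay_def)
  have "prob (P - (\<Union>n. Pn n)) = 0"
  proof -
    have "prob (P - (\<Union>n. Pn n)) \<le> prob P - prob (Pn n)" for n
    proof -
      have "prob (P - (\<Union>n. Pn n)) \<le> prob (P - Pn n)" using PM by (intro finite_measure_mono) auto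
      also have "\<dots> = prob P - prob (Pn n)" using PM sub by (intro finite_measure_Diff) auto
      finally show ?thesis .
    qed
    moreover have "(\<lambda>n. prob P - prob (Pn n)) \<longlonglongrightarrow> prob P - prob P" by (intro tendsto_intros lim)
    ultimately have "prob (P - (\<Union>n. Pn n)) \<le> prob P - prob P"
      by (intro LIMSEQ_le_const[where X="\<lambda>n. prob P - prob (Pn n)"]) auto
    then show ?thesis using measure_nonneg[of M] by (simp add: antisym)
  qed
  then have "P - (\<Union>n. Pn n) \<in> null_sets M" using PM by (auto simp: null_sets_def emeasure_eq_measure)
  then have "AE \<omega> in M. \<omega> \<notin> P - (\<Union>n. Pn n)" by (rule AE_not_in)
  with AE_space show ?thesis
  proof eventually_elim
    case (elim \<omega>)
    show ?case
    proof (intro impI ballI)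
      fix r assume "\<omega> \<in> stay s t {0..}" "0 < V s \<omega>" and r: "r \<in> {s..t}"
      then have "\<omega> \<in> P" using elim by (auto simp: P_def Z_def)
      with elim obtain n where "\<omega> \<in> Pn n" by auto
      then show "0 < V r \<omega>" using r d(1)[of n] by (auto simp: Pn_def stay_def intro: less_le_trans)
    qed
  qed
qed

text \<open>The wave is odd about both boundary points, so \<open>survival_expectation\<close>
  yields the heat flow of \<open>wave c r\<close>, and \<open>r\<close> tends to 1. The upper bound
  replaces the sine by its argument, to be linear in \<open>V s\<close> like the half-line
  probability.\<close>

lemma prob_stay_strip:
  fixes c s t :: real
  defines "E \<equiv> exp (- (pi\<^sup>2 * (t - s) / (2 * c\<^sup>2)))" and "R \<equiv> wave_rest ((t - s) / c\<^sup>2)"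
  assumes s: "0 \<le> s" "s < t" and c: "0 < c" and Z: "Z \<in> sets (past s)" and ZV: "\<And>\<omega>. \<omega> \<in> Z \<Longrightarrow> 0 < V s \<omega> \<and> V s \<omega> \<le> c"
  shows "prob (Z \<inter> stay s t {0..c}) \<le> (\<integral>\<omega>. indicator Z \<omega> * (4 * V s \<omega> / c * E * (1 + R)) \<partial>M)"
    and "(\<integral>\<omega>. indicator Z \<omega> * (4 / pi * sin (pi * V s \<omega> / c) * E - 4 * V s \<omega> / c * E * R) \<partial>M)
      \<le> prob (Z \<inter> stay s t {0..c})"
proof -
  have R0: "0 \<le> R" unfolding R_def using s c by (intro wave_rest_nonneg) auto
  have E0: "0 < E" unfolding E_def by simp
  define r where "r n = 1 - inverse (real (Suc (Suc n)))" for n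
  have r: "0 \<le> r n" "r n < 1" for n unfolding r_def by (auto simp: inverse_le_1_iff)
  have rlim: "r \<longlonglongrightarrow> 1"
    unfolding r_def using tendsto_diff[OF tendsto_const LIMSEQ_Suc[OF LIMSEQ_inverse_real_of_nat], of 1] by simp
  have ZM: "Z \<in> sets M" using Z sets_past_subset by blast
  have SM: "stay s t {0..c} \<in> sets M" using s by (intro stay_sets) auto
  have mV: "V s \<in> borel_measurable M" "V t \<in> borel_measurable M" using s by (auto intro: measurable_V)
  have eq: "(\<integral>\<omega>. indicator (Z \<inter> stay s t {0..c}) \<omega> * wave c (r n) (V t \<omega>) \<partial>M)
      = (\<integral>\<omega>. indicator Z \<omega> * heat (t - s) (wave c (r n)) (V s \<omega>) \<partial>M)" for n
  proof (rule survival_expectation[OF s(1) less_imp_le[OF s(2)] Z, where L="4 * r n / ((1 - (r n)\<^sup>2) * c)" and K=1])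
    have r2: "0 < 1 - (r n)\<^sup>2" using r[of n] by (simp add: power_less_one_iff abs_square_less_1)
    show L0: "0 \<le> 4 * r n / ((1 - (r n)\<^sup>2) * c)" using r2 r[of n] c by simp
    show "\<bar>heat h (wave c (r n)) y'\<bar> \<le> 4 * r n / ((1 - (r n)\<^sup>2) * c) * \<bar>y' - y\<bar>"
      if "0 \<le> h" "y \<in> {0..c}" "y' \<notin> {0..c}" for h y y'
    proof (cases "y' < 0")
      case True
      then show ?thesis using that
        by (intro heat_crossing[OF _ abs_wave_le wave_lipschitz[OF c r] L0 wave_reflect_0]) auto
    next
      case False
      then show ?thesis using that c
        by (intro heat_crossing[OF _ abs_wave_le wave_lipschitz[OF c r] L0 wave_reflect_c]) auto
    qed
  qed (use ZV abs_wave_le in \<open>force+\<close>)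
  have lim: "(\<lambda>n. \<integral>\<omega>. indicator (Z \<inter> stay s t {0..c}) \<omega> * wave c (r n) (V t \<omega>) \<partial>M)
      \<longlonglongrightarrow> (\<integral>\<omega>. indicator (Z \<inter> stay s t {0..c}) \<omega> \<partial>M)"
  proof (rule integral_dominated_convergence[where w="\<lambda>_. 1"])
    show "(\<lambda>\<omega>. indicator (Z \<inter> stay s t {0..c}) \<omega> :: real) \<in> borel_measurable M" using ZM SM by auto
    show "(\<lambda>\<omega>. indicator (Z \<inter> stay s t {0..c}) \<omega> * wave c (r n) (V t \<omega>)) \<in> borel_measurable M" for n
      using sets.Int[OF ZM SM] measurable_compose[OF mV(2) borel_measurable_wave]
      by (intro borel_measurable_times borel_measurable_indicator)
    show "AE \<omega> in M. norm (indicator (Z \<inter> stay s t {0..c}) \<omega> * wave c (r n) (V t \<omega>)) \<le> 1" for n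
      using abs_wave_le by (auto simp: indicator_def)
    have "AE \<omega> in M. V t \<omega> \<noteq> 0" "AE \<omega> in M. V t \<omega> \<noteq> c" using s by (intro AE_V_neq; simp)+
    then show "AE \<omega> in M. (\<lambda>n. indicator (Z \<inter> stay s t {0..c}) \<omega> * wave c (r n) (V t \<omega>))
        \<longlonglongrightarrow> indicator (Z \<inter> stay s t {0..c}) \<omega>"
    proof eventually_elim
      case (elim \<omega>)
      show ?case
      proof (cases "\<omega> \<in> Z \<inter> stay s t {0..c}")
        case True
        then have "0 < V t \<omega>" "V t \<omega> < c" using elim s by (auto simp: stay_def less_le)
        from wave_tendsto[OF this rlim r] True show ?thesis by simp
      qed simp
    qed
  qed simp
  have P: "(\<integral>\<omega>. indicator (Z \<inter> stay s t {0..c}) \<omega> \<partial>M) = prob (Z \<inter> stay s t {0..c})"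
    using ZM SM by simp
  have approx: "\<bar>heat (t - s) (wave c (r n)) y - 4 / pi * r n * sin (pi * y / c) * E\<bar> \<le> 4 * y / c * E * R"
    if "0 \<le> y" for n y
    unfolding E_def R_def by (rule heat_wave_approx) (use r s c that in auto)
  have int_heat: "integrable M (\<lambda>\<omega>. indicator Z \<omega> * heat (t - s) (wave c (r n)) (V s \<omega>))" for n
    using ZM heat_bounded[OF borel_measurable_wave abs_wave_le] measurable_compose[OF mV(1) borel_measurable_heat[OF borel_measurable_wave]]
    by (intro integrable_indicator_mult) auto
  have bndV: "\<omega> \<in> Z \<Longrightarrow> \<bar>V s \<omega>\<bar> \<le> c" for \<omega> using ZV[of \<omega>] by auto
  have int_V: "integrable M (\<lambda>\<omega>. indicator Z \<omega> * V s \<omega>)"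
    using ZM mV bndV by (intro integrable_indicator_mult)
  have int_sin: "integrable M (\<lambda>\<omega>. indicator Z \<omega> * sin (pi * V s \<omega> / c))"
    using ZM mV by (intro integrable_indicator_mult[where K=1]) auto
  have up: "(\<integral>\<omega>. indicator Z \<omega> * heat (t - s) (wave c (r n)) (V s \<omega>) \<partial>M)
      \<le> (\<integral>\<omega>. indicator Z \<omega> * (4 * V s \<omega> / c * E * (1 + R)) \<partial>M)" for n
  proof (rule integral_mono[OF int_heat])
    have "integrable M (\<lambda>\<omega>. indicator Z \<omega> * V s \<omega> * (4 / c * E * (1 + R)))"
      by (intro integrable_mult_left int_V)
    then show "integrable M (\<lambda>\<omega>. indicator Z \<omega> * (4 * V s \<omega> / c * E * (1 + R)))"
      by (simp add: algebra_simps)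
    fix \<omega> assume "\<omega> \<in> space M"
    show "indicator Z \<omega> * heat (t - s) (wave c (r n)) (V s \<omega>) \<le> indicator Z \<omega> * (4 * V s \<omega> / c * E * (1 + R))"
    proof (cases "\<omega> \<in> Z")
      case True
      then have v: "0 < V s \<omega>" using ZV by auto
      have "sin (pi * V s \<omega> / c) \<le> pi * V s \<omega> / c" using v c by (intro sin_x_le_x) auto
      then have "r n * sin (pi * V s \<omega> / c) \<le> 1 * (pi * V s \<omega> / c)"
        using r[of n] v c ZV[OF True] by (intro mult_mono sin_ge_zero) (auto simp: field_simps)
      then have "4 / pi * E * (r n * sin (pi * V s \<omega> / c)) \<le> 4 / pi * E * (pi * V s \<omega> / c)"
        using E0 by (intro mult_left_mono) auto
      then have "4 / pi * r n * sin (pi * V s \<omega> / c) * E \<le> 4 * V s \<omega> / c * E" by (simp add: mult_ac)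
      with approx[of "V s \<omega>" n] v have "heat (t - s) (wave c (r n)) (V s \<omega>) \<le> 4 * V s \<omega> / c * E + 4 * V s \<omega> / c * E * R"
        by linarith
      with True show ?thesis by (simp add: distrib_left)
    qed simp
  qed
  show "prob (Z \<inter> stay s t {0..c}) \<le> (\<integral>\<omega>. indicator Z \<omega> * (4 * V s \<omega> / c * E * (1 + R)) \<partial>M)"
    unfolding P[symmetric] by (rule LIMSEQ_le_const2[OF lim]) (use up eq in auto)
  define A where "A = (\<integral>\<omega>. indicator Z \<omega> * sin (pi * V s \<omega> / c) \<partial>M)"
  define B where "B = (\<integral>\<omega>. indicator Z \<omega> * V s \<omega> \<partial>M)"
  \<comment> \<open>The parameter \<open>u\<close> serves twice: \<open>u = r n\<close> for the
    lower bound before the limit, \<open>u = 1\<close> for the integral in the claim.\<close>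
  have lin: "(\<integral>\<omega>. indicator Z \<omega> * (4 / pi * u * sin (pi * V s \<omega> / c) * E - 4 * V s \<omega> / c * E * R) \<partial>M)
      = u * (4 / pi * E) * A - 4 / c * E * R * B"
    and lin_int: "integrable M (\<lambda>\<omega>. indicator Z \<omega> * (4 / pi * u * sin (pi * V s \<omega> / c) * E - 4 * V s \<omega> / c * E * R))" for u
  proof -
    have e: "indicator Z \<omega> * (4 / pi * u * sin (pi * V s \<omega> / c) * E - 4 * V s \<omega> / c * E * R)
      = u * (4 / pi * E) * (indicator Z \<omega> * sin (pi * V s \<omega> / c)) - 4 / c * E * R * (indicator Z \<omega> * V s \<omega>)" for \<omega>
      by (simp add: algebra_simps)
    show "(\<integral>\<omega>. indicator Z \<omega> * (4 / pi * u * sin (pi * V s \<omega> / c) * E - 4 * V s \<omega> / c * E * R) \<partial>M)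
      = u * (4 / pi * E) * A - 4 / c * E * R * B"
      unfolding e A_def B_def
      by (subst Bochner_Integration.integral_diff[OF integrable_mult_right[OF int_sin] integrable_mult_right[OF int_V]]) simp
    show "integrable M (\<lambda>\<omega>. indicator Z \<omega> * (4 / pi * u * sin (pi * V s \<omega> / c) * E - 4 * V s \<omega> / c * E * R))"
      unfolding e using int_V int_sin by (intro Bochner_Integration.integrable_diff integrable_mult_right)
  qed
  have low: "r n * (4 / pi * E) * A - 4 / c * E * R * B \<le> (\<integral>\<omega>. indicator Z \<omega> * heat (t - s) (wave c (r n)) (V s \<omega>) \<partial>M)" for n
    unfolding lin[symmetric]
  proof (rule integral_mono[OF lin_int int_heat])
    fix \<omega> assume "\<omega> \<in> space M"
    show "indicator Z \<omega> * (4 / pi * r n * sin (pi * V s \<omega> / c) * E - 4 * V s \<omega> / c * E * R)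
        \<le> indicator Z \<omega> * heat (t - s) (wave c (r n)) (V s \<omega>)"
    proof (cases "\<omega> \<in> Z")
      case True
      then show ?thesis using approx[of "V s \<omega>" n] ZV[OF True] by (simp add: abs_le_iff)
    qed simp
  qed
  have "(\<lambda>n. r n * (4 / pi * E) * A - 4 / c * E * R * B) \<longlonglongrightarrow> 1 * (4 / pi * E) * A - 4 / c * E * R * B"
    by (intro tendsto_intros rlim)
  from LIMSEQ_le[OF this lim] low eq
  have "1 * (4 / pi * E) * A - 4 / c * E * R * B \<le> prob (Z \<inter> stay s t {0..c})" unfolding P by auto
  then show "(\<integral>\<omega>. indicator Z \<omega> * (4 / pi * sin (pi * V s \<omega> / c) * E - 4 * V s \<omega> / c * E * R) \<partial>M)
      \<le> prob (Z \<inter> stay s t {0..c})"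
    using lin[of 1] by simp
qed

end

section \<open>Comparison of the strip with the zero-free event\<close>

text \<open>The quotient of the upper bound
  \<open>4 * y / \<epsilon> * exp (...) * (1 + wave_rest ...)\<close> for the strip and the lower
  bound \<open>2 * y * std_normal_density \<delta>\<close> for the half-line, where \<open>y\<close>
  is at most \<open>\<delta>\<close>; the factor \<open>y\<close> cancels.\<close>

definition strip_upper :: "real \<Rightarrow> real \<Rightarrow> real" where
  "strip_upper \<epsilon> \<delta> = 2 / (\<epsilon> * std_normal_density \<delta>) * exp (- (pi\<^sup>2 / (2 * \<epsilon>\<^sup>2))) * (1 + wave_rest (1 / \<epsilon>\<^sup>2))"

text \<open>The analogous quotient with the bounds exchanged: \<open>sin x\<close> is bounded below
  by \<open>x * cos (pi * \<delta> / \<epsilon>)\<close>, and the half-line probability above by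
  \<open>2 * y * std_normal_density 0\<close>.\<close>

definition strip_lower :: "real \<Rightarrow> real \<Rightarrow> real" where
  "strip_lower \<epsilon> \<delta> = 2 / (\<epsilon> * std_normal_density 0) * exp (- (pi\<^sup>2 / (2 * \<epsilon>\<^sup>2))) *
     (cos (pi * \<delta> / \<epsilon>) - wave_rest (1 / \<epsilon>\<^sup>2))"

text \<open>The difference vanishes at 0 and has derivative \<open>z * sin z\<close>. The bound
  makes the sine comparable to its argument from below, with a factor close to 1 near 0.\<close>

lemma sin_ge_mult_cos:
  fixes x :: real
  assumes "0 \<le> x" "x \<le> pi"
  shows "x * cos x \<le> sin x"
proof -
  define f where "f y = sin y - y * cos y" for y :: real
  have "\<exists>y. (f has_real_derivative y) (at z) \<and> 0 \<le> y" if "0 \<le> z" "z \<le> x" for z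
  proof (intro exI conjI)
    show "(f has_real_derivative (z * sin z)) (at z)"
      unfolding f_def by (auto intro!: derivative_eq_intros)
    show "0 \<le> z * sin z" using that assms sin_ge_zero[of z] by simp
  qed
  then have "f 0 \<le> f x" by (rule DERIV_nonneg_imp_nondecreasing[OF assms(1)])
  then show ?thesis by (simp add: f_def)
qed

lemma IVT_pos:
  fixes f :: "real \<Rightarrow> real"
  assumes "continuous_on {s..t} f" "\<And>r. r \<in> {s..t} \<Longrightarrow> f r \<noteq> 0" "0 < f s" "r \<in> {s..t}"
  shows "0 < f r"
proof (rule ccontr)
  assume "\<not> 0 < f r"
  moreover have "continuous_on {s..r} f" using assms by (auto intro: continuous_on_subset)
  ultimately obtain x where "s \<le> x" "x \<le> r" "f x = 0"
    using IVT2'[of f r 0 s] assms by auto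
  with assms show False by auto
qed

context continuous_brownian_motion
begin

text \<open>Both probabilities are, or are bounded by, integrals over \<open>Z\<close> of functions
  of \<open>\<eta> = V s / sqrt (t - s)\<close>, which are compared pointwise. The strip width is
  scaled so that \<open>(t - s) / c\<^sup>2 = 1 / \<epsilon>\<^sup>2\<close>; hence the factors
  depend neither on the times nor on \<open>Z\<close>.\<close>

lemma prob_strip_halfline:
  assumes s: "0 \<le> s" "s < t" and d: "0 < \<delta>" "\<delta> \<le> \<epsilon>" and Z: "Z \<in> sets (past s)"
    and ZV: "\<And>\<omega>. \<omega> \<in> Z \<Longrightarrow> 0 < V s \<omega> \<and> V s \<omega> \<le> \<delta> * sqrt (t - s)"
  shows "prob (Z \<inter> stay s t {0..\<epsilon> * sqrt (t - s)}) \<le> strip_upper \<epsilon> \<delta> * prob (Z \<inter> stay s t {0..})"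
    and "strip_lower \<epsilon> \<delta> * prob (Z \<inter> stay s t {0..}) \<le> prob (Z \<inter> stay s t {0..\<epsilon> * sqrt (t - s)})"
proof -
  define q where "q = sqrt (t - s)"
  define c where "c = \<epsilon> * q"
  define E where "E = exp (- (pi\<^sup>2 / (2 * \<epsilon>\<^sup>2)))"
  define R where "R = wave_rest (1 / \<epsilon>\<^sup>2)"
  have q: "0 < q" "q\<^sup>2 = t - s" using s by (auto simp: q_def)
  have e: "0 < \<epsilon>" using d by simp
  have c: "0 < c" using q e by (simp add: c_def)
  have eqE: "exp (- (pi\<^sup>2 * (t - s) / (2 * c\<^sup>2))) = E" and eqR: "wave_rest ((t - s) / c\<^sup>2) = R"
    unfolding E_def R_def c_def q(2)[symmetric] power_mult_distrib using q(1) e by simp_all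
  have E0: "0 < E" by (simp add: E_def)
  have R0: "0 \<le> R" unfolding R_def using e by (intro wave_rest_nonneg) auto
  have ZV': "0 < V s \<omega> \<and> V s \<omega> \<le> c" if "\<omega> \<in> Z" for \<omega>
  proof -
    have "\<delta> * q \<le> \<epsilon> * q" using d q by (intro mult_right_mono) auto
    then show ?thesis using ZV[OF that] unfolding c_def q_def by linarith
  qed
  have ZM: "Z \<in> sets M" using Z sets_past_subset by blast
  have mV: "V s \<in> borel_measurable M" using s by (intro measurable_V)
  define \<eta> where "\<eta> \<omega> = V s \<omega> / q" for \<omega>
  have \<eta>: "0 < \<eta> \<omega>" "\<eta> \<omega> \<le> \<delta>" if "\<omega> \<in> Z" for \<omega>
    using ZV[OF that] q by (auto simp: \<eta>_def divide_le_eq q_def)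
  have m\<eta>: "\<eta> \<in> borel_measurable M" unfolding \<eta>_def using mV by measurable
  have Vc: "V s \<omega> / c = \<eta> \<omega> / \<epsilon>" for \<omega> using q e by (simp add: \<eta>_def c_def)
  note strip = prob_stay_strip[OF s c Z ZV', unfolded eqE eqR]
  have half: "prob (Z \<inter> stay s t {0..}) = (\<integral>\<omega>. indicator Z \<omega> * heat 1 sgn (\<eta> \<omega>) \<partial>M)"
    using prob_stay_halfline[OF s Z, of 0] ZV by (fastforce simp: \<eta>_def q_def less_imp_le)
  have int_h: "integrable M (\<lambda>\<omega>. indicator Z \<omega> * heat 1 sgn (\<eta> \<omega>))"
  proof (rule integrable_indicator_mult[OF ZM])
    have "heat 1 sgn \<in> borel_measurable borel" by (rule borel_measurable_heat) measurable
    then show "(\<lambda>\<omega>. heat 1 sgn (\<eta> \<omega>)) \<in> borel_measurable M" by (rule measurable_compose[OF m\<eta>])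
    show "\<bar>heat 1 sgn (\<eta> \<omega>)\<bar> \<le> 1" for \<omega> by (rule heat_bounded) (auto simp: sgn_if)
  qed
  have bnd: "\<omega> \<in> Z \<Longrightarrow> \<bar>\<eta> \<omega>\<bar> \<le> \<delta>" for \<omega> using \<eta>[of \<omega>] by auto
  have int_\<eta>: "integrable M (\<lambda>\<omega>. indicator Z \<omega> * \<eta> \<omega>)"
    using ZM m\<eta> bnd by (intro integrable_indicator_mult)
  have int_sin: "integrable M (\<lambda>\<omega>. indicator Z \<omega> * sin (pi * (\<eta> \<omega> / \<epsilon>)))"
    using ZM m\<eta> by (intro integrable_indicator_mult[where K=1]) auto
  have nd: "0 < std_normal_density x" for x by (rule normal_density_pos) simp
  have nz: "std_normal_density x \<noteq> 0" for x using nd[of x] by linarith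
  have ratio: "2 * x * std_normal_density \<delta> \<le> heat 1 sgn x" "heat 1 sgn x \<le> 2 * x * std_normal_density 0"
    if "0 < x" "x \<le> \<delta>" for x
  proof -
    have "2 * x * std_normal_density \<delta> \<le> 2 * x * std_normal_density x"
      using that by (intro mult_left_mono std_normal_density_antimono) auto
    also have "\<dots> \<le> heat 1 sgn x" using that by (intro heat_sgn_bounds) auto
    finally show "2 * x * std_normal_density \<delta> \<le> heat 1 sgn x" .
    show "heat 1 sgn x \<le> 2 * x * std_normal_density 0" using that by (intro heat_sgn_bounds) auto
  qed
  have "(\<integral>\<omega>. indicator Z \<omega> * (4 * V s \<omega> / c * E * (1 + R)) \<partial>M)
      \<le> (\<integral>\<omega>. strip_upper \<epsilon> \<delta> * (indicator Z \<omega> * heat 1 sgn (\<eta> \<omega>)) \<partial>M)"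
  proof (rule integral_mono)
    have "integrable M (\<lambda>\<omega>. (4 / \<epsilon> * E * (1 + R)) * (indicator Z \<omega> * \<eta> \<omega>))"
      by (intro integrable_mult_right int_\<eta>)
    moreover have "indicator Z \<omega> * (4 * V s \<omega> / c * E * (1 + R)) = (4 / \<epsilon> * E * (1 + R)) * (indicator Z \<omega> * \<eta> \<omega>)" for \<omega>
    proof -
      have "4 * V s \<omega> / c = 4 * (V s \<omega> / c)" by simp
      then show ?thesis unfolding Vc by (simp add: algebra_simps)
    qed
    ultimately show "integrable M (\<lambda>\<omega>. indicator Z \<omega> * (4 * V s \<omega> / c * E * (1 + R)))" by simp
    show "integrable M (\<lambda>\<omega>. strip_upper \<epsilon> \<delta> * (indicator Z \<omega> * heat 1 sgn (\<eta> \<omega>)))"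
      by (intro integrable_mult_right int_h)
    fix \<omega> assume "\<omega> \<in> space M"
    show "indicator Z \<omega> * (4 * V s \<omega> / c * E * (1 + R)) \<le> strip_upper \<epsilon> \<delta> * (indicator Z \<omega> * heat 1 sgn (\<eta> \<omega>))"
    proof (cases "\<omega> \<in> Z")
      case True
      have "4 * V s \<omega> / c * E * (1 + R) = 4 * (V s \<omega> / c) * E * (1 + R)" by simp
      also have "\<dots> = strip_upper \<epsilon> \<delta> * (2 * \<eta> \<omega> * std_normal_density \<delta>)"
        unfolding strip_upper_def E_def[symmetric] R_def[symmetric] Vc using nz[of \<delta>] e by (simp add: field_simps)
      also have "\<dots> \<le> strip_upper \<epsilon> \<delta> * heat 1 sgn (\<eta> \<omega>)"
        using ratio(1)[OF \<eta>[OF True]] e R0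
        by (intro mult_left_mono) (auto simp: strip_upper_def R_def[symmetric] less_imp_le[OF nd])
      finally show ?thesis using True by simp
    qed simp
  qed
  with strip(1) show "prob (Z \<inter> stay s t {0..\<epsilon> * sqrt (t - s)}) \<le> strip_upper \<epsilon> \<delta> * prob (Z \<inter> stay s t {0..})"
    unfolding half c_def q_def by simp
  show "strip_lower \<epsilon> \<delta> * prob (Z \<inter> stay s t {0..}) \<le> prob (Z \<inter> stay s t {0..\<epsilon> * sqrt (t - s)})"
  \<comment> \<open>The pointwise comparison multiplies by \<open>strip_lower\<close>, which must be
    nonnegative for it; otherwise the left side is at most 0 anyway.\<close>
  proof (cases "0 \<le> cos (pi * \<delta> / \<epsilon>) - R")
    case False
    then have "strip_lower \<epsilon> \<delta> \<le> 0"
      unfolding strip_lower_def R_def[symmetric] using e nd[of 0] by (intro mult_nonneg_nonpos) auto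
    then have "strip_lower \<epsilon> \<delta> * prob (Z \<inter> stay s t {0..}) \<le> 0" by (intro mult_nonpos_nonneg) auto
    also have "0 \<le> prob (Z \<inter> stay s t {0..\<epsilon> * sqrt (t - s)})" by simp
    finally show ?thesis .
  next
    case True
    note cR = this
    have "(\<integral>\<omega>. strip_lower \<epsilon> \<delta> * (indicator Z \<omega> * heat 1 sgn (\<eta> \<omega>)) \<partial>M)
      \<le> (\<integral>\<omega>. indicator Z \<omega> * (4 / pi * sin (pi * V s \<omega> / c) * E - 4 * V s \<omega> / c * E * R) \<partial>M)"
    proof (rule integral_mono)
      show "integrable M (\<lambda>\<omega>. strip_lower \<epsilon> \<delta> * (indicator Z \<omega> * heat 1 sgn (\<eta> \<omega>)))"
        by (intro integrable_mult_right int_h)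
      have rw: "4 / pi * sin (pi * V s \<omega> / c) * E - 4 * V s \<omega> / c * E * R
          = 4 / pi * E * sin (pi * (\<eta> \<omega> / \<epsilon>)) - 4 / \<epsilon> * E * R * \<eta> \<omega>" for \<omega>
      proof -
        have "4 * V s \<omega> / c = 4 * (V s \<omega> / c)" "pi * V s \<omega> / c = pi * (V s \<omega> / c)" by simp_all
        then show ?thesis unfolding Vc by (simp add: mult_ac)
      qed
      have "integrable M (\<lambda>\<omega>. 4 / pi * E * (indicator Z \<omega> * sin (pi * (\<eta> \<omega> / \<epsilon>))) - 4 / \<epsilon> * E * R * (indicator Z \<omega> * \<eta> \<omega>))"
        by (intro Bochner_Integration.integrable_diff integrable_mult_right int_\<eta> int_sin)
      then show "integrable M (\<lambda>\<omega>. indicator Z \<omega> * (4 / pi * sin (pi * V s \<omega> / c) * E - 4 * V s \<omega> / c * E * R))"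
        unfolding rw by (simp add: algebra_simps)
      fix \<omega> assume "\<omega> \<in> space M"
      show "strip_lower \<epsilon> \<delta> * (indicator Z \<omega> * heat 1 sgn (\<eta> \<omega>))
          \<le> indicator Z \<omega> * (4 / pi * sin (pi * V s \<omega> / c) * E - 4 * V s \<omega> / c * E * R)"
      proof (cases "\<omega> \<in> Z")
        case True
        define x where "x = pi * (\<eta> \<omega> / \<epsilon>)"
        \<comment> \<open>Because \<open>\<delta> \<le> \<epsilon>\<close>, all angles stay in
          \<open>[0, pi]\<close>, where the cosine decreases and \<open>sin_ge_mult_cos\<close>
          applies.\<close>
        have "\<eta> \<omega> / \<epsilon> \<le> \<delta> / \<epsilon>" "\<delta> / \<epsilon> \<le> 1" using \<eta>[OF True] d e by (auto intro: divide_right_mono)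
        then have "pi * (\<eta> \<omega> / \<epsilon>) \<le> pi * (\<delta> / \<epsilon>)" "pi * (\<delta> / \<epsilon>) \<le> pi * 1"
          by (intro mult_left_mono; simp)+
        then have x: "0 \<le> x" "x \<le> pi * \<delta> / \<epsilon>" "pi * \<delta> / \<epsilon> \<le> pi * 1"
          unfolding x_def using \<eta>[OF True] e by auto
        have "x * cos (pi * \<delta> / \<epsilon>) \<le> x * cos x"
          using x by (intro mult_left_mono cos_monotone_0_pi_le) auto
        also have "\<dots> \<le> sin x" using x by (intro sin_ge_mult_cos) auto
        finally have sx: "x * cos (pi * \<delta> / \<epsilon>) \<le> sin x" .
        have "strip_lower \<epsilon> \<delta> * heat 1 sgn (\<eta> \<omega>) \<le> strip_lower \<epsilon> \<delta> * (2 * \<eta> \<omega> * std_normal_density 0)"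
          using ratio(2)[OF \<eta>[OF True]] e cR
          by (intro mult_left_mono) (auto simp: strip_lower_def R_def[symmetric] less_imp_le[OF nd])
        also have "\<dots> = 4 / \<epsilon> * E * \<eta> \<omega> * (cos (pi * \<delta> / \<epsilon>) - R)"
          unfolding strip_lower_def E_def[symmetric] R_def[symmetric] using nz[of 0] e by (simp add: field_simps)
        also have "\<dots> = 4 / pi * E * (x * cos (pi * \<delta> / \<epsilon>)) - 4 / \<epsilon> * E * R * \<eta> \<omega>"
          using e by (simp add: x_def field_simps)
        also have "\<dots> \<le> 4 / pi * E * sin x - 4 / \<epsilon> * E * R * \<eta> \<omega>"
          using sx E0 by (intro diff_right_mono mult_left_mono) auto
        finally show ?thesis unfolding rw using True by (simp add: x_def)
      qed simp
    qed
    with strip(2) show ?thesis unfolding half c_def q_def by simp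
  qed
qed

section \<open>From positive paths to zero-free paths of either sign\<close>

lemma continuous_brownian_motion_uminus: "continuous_brownian_motion M (\<lambda>t \<omega>. - V t \<omega>)"
proof unfold_locales
  fix n :: nat and t :: "nat \<Rightarrow> real"
  assume "0 \<le> t 0" "\<And>i. i < n \<Longrightarrow> t i \<le> t (Suc i)"
  then have "indep_vars (\<lambda>_. borel) (\<lambda>i \<omega>. V (t (Suc i)) \<omega> - V (t i) \<omega>) {..<n}"
    by (rule indep_increments)
  then have "indep_vars (\<lambda>_. borel) (\<lambda>i \<omega>. uminus (V (t (Suc i)) \<omega> - V (t i) \<omega>)) {..<n}"
    by (rule indep_vars_compose2[where Y="\<lambda>_. uminus"]) auto
  then show "indep_vars (\<lambda>_. borel) (\<lambda>i \<omega>. - V (t (Suc i)) \<omega> - - V (t i) \<omega>) {..<n}"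
    by (simp add: algebra_simps)
next
  fix s t :: real assume st: "0 \<le> s" "s < t"
  have "distributed M lborel (\<lambda>\<omega>. 0 + (-1) * (V t \<omega> - V s \<omega>)) (normal_density (0 + (-1) * 0) (\<bar>-1\<bar> * sqrt (t - s)))"
    using st by (intro normal_density_affine normal_increments) auto
  then show "distributed M lborel (\<lambda>\<omega>. - V t \<omega> - - V s \<omega>) (normal_density 0 (sqrt (t - s)))"
    by (simp add: algebra_simps)
qed (auto intro!: measurable_V continuous_V continuous_on_minus simp: V_0)

definition zero_free :: "real \<Rightarrow> real \<Rightarrow> 'a set" where
  "zero_free s t = {\<omega> \<in> space M. \<forall>r\<in>{s..t}. V r \<omega> \<noteq> 0}"

text \<open>On a compact interval a zero-free continuous path has a positive minimal modulus. This
  writes the event as a countable union of events of staying in a closed set.\<close>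

lemma zero_free_sets_past:
  assumes "0 \<le> s" "s \<le> t"
  shows "zero_free s t \<in> sets (past t)"
proof -
  have "zero_free s t = (\<Union>n. stay s t {y. inverse (real (Suc n)) \<le> \<bar>y\<bar>})"
  proof (intro equalityI subsetI)
    fix \<omega> assume w: "\<omega> \<in> zero_free s t"
    then have "continuous_on {s..t} (\<lambda>r. \<bar>V r \<omega>\<bar>)"
      using assms by (intro continuous_on_rabs continuous_on_subset[OF continuous_V]) (auto simp: zero_free_def)
    from continuous_attains_inf[OF _ _ this] obtain r where r: "r \<in> {s..t}" "\<And>u. u \<in> {s..t} \<Longrightarrow> \<bar>V r \<omega>\<bar> \<le> \<bar>V u \<omega>\<bar>"
      using assms by auto
    then have "0 < \<bar>V r \<omega>\<bar>" using w by (auto simp: zero_free_def)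
    from reals_Archimedean[OF this] obtain n where "inverse (real (Suc n)) < \<bar>V r \<omega>\<bar>" by blast
    then have "inverse (real (Suc n)) \<le> \<bar>V u \<omega>\<bar>" if "u \<in> {s..t}" for u
      using r(2)[OF that] by linarith
    then have "\<omega> \<in> stay s t {y. inverse (real (Suc n)) \<le> \<bar>y\<bar>}"
      using w unfolding stay_def zero_free_def by blast
    then show "\<omega> \<in> (\<Union>n. stay s t {y. inverse (real (Suc n)) \<le> \<bar>y\<bar>})" by blast
  next
    fix \<omega> assume "\<omega> \<in> (\<Union>n. stay s t {y. inverse (real (Suc n)) \<le> \<bar>y\<bar>})"
    then obtain n where n: "\<omega> \<in> stay s t {y. inverse (real (Suc n)) \<le> \<bar>y\<bar>}" by blast
    have "V r \<omega> \<noteq> 0" if "r \<in> {s..t}" for r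
    proof -
      have "inverse (real (Suc n)) \<le> \<bar>V r \<omega>\<bar>" using n that unfolding stay_def by blast
      moreover have "0 < inverse (real (Suc n))" by simp
      ultimately show ?thesis by linarith
    qed
    with n show "\<omega> \<in> zero_free s t" unfolding stay_def zero_free_def by blast
  qed
  also have "\<dots> \<in> sets (past t)"
    using assms by (intro sets.countable_UN) (auto intro!: stay_sets_past closed_Collect_le continuous_intros)
  finally show ?thesis .
qed

text \<open>A zero-free path keeps its sign by the intermediate value theorem. Conversely, a path
  that starts positive and stays nonnegative has no zero only up to a null set, by
  \<open>AE_stay_nonneg_pos\<close>. The negative paths are those of \<open>- V\<close>.\<close>

lemma prob_zero_free_stay:
  assumes s: "0 \<le> s" "s < t" and D: "closed D" "\<And>y. y \<in> D \<longleftrightarrow> - y \<in> D" and Z: "Z \<in> sets (past s)"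
  shows "prob (Z \<inter> zero_free s t \<inter> stay s t D)
    = prob ({\<omega> \<in> Z. 0 < V s \<omega>} \<inter> stay s t ({0..} \<inter> D))
      + prob ({\<omega> \<in> Z. 0 < - V s \<omega>} \<inter> {\<omega> \<in> space M. \<forall>r\<in>{s..t}. - V r \<omega> \<in> {0..} \<inter> D})"
    (is "_ = prob ?P + prob ?N")
proof -
  interpret N: continuous_brownian_motion M "\<lambda>t \<omega>. - V t \<omega>" by (rule continuous_brownian_motion_uminus)
  have ZM: "Z \<in> sets M" using Z sets_past_subset by blast
  have mV: "V s \<in> borel_measurable M" using s by (intro measurable_V)
  have Zp: "{\<omega> \<in> Z. 0 < V s \<omega>} \<in> sets M" "{\<omega> \<in> Z. 0 < - V s \<omega>} \<in> sets M"
  proof -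
    have "{\<omega> \<in> space M. 0 < V s \<omega>} \<in> sets M" "{\<omega> \<in> space M. 0 < - V s \<omega>} \<in> sets M" using mV by measurable
    moreover have "{\<omega> \<in> Z. 0 < V s \<omega>} = Z \<inter> {\<omega> \<in> space M. 0 < V s \<omega>}"
      "{\<omega> \<in> Z. 0 < - V s \<omega>} = Z \<inter> {\<omega> \<in> space M. 0 < - V s \<omega>}"
      using sets.sets_into_space[OF ZM] by auto
    ultimately show "{\<omega> \<in> Z. 0 < V s \<omega>} \<in> sets M" "{\<omega> \<in> Z. 0 < - V s \<omega>} \<in> sets M" using ZM by auto
  qed
  have cl: "closed ({0..} \<inter> D)" using D by (intro closed_Int) auto
  have PM: "?P \<in> sets M" using Zp(1) cl s by (intro sets.Int stay_sets) auto
  have NM: "?N \<in> sets M" using Zp(2) N.stay_sets[OF s(1) less_imp_le[OF s(2)] cl] unfolding N.stay_def by (intro sets.Int)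
  have zM: "zero_free s t \<in> sets M" using zero_free_sets_past[of s t] s sets_past_subset by auto
  have "prob (Z \<inter> zero_free s t \<inter> stay s t D) = prob (?P \<union> ?N)"
  proof (rule measure_eq_AE)
    show "Z \<inter> zero_free s t \<inter> stay s t D \<in> events" using ZM zM s D by (intro sets.Int stay_sets) auto
    show "?P \<union> ?N \<in> events" by (intro sets.Un PM NM)
    show "AE \<omega> in M. (\<omega> \<in> Z \<inter> zero_free s t \<inter> stay s t D) = (\<omega> \<in> ?P \<union> ?N)"
      using AE_stay_nonneg_pos[OF s] N.AE_stay_nonneg_pos[OF s] AE_space
    proof eventually_elim
      case (elim \<omega>)
      have cont: "continuous_on {s..t} (\<lambda>r. V r \<omega>)"
        using s by (intro continuous_on_subset[OF continuous_V[OF elim(3)]]) auto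
      then have cont': "continuous_on {s..t} (\<lambda>r. - V r \<omega>)" by (intro continuous_on_minus)
      show ?case
      proof
        assume w: "\<omega> \<in> Z \<inter> zero_free s t \<inter> stay s t D"
        then have nz: "\<And>r. r \<in> {s..t} \<Longrightarrow> V r \<omega> \<noteq> 0" by (auto simp: zero_free_def)
        have "V s \<omega> \<noteq> 0" using nz s by auto
        then consider "0 < V s \<omega>" | "0 < - V s \<omega>" by linarith
        then show "\<omega> \<in> ?P \<union> ?N"
        proof cases
          case 1
          then have "0 < V r \<omega>" if "r \<in> {s..t}" for r by (intro IVT_pos[OF cont nz _ that])
          with w 1 have "\<omega> \<in> ?P" by (auto simp: stay_def less_imp_le)
          then show ?thesis by blast
        next
          case 2
          then have "0 < - V r \<omega>" if "r \<in> {s..t}" for r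
            using IVT_pos[OF cont' _ _ that] nz by (auto simp: neg_equal_0_iff_equal)
          with w 2 D(2) have "\<omega> \<in> ?N" by (auto simp: stay_def less_imp_le)
          then show ?thesis by blast
        qed
      next
        assume "\<omega> \<in> ?P \<union> ?N"
        then show "\<omega> \<in> Z \<inter> zero_free s t \<inter> stay s t D"
        proof
          assume w: "\<omega> \<in> ?P"
          then have "\<forall>r\<in>{s..t}. 0 < V r \<omega>" using elim(1) by (auto simp: stay_def)
          then show ?thesis using w by (auto simp: stay_def zero_free_def)
        next
          assume w: "\<omega> \<in> ?N"
          then have "\<forall>r\<in>{s..t}. 0 < - V r \<omega>" using elim(2) by (auto simp: N.stay_def)
          then show ?thesis using w D(2) by (auto simp: stay_def zero_free_def)
        qed
      qed
    qed
  qed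
  also have "\<dots> = prob ?P + prob ?N"
    by (rule finite_measure_Union[OF PM NM]) auto
  finally show ?thesis .
qed

lemma prob_zero_free_strip:
  assumes s: "0 \<le> s" "s < t" and d: "0 < \<delta>" "\<delta> \<le> \<epsilon>" and Z: "Z \<in> sets (past s)"
    and ZV: "\<And>\<omega>. \<omega> \<in> Z \<Longrightarrow> \<bar>V s \<omega>\<bar> \<le> \<delta> * sqrt (t - s)"
  defines "D \<equiv> {- (\<epsilon> * sqrt (t - s))..\<epsilon> * sqrt (t - s)}"
  shows "prob (Z \<inter> zero_free s t \<inter> stay s t D) \<le> strip_upper \<epsilon> \<delta> * prob (Z \<inter> zero_free s t)"
    and "strip_lower \<epsilon> \<delta> * prob (Z \<inter> zero_free s t) \<le> prob (Z \<inter> zero_free s t \<inter> stay s t D)"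
proof -
  interpret N: continuous_brownian_motion M "\<lambda>t \<omega>. - V t \<omega>" by (rule continuous_brownian_motion_uminus)
  \<comment> \<open>\<open>V\<close> and \<open>- V\<close> generate the same past, so events of the
    past may be used with the half-line comparison for \<open>- V\<close>.\<close>
  have past_N: "N.past s = past s"
  proof -
    have "{V r -` A \<inter> space M | r A. 0 \<le> r \<and> r \<le> s \<and> A \<in> sets borel}
        = {(\<lambda>\<omega>. - V r \<omega>) -` A \<inter> space M | r A. 0 \<le> r \<and> r \<le> s \<and> A \<in> sets borel}"
    proof (intro equalityI subsetI; clarify)
      fix r and A :: "real set" assume "0 \<le> r" "r \<le> s" "A \<in> sets borel"
      moreover have "uminus -` A \<in> sets borel"
        using measurable_sets[of "uminus :: real \<Rightarrow> real" borel borel A] \<open>A \<in> sets borel\<close> by simp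
      moreover have "V r -` A = (\<lambda>\<omega>. - V r \<omega>) -` (uminus -` A)" "(\<lambda>\<omega>. - V r \<omega>) -` A = V r -` (uminus -` A)" by auto
      ultimately show "\<exists>r' A'. V r -` A \<inter> space M = (\<lambda>\<omega>. - V r' \<omega>) -` A' \<inter> space M \<and> 0 \<le> r' \<and> r' \<le> s \<and> A' \<in> sets borel"
        "\<exists>r' A'. (\<lambda>\<omega>. - V r \<omega>) -` A \<inter> space M = V r' -` A' \<inter> space M \<and> 0 \<le> r' \<and> r' \<le> s \<and> A' \<in> sets borel"
        by (metis (no_types))+
    qed
    then show ?thesis unfolding past_def N.past_def by simp
  qed
  define Zp where "Zp = {\<omega> \<in> Z. 0 < V s \<omega>}"
  define Zm where "Zm = {\<omega> \<in> Z. 0 < - V s \<omega>}"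
  have mV: "V s \<in> borel_measurable (past s)" using s by (intro measurable_V_past) auto
  have "{\<omega> \<in> space (past s). 0 < V s \<omega>} \<in> sets (past s)" "{\<omega> \<in> space (past s). 0 < - V s \<omega>} \<in> sets (past s)"
    using mV by measurable
  moreover have "Zp = Z \<inter> {\<omega> \<in> space (past s). 0 < V s \<omega>}" "Zm = Z \<inter> {\<omega> \<in> space (past s). 0 < - V s \<omega>}"
    using sets.sets_into_space[OF Z] by (auto simp: Zp_def Zm_def)
  ultimately have Zpm: "Zp \<in> sets (past s)" "Zm \<in> sets (N.past s)" using Z past_N by auto
  have c0: "0 \<le> \<epsilon> * sqrt (t - s)" using s d by auto
  then have Dc: "{0..} \<inter> D = {0..\<epsilon> * sqrt (t - s)}" by (auto simp: D_def)
  have *: "prob (Z \<inter> zero_free s t \<inter> stay s t D)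
      = prob (Zp \<inter> stay s t {0..\<epsilon> * sqrt (t - s)}) + prob (Zm \<inter> N.stay s t {0..\<epsilon> * sqrt (t - s)})"
    unfolding Zp_def Zm_def N.stay_def Dc[symmetric]
    by (rule prob_zero_free_stay[OF s _ _ Z]) (auto simp: D_def)
  \<comment> \<open>Taking \<open>UNIV\<close> for \<open>D\<close> gives the zero-free probability
    by the same decomposition as the strip, so the bounds for the two signs simply add up.\<close>
  have "Z \<inter> zero_free s t \<inter> stay s t UNIV = Z \<inter> zero_free s t" by (auto simp: stay_def zero_free_def)
  then have **: "prob (Z \<inter> zero_free s t) = prob (Zp \<inter> stay s t {0..}) + prob (Zm \<inter> N.stay s t {0..})"
    unfolding Zp_def Zm_def N.stay_def using prob_zero_free_stay[OF s _ _ Z, of UNIV] by simp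
  have "\<And>\<omega>. \<omega> \<in> Zp \<Longrightarrow> 0 < V s \<omega> \<and> V s \<omega> \<le> \<delta> * sqrt (t - s)"
    "\<And>\<omega>. \<omega> \<in> Zm \<Longrightarrow> 0 < - V s \<omega> \<and> - V s \<omega> \<le> \<delta> * sqrt (t - s)"
    using ZV by (force simp: Zp_def Zm_def)+
  note P = prob_strip_halfline[OF s d Zpm(1) this(1)] and N = N.prob_strip_halfline[OF s d Zpm(2) this(2)]
  show "prob (Z \<inter> zero_free s t \<inter> stay s t D) \<le> strip_upper \<epsilon> \<delta> * prob (Z \<inter> zero_free s t)"
    unfolding * ** distrib_left using P(1) N(1) by (rule add_mono)
  show "strip_lower \<epsilon> \<delta> * prob (Z \<inter> zero_free s t) \<le> prob (Z \<inter> zero_free s t \<inter> stay s t D)"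
    unfolding * ** distrib_left using P(2) N(2) by (rule add_mono)
qed

end

section \<open>Last-exit decomposition\<close>

context continuous_brownian_motion
begin

section \<open>The last zero and measurability of the meander event\<close>

lemma mem_stay_abs: "\<omega> \<in> stay s t {- c..c} \<longleftrightarrow> \<omega> \<in> space M \<and> (\<forall>r\<in>{s..t}. \<bar>V r \<omega>\<bar> \<le> c)"
  by (auto simp: stay_def abs_le_iff minus_le_iff)

text \<open>The zeros in \<open>[0, 1]\<close> form a closed set containing 0, so the supremum is
  attained.\<close>

lemma last_zero_props:
  assumes "\<omega> \<in> space M"
  shows "0 \<le> last_zero V \<omega>" "last_zero V \<omega> \<le> 1" "V (last_zero V \<omega>) \<omega> = 0"
    and "\<And>r. 0 \<le> r \<Longrightarrow> r \<le> 1 \<Longrightarrow> V r \<omega> = 0 \<Longrightarrow> r \<le> last_zero V \<omega>"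
proof -
  define S where "S = {t. 0 \<le> t \<and> t \<le> 1 \<and> V t \<omega> = 0}"
  have g: "last_zero V \<omega> = Sup S" by (simp add: last_zero_def S_def)
  have ne: "0 \<in> S" using V_0[OF assms] by (simp add: S_def)
  have bd: "bdd_above S" by (auto simp: S_def bdd_above_def)
  have "continuous_on {0..1} (\<lambda>t. V t \<omega>)" by (rule continuous_on_subset[OF continuous_V[OF assms]]) auto
  then have "closed ({0..1} \<inter> (\<lambda>t. V t \<omega>) -` {0})"
    by (rule continuous_closed_preimage) auto
  moreover have "{0..1} \<inter> (\<lambda>t. V t \<omega>) -` {0} = S" by (auto simp: S_def)
  ultimately have "closed S" by simp
  then have "Sup S \<in> S" using ne bd by (intro closed_contains_Sup) auto
  then show "0 \<le> last_zero V \<omega>" "last_zero V \<omega> \<le> 1" "V (last_zero V \<omega>) \<omega> = 0"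
    unfolding g by (auto simp: S_def)
  show "r \<le> last_zero V \<omega>" if "0 \<le> r" "r \<le> 1" "V r \<omega> = 0" for r
    unfolding g using that bd by (intro cSup_upper) (auto simp: S_def)
qed

lemma last_zero_less_iff:
  assumes "\<omega> \<in> space M" "0 \<le> a" "a \<le> 1"
  shows "last_zero V \<omega> < a \<longleftrightarrow> \<omega> \<in> zero_free a 1"
proof
  assume "last_zero V \<omega> < a"
  then have "V r \<omega> \<noteq> 0" if "r \<in> {a..1}" for r
    using last_zero_props(4)[OF assms(1), of r] assms(2) that by auto
  then show "\<omega> \<in> zero_free a 1" using assms(1) by (simp add: zero_free_def)
next
  assume "\<omega> \<in> zero_free a 1"
  then show "last_zero V \<omega> < a"
    using last_zero_props(1-3)[OF assms(1)] by (force simp: zero_free_def)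
qed

lemma measurable_last_zero: "last_zero V \<in> borel_measurable M"
proof (rule borel_measurable_iff_less[THEN iffD2], rule allI)
  fix a :: real
  consider "a < 0" | "1 < a" | "0 \<le> a" "a \<le> 1" by linarith
  then show "{\<omega> \<in> space M. last_zero V \<omega> < a} \<in> sets M"
  proof cases
    case 1
    have "\<not> last_zero V \<omega> < a" if "\<omega> \<in> space M" for \<omega>
      using last_zero_props(1)[OF that] 1 by linarith
    then have "{\<omega> \<in> space M. last_zero V \<omega> < a} = {}" by blast
    then show ?thesis by (simp only: sets.empty_sets)
  next
    case 2
    have "last_zero V \<omega> < a" if "\<omega> \<in> space M" for \<omega>
      using last_zero_props(2)[OF that] 2 by linarith
    then have "{\<omega> \<in> space M. last_zero V \<omega> < a} = space M" by blast
    then show ?thesis by (simp only: sets.top)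
  next
    case 3
    then have "{\<omega> \<in> space M. last_zero V \<omega> < a} = zero_free a 1"
      using last_zero_less_iff by (auto simp: zero_free_def)
    then show ?thesis using zero_free_sets_past[of a 1] 3 sets_past_subset by auto
  qed
qed

lemma AE_last_zero_less_1: "AE \<omega> in M. last_zero V \<omega> < 1"
  using AE_V_neq[OF zero_less_one, of 0] AE_space
proof eventually_elim
  case (elim \<omega>)
  then show ?case using last_zero_props(2,3)[of \<omega>] by (cases "last_zero V \<omega> = 1") auto
qed

text \<open>The event for the supremum, with the division by
  \<open>sqrt (1 - last_zero V \<omega>)\<close> cleared and time running over the original interval
  after the last zero.\<close>

definition meander_below :: "real \<Rightarrow> 'a set" where
  "meander_below \<epsilon> = {\<omega> \<in> space M. \<forall>r\<in>{last_zero V \<omega>..1}. \<bar>V r \<omega>\<bar> \<le> \<epsilon> * sqrt (1 - last_zero V \<omega>)}"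

text \<open>The time interval has a random left end, so the measurability of \<open>stay\<close>
  does not apply. Instead, rational times are tested under the condition that they lie after the
  last zero.\<close>

lemma meander_below_sets: "meander_below \<epsilon> \<in> sets M"
proof -
  have "meander_below \<epsilon> = {\<omega> \<in> space M. \<forall>q\<in>\<rat> \<inter> {0..1}. last_zero V \<omega> \<le> q \<longrightarrow> \<bar>V q \<omega>\<bar> \<le> \<epsilon> * sqrt (1 - last_zero V \<omega>)}"
    (is "_ = ?B")
  proof (intro equalityI subsetI)
    fix \<omega> assume w: "\<omega> \<in> ?B"
    define g where "g = last_zero V \<omega>"
    define c where "c = \<epsilon> * sqrt (1 - g)"
    have \<omega>: "\<omega> \<in> space M" and q: "\<And>q. q \<in> \<rat> \<Longrightarrow> q \<in> {0..1} \<Longrightarrow> g \<le> q \<Longrightarrow> \<bar>V q \<omega>\<bar> \<le> c"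
      using w by (auto simp: g_def c_def)
    have g: "0 \<le> g" "g \<le> 1" using last_zero_props[OF \<omega>] by (auto simp: g_def)
    have "\<bar>V r \<omega>\<bar> \<le> c" if r: "r \<in> {g..1}" for r
    proof (rule ccontr)
      assume n: "\<not> \<bar>V r \<omega>\<bar> \<le> c"
      show False
      \<comment> \<open>For \<open>g = 1\<close> the interval is the single rational point 1.
        Otherwise it has interior points, and rational ones can be found near any \<open>r\<close>,
        even an end point.\<close>
      proof (cases "g = 1")
        case True
        then have "r = 1" using r by simp
        then show False using n q[of 1] True by simp
      next
        case False
        have "continuous_on {g..1} (\<lambda>u. \<bar>V u \<omega>\<bar>)"
          using g by (intro continuous_on_rabs continuous_on_subset[OF continuous_V[OF \<omega>]]) auto
        then have "\<forall>\<^sub>F u in at r within {g..1}. c < \<bar>V u \<omega>\<bar>"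
          using r n by (intro order_tendstoD(1)[where y="\<bar>V r \<omega>\<bar>"]) (auto simp: continuous_on_def)
        then obtain d where d: "0 < d" "\<And>u. u \<in> {g..1} \<Longrightarrow> u \<noteq> r \<Longrightarrow> dist u r < d \<Longrightarrow> c < \<bar>V u \<omega>\<bar>"
          unfolding eventually_at by blast
        have "max g (r - d) < min 1 (r + d)" using False g r d(1) by auto
        then obtain u where u: "u \<in> \<rat>" "max g (r - d) < u" "u < min 1 (r + d)"
          using Rats_dense_in_real by blast
        then have "\<bar>V u \<omega>\<bar> \<le> c" using g by (intro q) auto
        moreover have "c < \<bar>V u \<omega>\<bar>"
        proof (cases "u = r")
          case True then show ?thesis using n by simp
        next
          case False then show ?thesis using u by (intro d(2)) (auto simp: dist_real_def)
        qed
        ultimately show False by simp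
      qed
    qed
    then show "\<omega> \<in> meander_below \<epsilon>" using \<omega> by (auto simp: meander_below_def g_def c_def)
  qed (auto simp: meander_below_def)
  also have "\<dots> \<in> sets M"
  proof -
    have "?B = (\<Inter>q\<in>\<rat> \<inter> {0..1}. {\<omega> \<in> space M. last_zero V \<omega> \<le> q \<longrightarrow> \<bar>V q \<omega>\<bar> \<le> \<epsilon> * sqrt (1 - last_zero V \<omega>)})"
      by (auto intro!: exI[of _ 0] bexI[of _ 0])
    also have "\<dots> \<in> sets M"
    proof (rule sets.countable_INT')
      show "countable (\<rat> \<inter> {0..1} :: real set)" using countable_rat by (rule countable_Int1)
      have "0 \<in> \<rat> \<inter> {0..1::real}" by simp
      then show "\<rat> \<inter> {0..1::real} \<noteq> {}" by blast
      show "(\<lambda>q. {\<omega> \<in> space M. last_zero V \<omega> \<le> q \<longrightarrow> \<bar>V q \<omega>\<bar> \<le> \<epsilon> * sqrt (1 - last_zero V \<omega>)}) ` (\<rat> \<inter> {0..1}) \<subseteq> sets M"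
      proof (intro image_subsetI)
        fix q :: real assume q: "q \<in> \<rat> \<inter> {0..1}"
        then have [measurable]: "V q \<in> borel_measurable M" by (intro measurable_V) auto
        note measurable_last_zero [measurable]
        show "{\<omega> \<in> space M. last_zero V \<omega> \<le> q \<longrightarrow> \<bar>V q \<omega>\<bar> \<le> \<epsilon> * sqrt (1 - last_zero V \<omega>)} \<in> sets M"
          by measurable
      qed
    qed
    finally show ?thesis .
  qed
  finally show ?thesis .
qed

text \<open>On \<open>near_zero \<delta> n k\<close> without zeros in \<open>[k / n, 1]\<close>, the last zero may be replaced by the
  right end point of its cell. The condition in \<open>cells\<close> keeps the time left before and after
  this replacement comparable; it only discards cells close to 1.\<close>

definition near_zero :: "real \<Rightarrow> nat \<Rightarrow> nat \<Rightarrow> 'a set" where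
  "near_zero \<delta> n k = (space M - zero_free ((real k - 1) / n) (k / n)) \<inter>
     stay ((real k - 1) / n) (k / n) {- (\<delta> * sqrt (1 - k / n))..\<delta> * sqrt (1 - k / n)}"

definition cells :: "real \<Rightarrow> nat \<Rightarrow> nat set" where
  "cells \<delta> n = {k. 1 \<le> k \<and> k < n \<and> 1 - (real k - 1) / n \<le> (1 + \<delta>)\<^sup>2 * (1 - k / n)}"

definition good :: "real \<Rightarrow> nat \<Rightarrow> 'a set" where
  "good \<delta> n = (\<Union>k\<in>cells \<delta> n. near_zero \<delta> n k \<inter> zero_free (k / n) 1)"

section \<open>Locating the last zero in a grid cell\<close>

lemma finite_cells: "finite (cells \<delta> n)"
  by (rule finite_subset[of _ "{..n}"]) (auto simp: cells_def)

lemma cells_bounds: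
  assumes "k \<in> cells \<delta> n"
  shows "0 \<le> (real k - 1) / n" "(real k - 1) / n \<le> k / n" "0 \<le> real k / n" "k / n < 1"
  using assms by (auto simp: cells_def divide_right_mono)

lemma near_zero_sets_past:
  assumes "k \<in> cells \<delta> n" shows "near_zero \<delta> n k \<in> sets (past (k / n))"
proof -
  have "space (past (k / n)) - zero_free ((real k - 1) / n) (k / n) \<in> sets (past (k / n))"
    using cells_bounds[OF assms] by (intro sets.compl_sets zero_free_sets_past) auto
  then show ?thesis unfolding near_zero_def
    using cells_bounds[OF assms] by (intro sets.Int stay_sets_past) auto
qed

lemma near_zero_last_zero:
  assumes k: "k \<in> cells \<delta> n" and w: "\<omega> \<in> near_zero \<delta> n k" "\<omega> \<in> zero_free (k / n) 1"
  shows "(real k - 1) / n \<le> last_zero V \<omega>" "last_zero V \<omega> < k / n"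
proof -
  have \<omega>: "\<omega> \<in> space M" using w by (auto simp: near_zero_def)
  obtain r where r: "r \<in> {(real k - 1) / n..k / n}" "V r \<omega> = 0"
    using w(1) \<omega> by (auto simp: near_zero_def zero_free_def)
  then have "r \<le> last_zero V \<omega>"
    using cells_bounds[OF k] by (intro last_zero_props(4)[OF \<omega>]) auto
  with r show "(real k - 1) / n \<le> last_zero V \<omega>" by simp
  show "last_zero V \<omega> < k / n"
    using last_zero_less_iff[OF \<omega>, of "k / n"] w(2) cells_bounds[OF k] by simp
qed

lemma good_cell_sets:
  assumes "k \<in> cells \<delta> n"
  shows "near_zero \<delta> n k \<in> sets M" "zero_free (k / n) 1 \<in> sets M" "closed D \<Longrightarrow> stay (k / n) 1 D \<in> sets M"
proof -
  show "near_zero \<delta> n k \<in> sets M" using near_zero_sets_past[OF assms] sets_past_subset by blast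
  show "zero_free (k / n) 1 \<in> sets M"
    using zero_free_sets_past[of "k / n" 1] cells_bounds[OF assms] sets_past_subset by auto
  show "closed D \<Longrightarrow> stay (k / n) 1 D \<in> sets M"
    using cells_bounds[OF assms] by (intro stay_sets) auto
qed

lemma good_sets: "good \<delta> n \<in> sets M"
  unfolding good_def using finite_cells good_cell_sets by (intro sets.finite_UN sets.Int) auto

text \<open>Each event confines the last zero to the half-open interval from
  \<open>(k - 1) / n\<close> to \<open>k / n\<close>, and these intervals are disjoint.\<close>

lemma disjoint_good_cells:
  "disjoint_family_on (\<lambda>k. near_zero \<delta> n k \<inter> zero_free (k / n) 1) (cells \<delta> n)"
  unfolding disjoint_family_on_def
proof (intro ballI impI)
  fix j k assume jk: "j \<in> cells \<delta> n" "k \<in> cells \<delta> n" "j \<noteq> k"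
  then have n: "0 < real n" by (auto simp: cells_def)
  have False if "\<omega> \<in> near_zero \<delta> n j" "\<omega> \<in> zero_free (j / n) 1" "\<omega> \<in> near_zero \<delta> n k" "\<omega> \<in> zero_free (k / n) 1" for \<omega>
  proof -
    have "(real j - 1) / n < k / n" "(real k - 1) / n < j / n"
      using near_zero_last_zero[OF jk(1) that(1,2)] near_zero_last_zero[OF jk(2) that(3,4)] by linarith+
    then have "real j - 1 < k" "real k - 1 < j" using n by (auto simp: divide_less_cancel)
    with jk(3) show False by linarith
  qed
  then show "near_zero \<delta> n j \<inter> zero_free (j / n) 1 \<inter> (near_zero \<delta> n k \<inter> zero_free (k / n) 1) = {}" by blast
qed

lemma prob_good: "prob (good \<delta> n) = (\<Sum>k\<in>cells \<delta> n. prob (near_zero \<delta> n k \<inter> zero_free (k / n) 1))"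
  unfolding good_def using good_cell_sets finite_cells disjoint_good_cells
  by (intro finite_measure_finite_Union) auto

text \<open>For a fixed path the cell containing the last zero \<open>g\<close> works once
  \<open>n\<close> is large: continuity at \<open>g\<close> makes the path small throughout the
  cell, and the mesh is small compared with \<open>1 - g\<close>.\<close>

lemma eventually_good:
  assumes d: "0 < \<delta>" and \<omega>: "\<omega> \<in> space M" and g1: "last_zero V \<omega> < 1"
  shows "\<forall>\<^sub>F n in sequentially. \<omega> \<in> good \<delta> n"
proof -
  define g where "g = last_zero V \<omega>"
  have g: "0 \<le> g" "g < 1" "V g \<omega> = 0" using last_zero_props[OF \<omega>] g1 by (auto simp: g_def)
  \<comment> \<open>For large \<open>n\<close> the time left after the cell is at least
    \<open>(1 - g) / 2\<close>, so this fixed bound lies below the bound in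
    \<open>near_zero\<close>, which varies with \<open>n\<close>.\<close>
  define \<beta> where "\<beta> = \<delta> * sqrt ((1 - g) / 2)"
  have \<beta>: "0 < \<beta>" using d g by (simp add: \<beta>_def)
  obtain \<rho> where \<rho>: "0 < \<rho>" "\<And>r. r \<in> {0..} \<Longrightarrow> dist r g < \<rho> \<Longrightarrow> dist (V r \<omega>) (V g \<omega>) < \<beta>"
    using continuous_V[OF \<omega>] g(1) \<beta> unfolding continuous_on_iff by (metis atLeast_iff)
  have "(\<lambda>n. 1 / real n) \<longlonglongrightarrow> 0" by (rule lim_const_over_n)
  \<comment> \<open>The three bounds serve, in order, the continuity estimate, the time left after
    the cell, and the condition in \<open>cells\<close>.\<close>
  then have "\<forall>\<^sub>F n in sequentially. 1 / real n < Min {\<rho>, (1 - g) / 2, \<delta> * (1 - g)}"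
    using \<rho>(1) g d by (intro order_tendstoD(2)) auto
  then show ?thesis using eventually_gt_at_top[of 0]
  proof eventually_elim
    case (elim n)
    then have n: "1 / real n < \<rho>" "1 / real n < (1 - g) / 2" "1 / real n < \<delta> * (1 - g)" "0 < real n" by auto
    define k where "k = nat \<lfloor>real n * g\<rfloor> + 1"
    have kr: "real k = of_int \<lfloor>real n * g\<rfloor> + 1" using g n(4) by (simp add: k_def)
    have "real k - 1 \<le> real n * g" "real n * g < real k" unfolding kr by linarith+
    then have t: "(real k - 1) / n \<le> g" "g < k / n" using n(4) by (auto simp: field_simps)
    define \<tau> where "\<tau> = real k / real n"
    have step: "(real k - 1) / n = \<tau> - 1 / n" by (simp add: \<tau>_def diff_divide_distrib)
    have t': "\<tau> - 1 / n \<le> g" "g < \<tau>" using t unfolding step \<tau>_def by auto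
    have q: "(1 - g) / 2 \<le> 1 - \<tau>"
    proof -
      have "\<tau> \<le> g + (1 - g) / 2" using t'(1) n(2) by linarith
      then show ?thesis by (simp add: field_simps)
    qed
    moreover have "0 < (1 - g) / 2" using g by simp
    ultimately have "0 < 1 - \<tau>" by (rule order_less_le_trans[rotated])
    then have \<tau>1: "\<tau> < 1" by simp
    then have kn: "1 \<le> k" "k < n" using n(4) by (auto simp: k_def \<tau>_def)
    \<comment> \<open>The linear term \<open>2 * \<delta>\<close> in the expansion of
      \<open>(1 + \<delta>)\<^sup>2\<close> already absorbs the cell width
      \<open>1 / n\<close>.\<close>
    have "1 / n \<le> 2 * \<delta> * (1 - \<tau>)"
    proof -
      have "1 / n \<le> \<delta> * (1 - g)" using n(3) by (rule less_imp_le)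
      also have "\<dots> \<le> \<delta> * (2 * (1 - \<tau>))" using d q by (intro mult_left_mono) auto
      also have "\<dots> = 2 * \<delta> * (1 - \<tau>)" by simp
      finally show ?thesis .
    qed
    moreover have "0 \<le> \<delta>\<^sup>2 * (1 - \<tau>)" using \<tau>1 by simp
    moreover have "(1 + \<delta>)\<^sup>2 * (1 - \<tau>) = (1 - \<tau>) + 2 * \<delta> * (1 - \<tau>) + \<delta>\<^sup>2 * (1 - \<tau>)"
      by (simp add: power2_eq_square algebra_simps)
    ultimately have "1 - (real k - 1) / n \<le> (1 + \<delta>)\<^sup>2 * (1 - \<tau>)" unfolding step by linarith
    with kn have k: "k \<in> cells \<delta> n" by (simp add: cells_def \<tau>_def)
    have "\<omega> \<notin> zero_free ((real k - 1) / n) (k / n)" using t g(3) by (force simp: zero_free_def)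
    moreover have "\<omega> \<in> stay ((real k - 1) / n) (k / n) {- (\<delta> * sqrt (1 - k / n))..\<delta> * sqrt (1 - k / n)}"
    proof -
      have "\<bar>V r \<omega>\<bar> \<le> \<delta> * sqrt (1 - k / n)" if r: "r \<in> {(real k - 1) / n..k / n}" for r
      proof -
        have "dist r g < \<rho>" using r t' n(1) unfolding step \<tau>_def[symmetric] dist_real_def by auto
        moreover have "0 \<le> r" using r cells_bounds(1)[OF k] by auto
        ultimately have "\<bar>V r \<omega>\<bar> \<le> \<beta>" using \<rho>(2)[of r] g(3) by (simp add: dist_real_def)
        also have "\<beta> \<le> \<delta> * sqrt (1 - k / n)" unfolding \<beta>_def using q d unfolding \<tau>_def by (intro mult_left_mono) auto
        finally show ?thesis .
      qed
      then show ?thesis using \<omega> by (auto simp: mem_stay_abs)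
    qed
    moreover have "\<omega> \<in> zero_free (k / n) 1"
      using last_zero_less_iff[OF \<omega>, of "k / n"] t(2) \<tau>1 unfolding \<tau>_def by (simp add: g_def)
    ultimately show ?case using k \<omega> by (auto simp: good_def near_zero_def)
  qed
qed

lemma prob_good_tendsto: assumes "0 < \<delta>" shows "(\<lambda>n. prob (good \<delta> n)) \<longlonglongrightarrow> 1"
proof -
  have "(\<lambda>n. \<integral>\<omega>. indicator (good \<delta> n) \<omega> \<partial>M) \<longlonglongrightarrow> (\<integral>\<omega>. (1::real) \<partial>M)"
  proof (rule integral_dominated_convergence[where w="\<lambda>_. 1"])
    show "AE \<omega> in M. (\<lambda>n. indicator (good \<delta> n) \<omega>) \<longlonglongrightarrow> (1::real)"
      using AE_last_zero_less_1 AE_space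
    proof eventually_elim
      case (elim \<omega>)
      from eventually_good[OF assms elim(2,1)] show ?case
        by (intro tendsto_eventually) (auto elim: eventually_mono)
    qed
  qed (use good_sets in \<open>auto simp: indicator_def\<close>)
  then show ?thesis using good_sets by (simp add: prob_space)
qed

text \<open>Moving the last zero to the right end of its cell shortens the remaining time by at most
  the factor \<open>(1 + \<delta>)\<^sup>2\<close>. The bound on the path is its square root times
  \<open>\<epsilon>\<close>, hence the strip of relative width
  \<open>\<epsilon> * (1 + \<delta>)\<close>. The complement of \<open>good\<close> costs a
  probability that vanishes with the mesh.\<close>

lemma meander_below_upper:
  assumes e: "0 < \<epsilon>" and d: "0 < \<delta>" "\<delta> \<le> \<epsilon>"
  shows "prob (meander_below \<epsilon>) \<le> strip_upper (\<epsilon> * (1 + \<delta>)) \<delta>"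
proof -
  define \<epsilon>' where "\<epsilon>' = \<epsilon> * (1 + \<delta>)"
  define D where "D n k = {- (\<epsilon>' * sqrt (1 - real k / real n))..\<epsilon>' * sqrt (1 - real k / real n)}" for n k :: nat
  have \<epsilon>': "\<delta> \<le> \<epsilon>'" using e d by (simp add: \<epsilon>'_def distrib_left add_increasing2)
  have "prob (meander_below \<epsilon>) \<le> strip_upper \<epsilon>' \<delta> * prob (good \<delta> n) + (1 - prob (good \<delta> n))" for n
  proof -
    have "meander_below \<epsilon> \<inter> good \<delta> n \<subseteq> (\<Union>k\<in>cells \<delta> n. near_zero \<delta> n k \<inter> zero_free (k / n) 1 \<inter> stay (k / n) 1 (D n k))"
    proof
      fix \<omega> assume w: "\<omega> \<in> meander_below \<epsilon> \<inter> good \<delta> n"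
      then obtain k where k: "k \<in> cells \<delta> n" "\<omega> \<in> near_zero \<delta> n k" "\<omega> \<in> zero_free (k / n) 1"
        by (auto simp: good_def)
      have "\<bar>V r \<omega>\<bar> \<le> \<epsilon>' * sqrt (1 - k / n)" if r: "r \<in> {k / n..1}" for r
      proof -
        note g = near_zero_last_zero[OF k]
        have "\<bar>V r \<omega>\<bar> \<le> \<epsilon> * sqrt (1 - last_zero V \<omega>)" using w r g by (auto simp: meander_below_def)
        also have "\<dots> \<le> \<epsilon> * sqrt ((1 + \<delta>)\<^sup>2 * (1 - k / n))"
          using k(1) g e by (intro mult_left_mono) (auto simp: cells_def)
        also have "\<dots> = \<epsilon>' * sqrt (1 - k / n)" using d by (simp add: real_sqrt_mult \<epsilon>'_def)
        finally show ?thesis .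
      qed
      then have "\<omega> \<in> stay (k / n) 1 (D n k)" using w by (auto simp: mem_stay_abs meander_below_def D_def)
      with k show "\<omega> \<in> (\<Union>k\<in>cells \<delta> n. near_zero \<delta> n k \<inter> zero_free (k / n) 1 \<inter> stay (k / n) 1 (D n k))" by blast
    qed
    then have "prob (meander_below \<epsilon> \<inter> good \<delta> n) \<le> prob (\<Union>k\<in>cells \<delta> n. near_zero \<delta> n k \<inter> zero_free (k / n) 1 \<inter> stay (k / n) 1 (D n k))"
      using finite_cells good_cell_sets by (intro finite_measure_mono sets.finite_UN sets.Int) (auto simp: D_def)
    also have "\<dots> \<le> (\<Sum>k\<in>cells \<delta> n. prob (near_zero \<delta> n k \<inter> zero_free (k / n) 1 \<inter> stay (k / n) 1 (D n k)))"
      using finite_cells good_cell_sets by (intro finite_measure_subadditive_finite) (auto simp: D_def)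
    also have "\<dots> \<le> (\<Sum>k\<in>cells \<delta> n. strip_upper \<epsilon>' \<delta> * prob (near_zero \<delta> n k \<inter> zero_free (k / n) 1))"
    proof (rule sum_mono)
      fix k assume k: "k \<in> cells \<delta> n"
      show "prob (near_zero \<delta> n k \<inter> zero_free (k / n) 1 \<inter> stay (k / n) 1 (D n k)) \<le> strip_upper \<epsilon>' \<delta> * prob (near_zero \<delta> n k \<inter> zero_free (k / n) 1)"
        unfolding D_def
      proof (rule prob_zero_free_strip(1)[OF _ _ d(1) \<epsilon>' near_zero_sets_past[OF k]])
        show "\<bar>V (k / n) \<omega>\<bar> \<le> \<delta> * sqrt (1 - k / n)" if "\<omega> \<in> near_zero \<delta> n k" for \<omega>
          using that cells_bounds[OF k] by (auto simp: near_zero_def mem_stay_abs)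
      qed (use cells_bounds[OF k] in auto)
    qed
    also have "\<dots> = strip_upper \<epsilon>' \<delta> * prob (good \<delta> n)" by (simp add: prob_good sum_distrib_left)
    finally have 1: "prob (meander_below \<epsilon> \<inter> good \<delta> n) \<le> strip_upper \<epsilon>' \<delta> * prob (good \<delta> n)" .
    have "prob (meander_below \<epsilon>) \<le> prob ((meander_below \<epsilon> \<inter> good \<delta> n) \<union> (space M - good \<delta> n))"
      using meander_below_sets good_sets
      by (intro finite_measure_mono) (auto simp: meander_below_def)
    also have "\<dots> \<le> prob (meander_below \<epsilon> \<inter> good \<delta> n) + prob (space M - good \<delta> n)"
      using meander_below_sets good_sets by (intro measure_Un_le) auto
    finally show ?thesis using 1 prob_compl[OF good_sets, of \<delta> n] by linarith
  qed
  moreover have "(\<lambda>n. strip_upper \<epsilon>' \<delta> * prob (good \<delta> n) + (1 - prob (good \<delta> n))) \<longlonglongrightarrow> strip_upper \<epsilon>' \<delta> * 1 + (1 - 1)"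
    by (intro tendsto_intros prob_good_tendsto d)
  ultimately have "prob (meander_below \<epsilon>) \<le> strip_upper \<epsilon>' \<delta> * 1 + (1 - 1)"
    by (intro LIMSEQ_le_const) auto
  then show ?thesis by (simp add: \<epsilon>'_def)
qed

text \<open>The right end of the cell lies after the last zero, so the strip there is narrower than
  the meander event demands. Between the last zero and that end, \<open>near_zero\<close> bounds the
  path, as \<open>\<delta> \<le> \<epsilon>\<close>. Disjointness of the cells lets the lower bounds
  be added.\<close>

lemma meander_below_lower:
  assumes d: "0 < \<delta>" "\<delta> \<le> \<epsilon>"
  shows "strip_lower \<epsilon> \<delta> \<le> prob (meander_below \<epsilon>)"
proof -
  define D where "D n k = {- (\<epsilon> * sqrt (1 - real k / real n))..\<epsilon> * sqrt (1 - real k / real n)}" for n k :: nat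
  have "strip_lower \<epsilon> \<delta> * prob (good \<delta> n) \<le> prob (meander_below \<epsilon>)" for n
  proof -
    define C where "C k = near_zero \<delta> n k \<inter> zero_free (k / n) 1 \<inter> stay (k / n) 1 (D n k)" for k
    have CM: "k \<in> cells \<delta> n \<Longrightarrow> C k \<in> sets M" for k
      unfolding C_def using good_cell_sets by (auto simp: D_def)
    have "strip_lower \<epsilon> \<delta> * prob (good \<delta> n) = (\<Sum>k\<in>cells \<delta> n. strip_lower \<epsilon> \<delta> * prob (near_zero \<delta> n k \<inter> zero_free (k / n) 1))"
      by (simp add: prob_good sum_distrib_left)
    also have "\<dots> \<le> (\<Sum>k\<in>cells \<delta> n. prob (C k))"
    proof (rule sum_mono)
      fix k assume k: "k \<in> cells \<delta> n"
      show "strip_lower \<epsilon> \<delta> * prob (near_zero \<delta> n k \<inter> zero_free (k / n) 1) \<le> prob (C k)"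
        unfolding C_def D_def
      proof (rule prob_zero_free_strip(2)[OF _ _ d near_zero_sets_past[OF k]])
        show "\<bar>V (k / n) \<omega>\<bar> \<le> \<delta> * sqrt (1 - k / n)" if "\<omega> \<in> near_zero \<delta> n k" for \<omega>
          using that cells_bounds[OF k] by (auto simp: near_zero_def mem_stay_abs)
      qed (use cells_bounds[OF k] in auto)
    qed
    also have "\<dots> = prob (\<Union>k\<in>cells \<delta> n. C k)"
    proof (rule finite_measure_finite_Union[symmetric])
      show "disjoint_family_on C (cells \<delta> n)"
        using disjoint_good_cells[of \<delta> n] unfolding disjoint_family_on_def C_def by blast
    qed (use finite_cells CM in auto)
    also have "\<dots> \<le> prob (meander_below \<epsilon>)"
    proof (rule finite_measure_mono[OF _ meander_below_sets], safe)
      fix \<omega> k assume k: "k \<in> cells \<delta> n" and w: "\<omega> \<in> C k"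
      then have \<omega>: "\<omega> \<in> space M" by (auto simp: C_def zero_free_def)
      have "\<omega> \<in> near_zero \<delta> n k" "\<omega> \<in> zero_free (k / n) 1" using w by (auto simp: C_def)
      note g = near_zero_last_zero[OF k this]
      have le: "\<delta> * sqrt (1 - k / n) \<le> \<epsilon> * sqrt (1 - k / n)" "\<epsilon> * sqrt (1 - k / n) \<le> \<epsilon> * sqrt (1 - last_zero V \<omega>)"
        using d g cells_bounds[OF k] by (auto intro!: mult_right_mono mult_left_mono)
      have "\<bar>V r \<omega>\<bar> \<le> \<epsilon> * sqrt (1 - last_zero V \<omega>)" if r: "r \<in> {last_zero V \<omega>..1}" for r
      proof (cases "r \<le> k / n")
        case True
        then have "\<bar>V r \<omega>\<bar> \<le> \<delta> * sqrt (1 - k / n)"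
          using w g r by (auto simp: C_def near_zero_def mem_stay_abs)
        with le show ?thesis by linarith
      next
        case False
        then have "\<bar>V r \<omega>\<bar> \<le> \<epsilon> * sqrt (1 - k / n)"
          using w r by (auto simp: C_def D_def mem_stay_abs)
        with le show ?thesis by linarith
      qed
      then show "\<omega> \<in> meander_below \<epsilon>" using \<omega> by (auto simp: meander_below_def)
    qed
    finally show ?thesis .
  qed
  moreover have "(\<lambda>n. strip_lower \<epsilon> \<delta> * prob (good \<delta> n)) \<longlonglongrightarrow> strip_lower \<epsilon> \<delta> * 1"
    by (intro tendsto_intros prob_good_tendsto d)
  ultimately have "strip_lower \<epsilon> \<delta> * 1 \<le> prob (meander_below \<epsilon>)"
    by (intro LIMSEQ_le_const2) auto
  then show ?thesis by simp
qed

end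

section \<open>Asymptotics\<close>

text \<open>Independence of a nonempty finite family says that the joint law is the product of the
  marginal laws, and laws do not see null sets.\<close>

lemma (in prob_space) indep_vars_cong_AE:
  assumes "finite I" "\<And>i. i \<in> I \<Longrightarrow> random_variable (N i) (Y i)"
    and "indep_vars N X I" and "\<And>i. i \<in> I \<Longrightarrow> AE \<omega> in M. X i \<omega> = Y i \<omega>"
  shows "indep_vars N Y I"
proof (cases "I = {}")
  case True
  then show ?thesis using assms(3) by (simp add: indep_vars_def2 indep_sets_def)
next
  case False
  have X: "random_variable (N i) (X i)" if "i \<in> I" for i using assms(3) that by (simp add: indep_vars_def2)
  have "distr M (Pi\<^sub>M I N) (\<lambda>\<omega>. \<lambda>i\<in>I. Y i \<omega>) = distr M (Pi\<^sub>M I N) (\<lambda>\<omega>. \<lambda>i\<in>I. X i \<omega>)"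
  proof (rule distr_cong_AE)
    have "AE \<omega> in M. \<forall>i\<in>I. X i \<omega> = Y i \<omega>" using assms(1,4) by (simp add: AE_finite_all)
    then show "AE \<omega> in M. (\<lambda>i\<in>I. Y i \<omega>) = (\<lambda>i\<in>I. X i \<omega>)" by eventually_elim auto
  qed (auto intro!: measurable_restrict assms(2) X)
  also have "\<dots> = (\<Pi>\<^sub>M i\<in>I. distr M (N i) (X i))"
    using indep_vars_iff_distr_eq_PiM'[OF False X] assms(3) by simp
  also have "\<dots> = (\<Pi>\<^sub>M i\<in>I. distr M (N i) (Y i))"
    using assms by (intro PiM_cong refl distr_cong_AE X) auto
  finally show ?thesis using indep_vars_iff_distr_eq_PiM'[OF False assms(2)] by simp
qed

text \<open>All exceptional paths lie in one measurable null set, on which the path is replaced by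
  0. This set is the same for all times, so almost surely the entire paths agree, as the last zero
  and the supremum require.\<close>

lemma continuous_modification:
  assumes "standard_brownian_motion M W"
  obtains V where "continuous_brownian_motion M V" "AE \<omega> in M. \<forall>t. V t \<omega> = W t \<omega>"
proof -
  interpret prob_space M using assms by (simp add: standard_brownian_motion_def)
  have W: "\<And>t. 0 \<le> t \<Longrightarrow> W t \<in> borel_measurable M"
    "AE \<omega> in M. W 0 \<omega> = 0"
    "\<And>(n::nat) t. 0 \<le> t 0 \<Longrightarrow> (\<And>i. i < n \<Longrightarrow> t i \<le> t (Suc i)) \<Longrightarrow>
        indep_vars (\<lambda>_. borel) (\<lambda>i \<omega>. W (t (Suc i)) \<omega> - W (t i) \<omega>) {..<n}"
    "\<And>s t. 0 \<le> s \<Longrightarrow> s < t \<Longrightarrow> distributed M lborel (\<lambda>\<omega>. W t \<omega> - W s \<omega>) (normal_density 0 (sqrt (t - s)))"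
    "AE \<omega> in M. continuous_on {0..} (\<lambda>t. W t \<omega>)"
    using assms unfolding standard_brownian_motion_def by blast+
  have "AE \<omega> in M. W 0 \<omega> = 0 \<and> continuous_on {0..} (\<lambda>t. W t \<omega>)" using W(2,5) by eventually_elim simp
  then obtain N where N: "{\<omega> \<in> space M. \<not> (W 0 \<omega> = 0 \<and> continuous_on {0..} (\<lambda>t. W t \<omega>))} \<subseteq> N"
    "N \<in> sets M" "emeasure M N = 0"
    by (rule AE_E)
  define V where "V t \<omega> = (if \<omega> \<in> N then 0 else W t \<omega>)" for t \<omega>
  have "AE \<omega> in M. \<omega> \<notin> N" using N by (intro AE_not_in) auto
  then have eq: "AE \<omega> in M. \<forall>t. V t \<omega> = W t \<omega>" by eventually_elim (simp add: V_def)
  have mV: "V t \<in> borel_measurable M" if "0 \<le> t" for t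
    unfolding V_def using W(1)[OF that] N(2) by measurable
  have "continuous_brownian_motion M V"
  proof unfold_locales
    show "V t \<in> borel_measurable M" if "0 \<le> t" for t by (rule mV[OF that])
    show "V 0 \<omega> = 0" if "\<omega> \<in> space M" for \<omega> using that N(1) by (auto simp: V_def)
    show "continuous_on {0..} (\<lambda>t. V t \<omega>)" if "\<omega> \<in> space M" for \<omega>
      using that N(1) by (cases "\<omega> \<in> N") (auto simp: V_def)
  next
    fix n :: nat and t :: "nat \<Rightarrow> real"
    assume t: "0 \<le> t 0" "\<And>i. i < n \<Longrightarrow> t i \<le> t (Suc i)"
    have t0: "0 \<le> t i" if "i \<le> n" for i using that
    proof (induction i)
      case (Suc i) then show ?case using t(2)[of i] by auto
    qed (use t in simp)
    show "indep_vars (\<lambda>_. borel) (\<lambda>i \<omega>. V (t (Suc i)) \<omega> - V (t i) \<omega>) {..<n}"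
    proof (rule indep_vars_cong_AE[OF _ _ W(3)[OF t]])
      show "AE \<omega> in M. W (t (Suc i)) \<omega> - W (t i) \<omega> = V (t (Suc i)) \<omega> - V (t i) \<omega>" for i
        using eq by eventually_elim simp
    qed (auto intro!: borel_measurable_diff mV t0)
  next
    fix s t :: real assume st: "0 \<le> s" "s < t"
    have m: "(\<lambda>\<omega>. V t \<omega> - V s \<omega>) \<in> borel_measurable M" using st by (intro borel_measurable_diff mV) auto
    have "distr M lborel (\<lambda>\<omega>. V t \<omega> - V s \<omega>) = distr M lborel (\<lambda>\<omega>. W t \<omega> - W s \<omega>)"
    proof (rule distr_cong_AE)
      show "AE \<omega> in M. V t \<omega> - V s \<omega> = W t \<omega> - W s \<omega>" using eq by eventually_elim simp
    qed (use m W(1)[of t] W(1)[of s] st in auto)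
    then show "distributed M lborel (\<lambda>\<omega>. V t \<omega> - V s \<omega>) (normal_density 0 (sqrt (t - s)))"
      using W(4)[OF st] m by (simp add: distributed_def)
  qed
  then show ?thesis using eq by (rule that)
qed

context continuous_brownian_motion
begin

text \<open>For \<open>g < 1\<close> the time change maps \<open>[0, 1]\<close> onto
  \<open>[g, 1]\<close> and the divisor is positive. Continuity makes the meander bounded, so its
  supremum is at most \<open>\<epsilon>\<close> exactly if all values are.\<close>

lemma path_sup_meander_le_iff:
  assumes \<omega>: "\<omega> \<in> space M" and g1: "last_zero V \<omega> < 1"
  shows "path_sup (\<lambda>u. brownian_meander V u \<omega>) \<le> \<epsilon> \<longleftrightarrow> \<omega> \<in> meander_below \<epsilon>"
proof -
  define g where "g = last_zero V \<omega>"
  have g: "0 \<le> g" "g < 1" using last_zero_props[OF \<omega>] g1 by (auto simp: g_def)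
  have range: "(\<lambda>u. g + u * (1 - g)) ` {0..1} = {g..1}"
  proof (intro equalityI subsetI)
    fix r assume "r \<in> (\<lambda>u. g + u * (1 - g)) ` {0..1}"
    then obtain u where u: "0 \<le> u" "u \<le> 1" "r = g + u * (1 - g)" by auto
    then have "u * (1 - g) \<le> 1 * (1 - g)" "0 \<le> u * (1 - g)" using g by (auto intro!: mult_right_mono)
    then show "r \<in> {g..1}" using u(3) by simp
  next
    fix r assume "r \<in> {g..1}"
    then show "r \<in> (\<lambda>u. g + u * (1 - g)) ` {0..1}"
      using g by (intro image_eqI[of _ _ "(r - g) / (1 - g)"]) auto
  qed
  have "continuous_on {g..1} (\<lambda>r. \<bar>V r \<omega>\<bar>)"
    using g by (intro continuous_on_rabs continuous_on_subset[OF continuous_V[OF \<omega>]]) auto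
  then have "continuous_on {0..1} (\<lambda>u. \<bar>V (g + u * (1 - g)) \<omega>\<bar>)"
    by (rule continuous_on_compose2) (use range in \<open>auto intro!: continuous_intros\<close>)
  then have "continuous_on {0..1} (\<lambda>u. brownian_meander V u \<omega>)"
    unfolding brownian_meander_def g_def[symmetric] using g by (intro continuous_on_divide continuous_on_const) auto
  then have "bdd_above ((\<lambda>u. brownian_meander V u \<omega>) ` {0..1})"
    by (intro bounded_imp_bdd_above compact_imp_bounded compact_continuous_image) auto
  then have "path_sup (\<lambda>u. brownian_meander V u \<omega>) \<le> \<epsilon> \<longleftrightarrow> (\<forall>u\<in>{0..1}. brownian_meander V u \<omega> \<le> \<epsilon>)"
    unfolding path_sup_def by (intro cSUP_le_iff) auto
  also have "\<dots> \<longleftrightarrow> (\<forall>u\<in>{0..1}. \<bar>V (g + u * (1 - g)) \<omega>\<bar> \<le> \<epsilon> * sqrt (1 - g))"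
    unfolding brownian_meander_def g_def[symmetric] using g by (simp add: divide_le_eq)
  also have "\<dots> \<longleftrightarrow> (\<forall>r\<in>(\<lambda>u. g + u * (1 - g)) ` {0..1}. \<bar>V r \<omega>\<bar> \<le> \<epsilon> * sqrt (1 - g))"
    by simp
  finally show ?thesis unfolding range using \<omega> by (simp add: meander_below_def g_def)
qed

text \<open>The event for \<open>W\<close> need not be measurable in \<open>M\<close>, but it
  differs from \<open>meander_below\<close> only inside a null set. So it is measurable in the
  completion, with the same probability.\<close>

lemma path_prob_meander:
  assumes eq: "AE \<omega> in M. \<forall>t. V t \<omega> = W t \<omega>"
  shows "path_prob M (\<lambda>\<omega>. path_sup (\<lambda>u. brownian_meander W u \<omega>) \<le> \<epsilon>) = prob (meander_below \<epsilon>)"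
proof -
  define S where "S = {\<omega> \<in> space M. path_sup (\<lambda>u. brownian_meander W u \<omega>) \<le> \<epsilon>}"
  have ae: "AE \<omega> in M. \<omega> \<in> S \<longleftrightarrow> \<omega> \<in> meander_below \<epsilon>"
    using eq AE_last_zero_less_1 AE_space
  proof eventually_elim
    case (elim \<omega>)
    then have "brownian_meander W u \<omega> = brownian_meander V u \<omega>" for u
      unfolding brownian_meander_def last_zero_def by simp
    then show ?case using path_sup_meander_le_iff[OF elim(3,2), of \<epsilon>] elim(3) by (simp add: S_def)
  qed
  then obtain N where N: "{\<omega> \<in> space M. \<not> (\<omega> \<in> S \<longleftrightarrow> \<omega> \<in> meander_below \<epsilon>)} \<subseteq> N" "N \<in> null_sets M"
    by (auto elim!: AE_E simp: null_sets_def)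
  have SM: "S \<in> sets (completion M)"
  proof (rule sets_completionI)
    show "S = (meander_below \<epsilon> - N) \<union> (S \<inter> N)"
      using N(1) by (auto simp: S_def meander_below_def)
    show "S \<inter> N \<subseteq> N" by simp
  qed (use N(2) meander_below_sets in auto)
  have "measure (completion M) S = measure (completion M) (meander_below \<epsilon>)"
    by (rule measure_eq_AE[OF AE_completion[OF ae] SM]) (use meander_below_sets in auto)
  then show ?thesis unfolding path_prob_def S_def[symmetric] using meander_below_sets by simp
qed

end

section \<open>Letting \<open>\<delta>\<close> and then \<open>\<epsilon>\<close> tend to 0\<close>

lemma std_normal_density_0: "std_normal_density 0 = 1 / sqrt (2 * pi)"
  by (simp add: std_normal_density_def)

lemma strip_lower_tendsto:
  assumes e: "0 < \<epsilon>"
  shows "(strip_lower \<epsilon> \<longlongrightarrow> 2 * sqrt (2 * pi) / \<epsilon> * exp (- (pi\<^sup>2 / (2 * \<epsilon>\<^sup>2))) * (1 - wave_rest (1 / \<epsilon>\<^sup>2))) (at_right 0)"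
proof -
  have "((\<lambda>\<delta>. cos (pi * \<delta> / \<epsilon>)) \<longlongrightarrow> cos (pi * 0 / \<epsilon>)) (at_right 0)"
    using e by (intro tendsto_intros) auto
  then have "((\<lambda>\<delta>. 2 / (\<epsilon> * std_normal_density 0) * exp (- (pi\<^sup>2 / (2 * \<epsilon>\<^sup>2))) * (cos (pi * \<delta> / \<epsilon>) - wave_rest (1 / \<epsilon>\<^sup>2)))
     \<longlongrightarrow> 2 / (\<epsilon> * std_normal_density 0) * exp (- (pi\<^sup>2 / (2 * \<epsilon>\<^sup>2))) * (cos (pi * 0 / \<epsilon>) - wave_rest (1 / \<epsilon>\<^sup>2))) (at_right 0)"
    by (intro tendsto_mult tendsto_diff tendsto_const)
  then show ?thesis unfolding strip_lower_def[abs_def] std_normal_density_0 by (simp add: field_simps)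
qed

lemma strip_upper_tendsto:
  assumes e: "0 < \<epsilon>"
  shows "((\<lambda>\<delta>. strip_upper (\<epsilon> * (1 + \<delta>)) \<delta>) \<longlongrightarrow> 2 * sqrt (2 * pi) / \<epsilon> * exp (- (pi\<^sup>2 / (2 * \<epsilon>\<^sup>2))) * (1 + wave_rest (1 / \<epsilon>\<^sup>2))) (at_right 0)"
proof -
  have "isCont (\<lambda>\<delta>. strip_upper (\<epsilon> * (1 + \<delta>)) \<delta>) 0"
    unfolding strip_upper_def wave_rest_def std_normal_density_def
    using e by (intro continuous_intros) auto
  then have "((\<lambda>\<delta>. strip_upper (\<epsilon> * (1 + \<delta>)) \<delta>) \<longlongrightarrow> strip_upper (\<epsilon> * (1 + 0)) 0) (at_right 0)"
    unfolding isCont_def by (rule filterlim_at_split[THEN iffD1, THEN conjunct2])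
  then show ?thesis unfolding strip_upper_def std_normal_density_0 by (simp add: field_simps)
qed

lemma wave_rest_tendsto: "((\<lambda>\<epsilon>. wave_rest (1 / \<epsilon>\<^sup>2)) \<longlongrightarrow> 0) (at_right 0)"
proof -
  have "((\<lambda>\<epsilon>. exp (- (4 * pi\<^sup>2 * (1 / \<epsilon>\<^sup>2))) :: real) \<longlongrightarrow> 0) (at_right 0)" by real_asymp
  then have "((\<lambda>\<epsilon>. exp (- (4 * pi\<^sup>2 * (1 / \<epsilon>\<^sup>2))) / (1 - exp (- (4 * pi\<^sup>2 * (1 / \<epsilon>\<^sup>2))))) \<longlongrightarrow> 0 / (1 - 0)) (at_right (0::real))"
    by (intro tendsto_divide tendsto_diff tendsto_const) auto
  then show ?thesis unfolding wave_rest_def by simp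
qed

theorem proposition13:
  fixes M :: "'a measure" and W :: "real \<Rightarrow> 'a \<Rightarrow> real"
  assumes "standard_brownian_motion M W"
  shows "asymp_equiv
    (\<lambda>\<epsilon>::real. path_prob M (\<lambda>\<omega>. path_sup (\<lambda>u. brownian_meander W u \<omega>) \<le> \<epsilon>))
    (at_right 0)
    (\<lambda>\<epsilon>::real. 2 * sqrt (2 * pi) / \<epsilon> * exp (- (pi\<^sup>2 / (2 * \<epsilon>\<^sup>2))))"
proof -
  obtain V where V: "continuous_brownian_motion M V" and eq: "AE \<omega> in M. \<forall>t. V t \<omega> = W t \<omega>"
    by (rule continuous_modification[OF assms])
  interpret continuous_brownian_motion M V by (rule V)
  define \<psi> where "\<psi> \<epsilon> = 2 * sqrt (2 * pi) / \<epsilon> * exp (- (pi\<^sup>2 / (2 * \<epsilon>\<^sup>2)))" for \<epsilon> :: real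
  have \<psi>: "0 < \<psi> \<epsilon>" if "0 < \<epsilon>" for \<epsilon> using that by (simp add: \<psi>_def)
  \<comment> \<open>Here \<open>\<epsilon>\<close> is fixed and \<open>\<delta>\<close> tends to 0
    in the upper and lower bounds, while the probability of the meander event does not involve
    \<open>\<delta>\<close>.\<close>
  have bounds: "1 - wave_rest (1 / \<epsilon>\<^sup>2) \<le> prob (meander_below \<epsilon>) / \<psi> \<epsilon>"
    "prob (meander_below \<epsilon>) / \<psi> \<epsilon> \<le> 1 + wave_rest (1 / \<epsilon>\<^sup>2)" if e: "0 < \<epsilon>" for \<epsilon>
  proof -
    have ev: "\<forall>\<^sub>F \<delta> in at_right 0. 0 < \<delta> \<and> \<delta> \<le> \<epsilon>"
      using e eventually_at_right[OF e] by (auto intro!: exI[of _ \<epsilon>])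
    have "\<forall>\<^sub>F \<delta> in at_right 0. strip_lower \<epsilon> \<delta> \<le> prob (meander_below \<epsilon>)"
      using ev by eventually_elim (auto intro: meander_below_lower)
    then have "\<psi> \<epsilon> * (1 - wave_rest (1 / \<epsilon>\<^sup>2)) \<le> prob (meander_below \<epsilon>)"
      unfolding \<psi>_def by (rule tendsto_upperbound[OF strip_lower_tendsto[OF e]]) simp
    moreover have "\<forall>\<^sub>F \<delta> in at_right 0. prob (meander_below \<epsilon>) \<le> strip_upper (\<epsilon> * (1 + \<delta>)) \<delta>"
      using ev by eventually_elim (use e in \<open>auto intro: meander_below_upper\<close>)
    then have "prob (meander_below \<epsilon>) \<le> \<psi> \<epsilon> * (1 + wave_rest (1 / \<epsilon>\<^sup>2))"
      unfolding \<psi>_def by (rule tendsto_lowerbound[OF strip_upper_tendsto[OF e]]) simp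
    ultimately show "1 - wave_rest (1 / \<epsilon>\<^sup>2) \<le> prob (meander_below \<epsilon>) / \<psi> \<epsilon>"
      "prob (meander_below \<epsilon>) / \<psi> \<epsilon> \<le> 1 + wave_rest (1 / \<epsilon>\<^sup>2)"
      using \<psi>[OF e] by (simp_all add: le_divide_eq divide_le_eq mult.commute)
  qed
  have "((\<lambda>\<epsilon>. prob (meander_below \<epsilon>) / \<psi> \<epsilon>) \<longlongrightarrow> 1) (at_right 0)"
  proof (rule tendsto_sandwich)
    show "\<forall>\<^sub>F \<epsilon> in at_right 0. 1 - wave_rest (1 / \<epsilon>\<^sup>2) \<le> prob (meander_below \<epsilon>) / \<psi> \<epsilon>"
      "\<forall>\<^sub>F \<epsilon> in at_right 0. prob (meander_below \<epsilon>) / \<psi> \<epsilon> \<le> 1 + wave_rest (1 / \<epsilon>\<^sup>2)"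
      using bounds by (auto intro: eventually_mono[OF eventually_at_right_less])
    show "((\<lambda>\<epsilon>. 1 - wave_rest (1 / \<epsilon>\<^sup>2)) \<longlongrightarrow> 1) (at_right 0)"
      using tendsto_diff[OF tendsto_const wave_rest_tendsto, of 1] by simp
    show "((\<lambda>\<epsilon>. 1 + wave_rest (1 / \<epsilon>\<^sup>2)) \<longlongrightarrow> 1) (at_right 0)"
      using tendsto_add[OF tendsto_const wave_rest_tendsto, of 1] by simp
  qed
  then have "asymp_equiv (\<lambda>\<epsilon>. prob (meander_below \<epsilon>)) (at_right 0) \<psi>"
    by (rule asymp_equivI')
  then show ?thesis unfolding path_prob_meander[OF eq] \<psi>_def .
qed

end
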